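(* Let $n\ge 1$. Then the poset $(\mathcal{W}(B_n),\leqslant)$ is graded, with rank function $\ell_{\mathcal{W}}$, and its rank is $n^2-\lfloor n/2\rfloor^2$.
   Context: For $k\ge1$, $B_k$ is the group of bijections $w$ of $[\pm k]=\{-k,\dots,-1,1,\dots,k\}$ with $w(-a)=-w(a)$, written in window notation $[w(1),\dots,w(k)]$. It is a Coxeter group with generators $(1,-1)$ and $(a,a+1)(-a,-a-1)$, $a\in[k-1]$, acting on the right; its length is $\ell_B(w)=\mathrm{inv}(w)+\mathrm{neg}(w)+\mathrm{nsp}(w)$ where $\mathrm{inv}(w)=|\{(a,b):1\le a<b\le k,\ w(a)>w(b)\}|$, $\mathrm{neg}(w)=|\{a\in[k]:w(a)<0\}|$, $\mathrm{nsp}(w)=|\{(a,b):1\le a<b\le k,\ w(a)+w(b)<0\}|$; $\leqslant$ is Bruhat order. For $a\in[n]$ let $a^*=a-1$ if $a$ is even, $a^*=a+1$ if $a$ is odd and $a+1\le n$, $a^*=n$ otherwise. The signed Wachs permutations are $\mathcal{W}(B_n)=\{v\in B_n: |v^{-1}(a)-v^{-1}(a^* )|\le1\ \forall a\in[n-1]\}$ (here $v^{-1}(a)\in[\pm n]$), with the induced Bruhat order. Let $\chi(P)=1$ if $P$ holds and $0$ otherwise. For $n=2m$: given $\sigma\in B_m$, $T\subseteq[m]$, define $v\in B_{2m}$ by $v(2i-1)=2\sigma(i)-\chi(\sigma(i)>0)$, $v(2i)=2\sigma(i)+\chi(\sigma(i)<0)$ if $i\notin T$, and $v(2i-1)=2\sigma(i)+\chi(\sigma(i)<0)$,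 $v(2i)=2\sigma(i)-\chi(\sigma(i)>0)$ if $i\in T$; this is a bijection $B_m\times\mathcal{P}([m])\to\mathcal{W}(B_{2m})$, and we write $v=(\sigma,T)$. For $n=2m+1$: for $v\in\mathcal{W}(B_{2m+1})$ let $p\in[\pm(2m+1)]$ with $v(p)=2m+1$ (so the entry $\mathrm{sgn}(p)(2m+1)$ occupies window position $|p|$), let $\bar v\in\mathcal{W}(B_{2m})$ be obtained by deleting this entry from the window of $v$, write $\bar v=(\sigma,S)$ and $v=(i,\sigma,S)$ with $i=(p+\mathrm{sgn}(p))/2\in[\pm(m+1)]$ (a bijection $\mathcal{W}(B_{2m+1})\to[\pm(m+1)]\times B_m\times\mathcal{P}([m])$). In both cases $\ell_{\mathcal{W}}(v)=\ell_B(v)-\ell_B(\sigma)$. *)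

theory Defs
  imports "HOL-Combinatorics.Permutations"
begin

section \<open>Signed permutations and Bruhat order\<close>

definition signed_range :: "nat \<Rightarrow> int set" where
  "signed_range k = {- int k..int k} - {0}"

text \<open>As usual for \<^const>\<open>permutes\<close>, a signed permutation is the identity outside
  \<open>signed_range k\<close>; the group operation is composition.\<close>

definition signed_perms :: "nat \<Rightarrow> (int \<Rightarrow> int) set" where
  "signed_perms k = {w. w permutes signed_range k \<and> (\<forall>a\<in>signed_range k. w (- a) = - w a)}"

text \<open>The odd function on \<open>signed_range k\<close> with window \<open>[f 1, \<dots>, f k]\<close>.\<close>

definition of_window :: "nat \<Rightarrow> (int \<Rightarrow> int) \<Rightarrow> int \<Rightarrow> int" where
  "of_window k f x =
     (if 1 \<le> x \<and> x \<le> int k then f x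
      else if - int k \<le> x \<and> x \<le> -1 then - f (- x)
      else x)"

definition inv_count :: "nat \<Rightarrow> (int \<Rightarrow> int) \<Rightarrow> nat" where
  "inv_count k w = card {(a, b). 1 \<le> a \<and> a < b \<and> b \<le> int k \<and> w a > w b}"

definition neg_count :: "nat \<Rightarrow> (int \<Rightarrow> int) \<Rightarrow> nat" where
  "neg_count k w = card {a \<in> {1..int k}. w a < 0}"

definition nsp_count :: "nat \<Rightarrow> (int \<Rightarrow> int) \<Rightarrow> nat" where
  "nsp_count k w = card {(a, b). 1 \<le> a \<and> a < b \<and> b \<le> int k \<and> w a + w b < 0}"

definition length_B :: "nat \<Rightarrow> (int \<Rightarrow> int) \<Rightarrow> nat" where
  "length_B k w = inv_count k w + neg_count k w + nsp_count k w"

definition generators_B :: "nat \<Rightarrow> (int \<Rightarrow> int) set" where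
  "generators_B k =
     {s. k \<ge> 1 \<and> s = transpose 1 (- 1)} \<union>
     {transpose a (a + 1) \<circ> transpose (- a) (- a - 1) | a. 1 \<le> a \<and> a \<le> int k - 1}"

definition reflections_B :: "nat \<Rightarrow> (int \<Rightarrow> int) set" where
  "reflections_B k = {w \<circ> s \<circ> inv w | w s. w \<in> signed_perms k \<and> s \<in> generators_B k}"

definition bruhat_step :: "nat \<Rightarrow> ((int \<Rightarrow> int) \<times> (int \<Rightarrow> int)) set" where
  "bruhat_step k =
     {(u, u \<circ> t) | u t. u \<in> signed_perms k \<and> t \<in> reflections_B k \<and> length_B k u < length_B k (u \<circ> t)}"

definition bruhat :: "nat \<Rightarrow> ((int \<Rightarrow> int) \<times> (int \<Rightarrow> int)) set" where
  "bruhat k = Restr ((bruhat_step k)\<^sup>*) (signed_perms k)"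


section \<open>Signed Wachs permutations\<close>

definition star :: "nat \<Rightarrow> int \<Rightarrow> int" where
  "star n a = (if even a then a - 1 else if a + 1 \<le> int n then a + 1 else int n)"

definition wachs :: "nat \<Rightarrow> (int \<Rightarrow> int) set" where
  "wachs n = {v \<in> signed_perms n. \<forall>a\<in>{1..int n - 1}. \<bar>inv v a - inv v (star n a)\<bar> \<le> 1}"

definition wachs_order :: "nat \<Rightarrow> ((int \<Rightarrow> int) \<times> (int \<Rightarrow> int)) set" where
  "wachs_order n = Restr (bruhat n) (wachs n)"

text \<open>The element \<open>(\<sigma>, T)\<close>; window position \<open>x\<close> is \<open>2 i - 1\<close> or \<open>2 i\<close> with \<open>i = (x + 1) div 2\<close>.\<close>

definition wachs_even :: "nat \<Rightarrow> (int \<Rightarrow> int) \<Rightarrow> int set \<Rightarrow> int \<Rightarrow> int" where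
  "wachs_even m \<sigma> T = of_window (2 * m) (\<lambda>x.
     let i = (x + 1) div 2 in
     if i \<notin> T then
       (if odd x then 2 * \<sigma> i - of_bool (\<sigma> i > 0) else 2 * \<sigma> i + of_bool (\<sigma> i < 0))
     else
       (if odd x then 2 * \<sigma> i + of_bool (\<sigma> i < 0) else 2 * \<sigma> i - of_bool (\<sigma> i > 0)))"

definition even_component :: "nat \<Rightarrow> (int \<Rightarrow> int) \<Rightarrow> int \<Rightarrow> int" where
  "even_component m v =
     (THE \<sigma>. \<sigma> \<in> signed_perms m \<and> (\<exists>T. T \<subseteq> {1..int m} \<and> v = wachs_even m \<sigma> T))"

text \<open>Deletes from the window of \<open>v\<close>, of length \<open>n\<close>, the entry of absolute value \<open>n\<close>.\<close>

definition delete_max :: "nat \<Rightarrow> (int \<Rightarrow> int) \<Rightarrow> int \<Rightarrow> int" where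
  "delete_max n v =
     (let p = inv v (int n) in
      of_window (n - 1) (\<lambda>x. if x < \<bar>p\<bar> then v x else v (x + 1)))"

text \<open>The component \<open>\<sigma>\<close> of \<open>v = (\<sigma>, T)\<close> or \<open>v = (i, \<sigma>, S)\<close>.\<close>

definition wachs_component :: "nat \<Rightarrow> (int \<Rightarrow> int) \<Rightarrow> int \<Rightarrow> int" where
  "wachs_component n v = even_component (n div 2) (if even n then v else delete_max n v)"

definition length_W :: "nat \<Rightarrow> (int \<Rightarrow> int) \<Rightarrow> int" where
  "length_W n v = int (length_B n v) - int (length_B (n div 2) (wachs_component n v))"


section \<open>Graded posets\<close>

definition covered_by :: "'a set \<Rightarrow> ('a \<times> 'a) set \<Rightarrow> 'a \<Rightarrow> 'a \<Rightarrow> bool" where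
  "covered_by P r x y \<longleftrightarrow>
     x \<in> P \<and> y \<in> P \<and> (x, y) \<in> r \<and> x \<noteq> y \<and>
     (\<forall>z\<in>P. (x, z) \<in> r \<and> (z, y) \<in> r \<longrightarrow> z = x \<or> z = y)"

definition minimal_in :: "'a set \<Rightarrow> ('a \<times> 'a) set \<Rightarrow> 'a \<Rightarrow> bool" where
  "minimal_in P r x \<longleftrightarrow> x \<in> P \<and> (\<forall>y\<in>P. (y, x) \<in> r \<longrightarrow> y = x)"

text \<open>A poset is graded of rank \<open>N\<close> if all its maximal chains have length \<open>N\<close>,
  that is, \<open>N + 1\<close> elements.\<close>

definition graded_poset :: "'a set \<Rightarrow> ('a \<times> 'a) set \<Rightarrow> nat \<Rightarrow> bool" where
  "graded_poset P r N \<longleftrightarrow>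
     partial_order_on P r \<and>
     (\<forall>C. pred_on.maxchain P (\<lambda>x y. (x, y) \<in> r) C \<longrightarrow> finite C \<and> card C = N + 1)"

definition rank_function :: "'a set \<Rightarrow> ('a \<times> 'a) set \<Rightarrow> ('a \<Rightarrow> int) \<Rightarrow> bool" where
  "rank_function P r \<rho> \<longleftrightarrow>
     (\<forall>x. minimal_in P r x \<longrightarrow> \<rho> x = 0) \<and>
     (\<forall>x y. covered_by P r x y \<longrightarrow> \<rho> y = \<rho> x + 1)"

end

theory Submission
  imports Defs
begin

text \<open>
  Bruhat order on signed permutations is the pointwise order of the rank counts
  \<open>#{x < c. w x \<ge> b}\<close>. A signed Wachs permutation of even size is a signed permutation \<open>s\<close> of half the
  size in which every entry is replaced by a block of two adjacent values, some of the blocks being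
  reversed; for odd size, the largest entry is inserted between two blocks. In terms of the rank
  counts, any relation \<open>u < v\<close> between Wachs permutations can be refined by one of three moves which
  raise the length by one: reverse a block; apply a Bruhat cover to \<open>s\<close> and put the moved blocks,
  all of them reversed before, back in increasing order; or move the largest entry one slot to the
  left. Together with the identity and the longest element as bottom and top this yields gradedness.
\<close>

section \<open>Ranks and reflections in centred coordinates\<close>

text \<open>A subset of Bruhat order need not be graded in the induced order, and here one cover of
  \<open>s\<close> with all reversed blocks kept raises the rank by 2 or 3. Gradedness only asks,
  for \<open>u < v\<close>, for some element of the subset above \<open>u\<close> and below or equal
  to \<open>v\<close> whose rank exceeds that of \<open>u\<close> by one. The rank counts of
  \<open>dbl s S\<close> decide which one to take: they depend on \<open>s\<close> alone except at
  \<open>(2 c + 1, 2 b + 1)\<close> with \<open>s c = b\<close>, where a reversed block adds one. A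
  cover of \<open>s\<close> raises these corner ranks at the blocks that it moves. So either some
  block still has room to be reversed, or all moved blocks are reversed; putting these back in
  increasing order gives back 1 or 2, and a gain of one is left. All lengths are doubled, because on
  the symmetric interval an inversion and its mirror image are both counted; the elementary moves
  therefore raise the doubled length by 2.\<close>

text \<open>The coordinate change \<open>x \<mapsto> x\<close> for \<open>x < 0\<close>, \<open>x \<mapsto> x - 1\<close> for \<open>x > 0\<close> closes the gap at \<open>0\<close>; it turns
  \<open>x \<mapsto> - x\<close> into \<open>x \<mapsto> - 1 - x\<close>, and the pairs \<open>{2 i - 1, 2 i}\<close> and their negatives into the
  blocks \<open>{2 k, 2 k + 1}\<close>.\<close>

definition centred :: "nat \<Rightarrow> (int \<Rightarrow> int) set" where
  "centred k = {w. w permutes {- int k..<int k} \<and> (\<forall>x. w (- 1 - x) = - 1 - w x)}"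

text \<open>All integers are allowed as positions and as cuts, so that the recurrences in
  \<open>c\<close> and \<open>b\<close> have no boundary cases; the set stays finite because a
  centred \<open>w\<close> fixes everything far to the left.\<close>

definition rk :: "(int \<Rightarrow> int) \<Rightarrow> int \<Rightarrow> int \<Rightarrow> int" where
  "rk w c b = int (card {x. x < c \<and> b \<le> w x})"

definition rk_le :: "(int \<Rightarrow> int) \<Rightarrow> (int \<Rightarrow> int) \<Rightarrow> bool" where
  "rk_le u v \<longleftrightarrow> (\<forall>c b. rk u c b \<le> rk v c b)"

text \<open>For \<open>b = - 1 - a\<close> the two transpositions coincide, so their product would be the identity.\<close>

definition mrefl :: "int \<Rightarrow> int \<Rightarrow> int \<Rightarrow> int" where
  "mrefl a b = (if b = - 1 - a then transpose a b
              else transpose a b \<circ> transpose (- 1 - b) (- 1 - a))"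

text \<open>An inversion and its mirror image are both counted, so this is close to twice the
  length; \<open>length_B_centre\<close> gives the exact relation.\<close>

definition invs :: "nat \<Rightarrow> (int \<Rightarrow> int) \<Rightarrow> int" where
  "invs k w = (\<Sum>x\<in>{- int k..<int k}. \<Sum>y\<in>{- int k..<int k}. of_bool (x < y \<and> w y < w x))"

lemma no_self_mirror [simp]:
  "- 1 \<noteq> 2 * (a :: int)" "2 * (a :: int) \<noteq> - 1"
  by presburger+

lemma centredD:
  assumes "w \<in> centred k"
  shows "w permutes {- int k..<int k}" "w (- 1 - x) = - 1 - w x" "inj w" "bij w"
    "x < - int k \<or> int k \<le> x \<Longrightarrow> w x = x" "w x = w y \<longleftrightarrow> x = y"
    "- int k \<le> w x \<longleftrightarrow> - int k \<le> x" "w x < int k \<longleftrightarrow> x < int k"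
proof -
  show p: "w permutes {- int k..<int k}" and "w (- 1 - x) = - 1 - w x"
    using assms by (auto simp: centred_def)
  show "inj w" "bij w" using p permutes_inj permutes_bij by auto
  then show "w x = w y \<longleftrightarrow> x = y" by (auto dest: injD)
  show *: "w x = x" if "x < - int k \<or> int k \<le> x" for x
    using p that by (auto simp: permutes_def)
  have **: "w x \<in> {- int k..<int k} \<longleftrightarrow> x \<in> {- int k..<int k}"
    using permutes_in_image[OF p] .
  show "- int k \<le> w x \<longleftrightarrow> - int k \<le> x" "w x < int k \<longleftrightarrow> x < int k"
    using *[of x] ** by fastforce+
qed

lemma finite_rk: "w \<in> centred k \<Longrightarrow> finite {x. x < c \<and> b \<le> w x}"
proof (rule finite_subset)
  assume w: "w \<in> centred k"
  show "{x. x < c \<and> b \<le> w x} \<subseteq> {min b (- int k)..<c}"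
  proof
    fix x assume "x \<in> {x. x < c \<and> b \<le> w x}"
    then show "x \<in> {min b (- int k)..<c}"
      using centredD(5)[OF w, of x] by (cases "x < - int k") auto
  qed
qed simp

lemma rk_Suc_pos:
  assumes "w \<in> centred k"
  shows "rk w (c + 1) b = rk w c b + of_bool (b \<le> w c)"
proof -
  have "{x. x < c + 1 \<and> b \<le> w x} =
      (if b \<le> w c then insert c {x. x < c \<and> b \<le> w x} else {x. x < c \<and> b \<le> w x})"
    by (auto simp: order_less_le)
  then show ?thesis using finite_rk[OF assms, of c b] by (simp add: rk_def)
qed

lemma rk_Suc_val:
  assumes "w \<in> centred k"
  shows "rk w c b = rk w c (b + 1) + of_bool (inv w b < c)"
proof -
  have i: "w (inv w b) = b" "\<And>x. w x = b \<Longrightarrow> x = inv w b"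
    using centredD(4)[OF assms] by (auto simp: bij_def surj_f_inv_f)
  have "{x. x < c \<and> b \<le> w x} =
      (if inv w b < c then insert (inv w b) {x. x < c \<and> b + 1 \<le> w x} else {x. x < c \<and> b + 1 \<le> w x})"
  proof -
    have "b \<le> w x \<longleftrightarrow> b + 1 \<le> w x \<or> x = inv w b" for x
    proof (cases "x = inv w b")
      case False
      then have "w x \<noteq> b" using i(2) by blast
      then show ?thesis using False by linarith
    qed (simp add: i)
    then show ?thesis by auto
  qed
  then show ?thesis using finite_rk[OF assms, of c "b+1"] i(1) by (simp add: rk_def)
qed

lemma rk_val_neq:
  assumes "w \<in> centred k" "w x = b"
  shows "rk w c b = rk w c (b + 1) + of_bool (x < c)"
proof -
  have "inv w b = x" using inv_f_f[OF centredD(3)[OF assms(1)], of x] assms(2) by simp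
  then show ?thesis using rk_Suc_val[OF assms(1), of c b] by simp
qed

lemma inv_centred_mirror:
  assumes "w \<in> centred k"
  shows "inv w (- 1 - b) = - 1 - inv w b"
proof -
  have "w (- 1 - inv w b) = - 1 - b"
    using assms centredD(2,4)[OF assms] by (simp add: bij_def surj_f_inv_f)
  then show ?thesis using centredD(3)[OF assms] inv_f_eq by metis
qed

text \<open>The mirror turns the quadrant at \<open>(- c, - b)\<close> into the one opposite to the
  quadrant at \<open>(c, b)\<close>. The proof uses only that the defect \<open>f\<close> is
  invariant under unit steps of \<open>c\<close> and \<open>b\<close> and vanishes at the origin.
  Comparing ranks at \<open>(c, b)\<close> thus amounts to comparing them at
  \<open>(- c, - b)\<close>.\<close>

lemma rk_mirror:
  assumes "w \<in> centred k"
  shows "rk w (- c) (- b) = rk w c b + b - c"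
proof -
  define f where "f c b = rk w (- c) (- b) - rk w c b - b + c" for c b
  have c1: "f (c + 1) b = f c b" for c b
    using rk_Suc_pos[OF assms, of c b] rk_Suc_pos[OF assms, of "- 1 - c" "- b"]
      centredD(2)[OF assms, of c] 
    by (auto simp: f_def minus_diff_commute[of c 1])
  have b1: "f c (b + 1) = f c b" for c b
    using rk_Suc_val[OF assms, of c b] rk_Suc_val[OF assms, of "- c" "- 1 - b"]
      inv_centred_mirror[OF assms, of b] 
    by (auto simp: f_def minus_diff_commute[of b 1])
  have "f c b = f 0 b" for c b
  proof (induction c rule: int_induct[where k=0])
    case (step1 i) then show ?case using c1 by simp
  next
    case (step2 i) then show ?case using c1[of "i - 1"] by simp
  qed simp
  moreover have "f 0 b = f 0 0" for b
  proof (induction b rule: int_induct[where k=0])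
    case (step1 i) then show ?case using b1 by simp
  next
    case (step2 i) then show ?case using b1[of _ "i - 1"] by simp
  qed simp
  moreover have "f 0 0 = 0" by (simp add: f_def)
  ultimately have "f c b = 0" by simp
  then show ?thesis by (simp add: f_def)
qed

lemma rk_nonneg: "0 \<le> rk w c b" by (simp add: rk_def)

lemma rk_mono:
  assumes "w \<in> centred k" "c \<le> c'" "b' \<le> b"
  shows "rk w c b \<le> rk w c' b'"
  unfolding rk_def using assms(2,3)
  by (intro of_nat_mono card_mono finite_rk[OF assms(1)]) auto

lemma rk_le_antisym:
  assumes "u \<in> centred k" "v \<in> centred k" "rk_le u v" "rk_le v u"
  shows "u = v"
proof
  fix c
  have eq: "rk u c b = rk v c b" for c b using assms(3,4) by (simp add: rk_le_def order_antisym)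
  have "b \<le> u c \<longleftrightarrow> b \<le> v c" for b
    using rk_Suc_pos[OF assms(1), of c b] rk_Suc_pos[OF assms(2), of c b] eq by (auto split: if_splits)
  then show "u c = v c" by (meson order_antisym order_refl)
qed

lemma rk_extreme:
  assumes "w \<in> centred k" "b \<le> - int k \<or> int k \<le> b"
  shows "rk w c b = rk id c b"
proof -
  have "{x. x < c \<and> b \<le> w x} = {x. x < c \<and> b \<le> x}"
    using assms centredD(5,7,8)[OF assms(1)] by (smt (verit, best) Collect_cong)
  then show ?thesis by (simp add: rk_def)
qed

lemma rk_leI:
  assumes "u \<in> centred k" "v \<in> centred k"
    and *: "\<And>c b. - int k < b \<Longrightarrow> b < int k \<Longrightarrow> rk u c b \<le> rk v c b"
  shows "rk_le u v"
  unfolding rk_le_def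
proof (intro allI)
  fix c b
  show "rk u c b \<le> rk v c b"
    using *[of b c] rk_extreme[OF assms(1), of b c] rk_extreme[OF assms(2), of b c] by linarith
qed

text \<open>A cut that does not separate \<open>a\<close> from \<open>b\<close> sees a permuted set.
  If it does, only the point at \<open>a\<close> matters, whose value rises from \<open>w a\<close>
  to \<open>w b\<close>. Finiteness is the hypothesis, and not \<open>w \<in> centred k\<close>,
  because the second factor of \<open>mrefl\<close> acts on a permutation that has lost its mirror
  symmetry.\<close>

lemma rk_transpose:
  assumes fin: "finite {x. x < c \<and> y \<le> w x}"
    and "a < b" "w' = w \<circ> transpose a b" "w a < w b"
  shows "rk w' c y = rk w c y + of_bool (a < c \<and> c \<le> b \<and> w a < y \<and> y \<le> w b)"
proof (cases "a < c \<and> c \<le> b")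
  case False
  then have t: "transpose a b x < c \<longleftrightarrow> x < c" for x
    using assms(2) by (auto simp: transpose_def)
  have "{x. x < c \<and> y \<le> w' x} = transpose a b ` {x. x < c \<and> y \<le> w x}"
  proof (intro subset_antisym subsetI)
    fix x assume "x \<in> {x. x < c \<and> y \<le> w' x}"
    then have "transpose a b x \<in> {x. x < c \<and> y \<le> w x}" using t by (simp add: assms(3))
    then show "x \<in> transpose a b ` {x. x < c \<and> y \<le> w x}"
      by (metis image_eqI transpose_involutory)
  next
    fix x assume "x \<in> transpose a b ` {x. x < c \<and> y \<le> w x}"
    then obtain z where "x = transpose a b z" "z < c" "y \<le> w z" by blast
    then show "x \<in> {x. x < c \<and> y \<le> w' x}" by (simp add: t assms(3))
  qed
  then have "card {x. x < c \<and> y \<le> w' x} = card {x. x < c \<and> y \<le> w x}"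
    by (simp only: card_image[OF inj_on_transpose])
  then have "rk w' c y = rk w c y" by (simp only: rk_def)
  with False show ?thesis by auto
next
  case True
  define A where "A = {x. x < c \<and> x \<noteq> a \<and> y \<le> w x}"
  have "A \<subseteq> {x. x < c \<and> y \<le> w x}" by (auto simp: A_def)
  with fin have f: "finite A" "a \<notin> A" by (auto simp: A_def intro: finite_subset)
  have w': "w' x = (if x = a then w b else w x)" if "x < c" for x
    using True that by (simp add: assms(3) transpose_def)
  have "{x. x < c \<and> y \<le> w' x} = (if y \<le> w b then insert a A else A)"
    using True by (auto simp: A_def w' split: if_splits)
  then have 1: "rk w' c y = int (card A) + of_bool (y \<le> w b)"
    using f unfolding rk_def by simp
  have "{x. x < c \<and> y \<le> w x} = (if y \<le> w a then insert a A else A)"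
    using True by (auto simp: A_def)
  then have "rk w c y = int (card A) + of_bool (y \<le> w a)"
    using f unfolding rk_def by simp
  with 1 show ?thesis using True assms(4) by auto
qed

section \<open>Mirror reflections and their effect on ranks\<close>

lemma mrefl_self: "mrefl a (- 1 - a) = transpose a (- 1 - a)"
  by (simp add: mrefl_def)

lemma mrefl_apply:
  "mrefl a b x = (if x = a then b else if x = b then a
    else if x = - 1 - a then - 1 - b else if x = - 1 - b then - 1 - a else x)"
  by (auto simp: mrefl_def transpose_def)

lemma mrefl_commute: "mrefl a b = mrefl b a"
  by (rule ext) (auto simp: mrefl_apply)

lemma mrefl_mrefl [simp]: "mrefl a b (mrefl a b x) = x"
  by (auto simp: mrefl_apply)

lemma mrefl_comp_mrefl [simp]: "w \<circ> mrefl a b \<circ> mrefl a b = w"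
  by (rule ext) simp

lemma id_centred [simp]: "id \<in> centred k"
  by (simp add: centred_def permutes_id)

lemma comp_centred: "u \<in> centred k \<Longrightarrow> v \<in> centred k \<Longrightarrow> u \<circ> v \<in> centred k"
  by (auto simp: centred_def intro: permutes_compose)

lemma mrefl_centred:
  assumes "a \<in> {- int k..<int k}" "b \<in> {- int k..<int k}"
  shows "mrefl a b \<in> centred k"
proof -
  have "mrefl a b permutes {- int k..<int k}"
    unfolding mrefl_def using assms
    by (auto intro!: permutes_compose permutes_swap_id)
  moreover have "mrefl a b (- 1 - x) = - 1 - mrefl a b x" for x
    by (auto simp: mrefl_apply)
  ultimately show ?thesis by (simp add: centred_def)
qed

lemma rk_mrefl_self:
  assumes "w \<in> centred k" "a < - 1 - a" "w a < - 1 - w a"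
  shows "rk (w \<circ> mrefl a (- 1 - a)) c y =
    rk w c y + of_bool (a < c \<and> c \<le> - 1 - a \<and> w a < y \<and> y \<le> - 1 - w a)"
  using rk_transpose[OF finite_rk[OF assms(1)] assms(2) refl, of c y] assms(3)
    centredD(2)[OF assms(1)] by (simp add: mrefl_self)

text \<open>The second indicator belongs to the mirrored rectangle but is written at
  \<open>(- c, - y)\<close>, so that bounds on the first rectangle carry over by
  \<open>rk_mirror\<close>. Both can be 1 at once if the two rectangles overlap.\<close>

lemma rk_mrefl:
  assumes w: "w \<in> centred k" and ab: "a < b" "w a < w b" "b \<noteq> - 1 - a"
  shows "rk (w \<circ> mrefl a b) c y = rk w c y + of_bool (a < c \<and> c \<le> b \<and> w a < y \<and> y \<le> w b)
    + of_bool (a < - c \<and> - c \<le> b \<and> w a < - y \<and> - y \<le> w b)"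
proof -
  define w1 where "w1 = w \<circ> transpose a b"
  have 1: "rk w1 c y = rk w c y + of_bool (a < c \<and> c \<le> b \<and> w a < y \<and> y \<le> w b)" for c y
    using rk_transpose[OF finite_rk[OF w] ab(1) refl ab(2)] by (simp add: w1_def)
  have "{x. x < c \<and> y \<le> w1 x} \<subseteq> insert a (insert b {x. x < c \<and> y \<le> w x})"
    by (auto simp: w1_def transpose_def split: if_splits)
  then have fin: "finite {x. x < c \<and> y \<le> w1 x}"
    by (rule finite_subset) (simp add: finite_rk[OF w])
  have v: "w1 (- 1 - b) = - 1 - w b" "w1 (- 1 - a) = - 1 - w a"
    using ab centredD(2)[OF w] by (auto simp: w1_def transpose_def)
  have "w \<circ> mrefl a b = w1 \<circ> transpose (- 1 - b) (- 1 - a)"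
    using ab(3) by (simp add: mrefl_def w1_def comp_assoc)
  from rk_transpose[OF fin _ this] v ab
  have "rk (w \<circ> mrefl a b) c y = rk w1 c y +
    of_bool (- 1 - b < c \<and> c \<le> - 1 - a \<and> - 1 - w b < y \<and> y \<le> - 1 - w a)"
    by simp
  moreover have "- 1 - b < c \<and> c \<le> - 1 - a \<and> - 1 - w b < y \<and> y \<le> - 1 - w a \<longleftrightarrow>
      a < - c \<and> - c \<le> b \<and> w a < - y \<and> - y \<le> w b"
    by auto
  ultimately show ?thesis by (simp only: 1)
qed

lemma rk_mrefl_ge:
  assumes w: "w \<in> centred k" and ab: "a < b" "w a < w b"
  shows "rk_le w (w \<circ> mrefl a b)"
proof (cases "b = - 1 - a")
  case True
  then show ?thesis using rk_mrefl_self[OF w, of a] ab centredD(2)[OF w, of a] by (simp add: rk_le_def)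
next
  case False
  then show ?thesis using rk_mrefl[OF w ab False] by (simp add: rk_le_def)
qed

text \<open>A position inside the rectangle becomes inverted with both swapped points, which gives
  the 2; any other position keeps its number of inversions with the pair, and the pair itself gives
  the 1.\<close>

lemma invs_transpose:
  assumes w: "inj w" and ab: "a < b" "w a < w b" and I: "a \<in> {- int k..<int k}" "b \<in> {- int k..<int k}"
  shows "invs k (w \<circ> transpose a b) =
    invs k w + 1 + 2 * int (card {z \<in> {- int k..<int k}. a < z \<and> z < b \<and> w a < w z \<and> w z < w b})"
proof -
  define Z where "Z = {- int k..<int k} - {a, b}"
  have Z: "finite Z" "a \<notin> Z" "b \<notin> Z" "a \<noteq> b" using ab by (auto simp: Z_def)
  have IZ: "{- int k..<int k} = insert a (insert b Z)" using I by (auto simp: Z_def)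
  define g :: "(int \<Rightarrow> int) \<Rightarrow> int \<Rightarrow> int \<Rightarrow> int"
    where "g w x y = of_bool (x < y \<and> w y < w x)" for w x y
  have split: "invs k w = (\<Sum>x\<in>Z. \<Sum>y\<in>Z. g w x y) +
      (\<Sum>z\<in>Z. g w a z + g w z a + g w b z + g w z b) + g w a b + g w b a" for w
    unfolding invs_def IZ using Z
    by (simp add: g_def[symmetric] sum.distrib) (simp add: g_def)
  let ?w = "w \<circ> transpose a b"
  have ne: "w z \<noteq> w a" "w z \<noteq> w b" if "z \<in> Z" for z using that Z w by (auto dest: injD)
  have "(\<Sum>x\<in>Z. \<Sum>y\<in>Z. g ?w x y) = (\<Sum>x\<in>Z. \<Sum>y\<in>Z. g w x y)"
    using Z by (intro sum.cong refl) (auto simp: g_def transpose_def)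
  moreover have "(\<Sum>z\<in>Z. g ?w a z + g ?w z a + g ?w b z + g ?w z b) =
     (\<Sum>z\<in>Z. g w a z + g w z a + g w b z + g w z b + 2 * of_bool (a < z \<and> z < b \<and> w a < w z \<and> w z < w b))"
  proof (intro sum.cong refl)
    fix z assume z: "z \<in> Z"
    then have "z \<noteq> a" "z \<noteq> b" using Z by auto
    then show "g ?w a z + g ?w z a + g ?w b z + g ?w z b = g w a z + g w z a + g w b z + g w z b
       + 2 * of_bool (a < z \<and> z < b \<and> w a < w z \<and> w z < w b)"
      using ab ne[OF z] by (simp add: g_def transpose_def of_bool_def)
  qed
  moreover have "(\<Sum>z\<in>Z. (of_bool (a < z \<and> z < b \<and> w a < w z \<and> w z < w b) :: int)) =
      int (card {z \<in> {- int k..<int k}. a < z \<and> z < b \<and> w a < w z \<and> w z < w b})"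
  proof -
    have "{z \<in> {- int k..<int k}. a < z \<and> z < b \<and> w a < w z \<and> w z < w b} =
        {z \<in> Z. a < z \<and> z < b \<and> w a < w z \<and> w z < w b}"
      by (auto simp: IZ)
    then show ?thesis using Z by (simp add: Int_def)
  qed
  moreover have "g ?w a b = 1" "g ?w b a = 0" "g w a b = 0" "g w b a = 0"
    using ab by (auto simp: g_def)
  ultimately show ?thesis
    unfolding split[of ?w] split[of w] by (simp add: sum.distrib sum_distrib_left[symmetric])
qed

lemma invs_mrefl_gt:
  assumes w: "w \<in> centred k" and ab: "a < b" "w a < w b"
    and I: "a \<in> {- int k..<int k}" "b \<in> {- int k..<int k}"
  shows "invs k w < invs k (w \<circ> mrefl a b)"
proof (cases "b = - 1 - a")
  case True
  then show ?thesis using invs_transpose[OF centredD(3)[OF w] ab I] by (simp add: mrefl_def)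
next
  case False
  define w1 where "w1 = w \<circ> transpose a b"
  have "invs k w < invs k w1"
    using invs_transpose[OF centredD(3)[OF w] ab I] by (simp add: w1_def)
  moreover have "inj w1" using centredD(3)[OF w] by (simp add: w1_def inj_compose)
  moreover have "w1 (- 1 - b) < w1 (- 1 - a)"
    using ab False centredD(2)[OF w] by (auto simp: w1_def transpose_def)
  ultimately show ?thesis
    using invs_transpose[of w1 "- 1 - b" "- 1 - a" k] ab I False by (simp add: w1_def mrefl_def comp_assoc)
qed

text \<open>Each of the two transpositions must find its rectangle empty. A point in the second
  rectangle is the mirror image of one in the first, or one of the points just swapped:
  \<open>a\<close> lies to the left of it, and \<open>disj\<close> keeps \<open>b\<close> out. In
  terms of cuts, \<open>disj\<close> says that the rectangle and its mirror image do not
  overlap.\<close>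

lemma invs_mrefl_cover:
  assumes w: "w \<in> centred k" and ab: "a < b" "w a < w b" "b < - 1 - a"
    and I: "a \<in> {- int k..<int k}" "b \<in> {- int k..<int k}"
    and empty: "\<And>x. a < x \<Longrightarrow> x < b \<Longrightarrow> \<not> (w a < w x \<and> w x < w b)"
    and disj: "\<not> (0 \<le> b \<and> w a < 0 \<and> 0 \<le> w b)"
  shows "invs k (w \<circ> mrefl a b) = invs k w + 2"
proof -
  define w1 where "w1 = w \<circ> transpose a b"
  have 0: "{z \<in> {- int k..<int k}. a < z \<and> z < b \<and> w a < w z \<and> w z < w b} = {}"
    using empty by auto
  have 1: "invs k w1 = invs k w + 1"
    using invs_transpose[OF centredD(3)[OF w] ab(1,2) I] unfolding 0 by (simp add: w1_def)
  have "inj w1" using centredD(3)[OF w] by (simp add: w1_def inj_compose)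
  have v: "w1 (- 1 - b) = - 1 - w b" "w1 (- 1 - a) = - 1 - w a"
    using ab centredD(2)[OF w] by (auto simp: w1_def transpose_def)
  have "\<not> (- 1 - b < z \<and> z < - 1 - a \<and> - 1 - w b < w1 z \<and> w1 z < - 1 - w a)" for z
  proof
    assume z: "- 1 - b < z \<and> z < - 1 - a \<and> - 1 - w b < w1 z \<and> w1 z < - 1 - w a"
    consider "z = a" | "z = b" | "z \<noteq> a" "z \<noteq> b" by blast
    then show False
    proof cases
      case 1 then show ?thesis using z ab by auto
    next
      case 2 then show ?thesis using z ab disj by (auto simp: w1_def)
    next
      case 3
      then have "w1 z = w z" by (simp add: w1_def)
      then show ?thesis using z empty[of "- 1 - z"] centredD(2)[OF w, of z] by auto
    qed
  qed
  then have 2: "{z \<in> {- int k..<int k}. - 1 - b < z \<and> z < - 1 - a \<and> w1 (- 1 - b) < w1 z \<and> w1 z < w1 (- 1 - a)} = {}"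
    unfolding v by blast
  have "invs k (w1 \<circ> transpose (- 1 - b) (- 1 - a)) = invs k w1 + 1"
    using invs_transpose[OF \<open>inj w1\<close>, of "- 1 - b" "- 1 - a" k] v ab I unfolding 2 by auto
  then show ?thesis using 1 ab by (simp add: w1_def mrefl_def comp_assoc)
qed

lemma invs_mrefl_self_cover:
  assumes w: "w \<in> centred k" and ab: "a < - 1 - a" "w a < - 1 - w a"
    and I: "a \<in> {- int k..<int k}"
    and empty: "\<And>x. a < x \<Longrightarrow> x < - 1 - a \<Longrightarrow> \<not> (w a < w x \<and> w x < - 1 - w a)"
  shows "invs k (w \<circ> mrefl a (- 1 - a)) = invs k w + 1"
proof -
  have 0: "{z \<in> {- int k..<int k}. a < z \<and> z < - 1 - a \<and> w a < w z \<and> w z < - 1 - w a} = {}"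
    using empty by auto
  then show ?thesis
    using invs_transpose[OF centredD(3)[OF w], of a "- 1 - a" k, unfolded centredD(2)[OF w, of a] 0] ab I
    by (simp add: mrefl_self)
qed

section \<open>Covers below a given element\<close>

text \<open>Split both quadrants at height \<open>v a\<close>. Above it, \<open>u\<close> has at
  most as many points as \<open>v\<close> because of \<open>rk_le\<close>. Between \<open>y\<close>
  and \<open>v a\<close>, the points of \<open>u\<close> left of \<open>c\<close> all lie left of
  \<open>a\<close>, where \<open>u\<close> and \<open>v\<close> agree, and \<open>v\<close> has the
  point at \<open>a\<close> in addition.\<close>

lemma rk_less_on_rectangle:
  assumes u: "u \<in> centred k" and v: "v \<in> centred k" and le: "rk_le u v"
    and agree: "\<And>x. x < a \<Longrightarrow> u x = v x"
    and empty: "\<And>x. a < x \<Longrightarrow> x < c \<Longrightarrow> \<not> (u a < u x \<and> u x \<le> v a)"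
    and c: "a < c" and y: "u a < y" "y \<le> v a"
  shows "rk u c y < rk v c y"
proof -
  define A where "A = {x. x < a \<and> y \<le> u x \<and> u x \<le> v a}"
  let ?U = "{x. x < c \<and> v a + 1 \<le> u x}" and ?V = "{x. x < c \<and> v a + 1 \<le> v x}"
  have "A \<subseteq> {x. x < a \<and> y \<le> u x}" by (auto simp: A_def)
  then have A: "finite A" "a \<notin> A" using finite_rk[OF u] by (auto simp: A_def intro: finite_subset)
  have U: "{x. x < c \<and> y \<le> u x} = ?U \<union> A"
  proof (intro subset_antisym subsetI)
    fix x assume x: "x \<in> {x. x < c \<and> y \<le> u x}"
    then have "x < a" if "u x \<le> v a" using empty[of x] y that by (cases x a rule: linorder_cases) auto
    with x show "x \<in> ?U \<union> A" by (auto simp: A_def)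
  qed (use c y in \<open>auto simp: A_def\<close>)
  have "?U \<inter> A = {}" by (auto simp: A_def)
  then have 1: "rk u c y = rk u c (v a + 1) + int (card A)"
    unfolding rk_def U using A finite_rk[OF u, of c "v a + 1"] by (simp add: card_Un_disjoint)
  have "?V \<inter> insert a A = {}" using agree by (auto simp: A_def)
  then have "rk v c (v a + 1) + int (card (insert a A)) = int (card (?V \<union> insert a A))"
    unfolding rk_def using A finite_rk[OF v, of c "v a + 1"] by (simp add: card_Un_disjoint)
  also have "\<dots> \<le> rk v c y"
    unfolding rk_def using agree c y
    by (intro of_nat_mono card_mono finite_rk[OF v]) (auto simp: A_def)
  finally have "rk v c (v a + 1) + (1 + int (card A)) \<le> rk v c y" using A by simp
  moreover have "rk u c (v a + 1) \<le> rk v c (v a + 1)" using le by (simp add: rk_le_def)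
  ultimately show ?thesis using 1 by linarith
qed

text \<open>Let \<open>a\<close> be the first position where \<open>u\<close> and \<open>v\<close> differ and \<open>b > a\<close> the first one with
  \<open>u a < u b \<le> v a\<close>. The reflection in \<open>a\<close> and \<open>b\<close> works unless its rectangle overlaps the mirror
  image; then the reflection in \<open>a\<close> and \<open>- 1 - a\<close> does.\<close>

lemma cover_below:
  assumes u: "u \<in> centred k" and v: "v \<in> centred k" and le: "rk_le u v" and ne: "u \<noteq> v"
  obtains a b where "a \<in> {- int k..<int k}" "b \<in> {- int k..<int k}" "a < b" "u a < u b"
    "\<And>x. a < x \<Longrightarrow> x < b \<Longrightarrow> \<not> (u a < u x \<and> u x < u b)"
    "rk_le (u \<circ> mrefl a b) v"
    "b = - 1 - a \<or> b < - 1 - a \<and> \<not> (0 \<le> b \<and> u a < 0 \<and> 0 \<le> u b)"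
proof -
  note mu = centredD(2)[OF u] and mv = centredD(2)[OF v]
  define E where "E = {x. u x \<noteq> v x}"
  have EI: "E \<subseteq> {- int k..<int k}"
    using centredD(5)[OF u] centredD(5)[OF v] unfolding E_def
    by (smt (verit, best) atLeastLessThan_iff mem_Collect_eq subsetI)
  then have fE: "finite E" "E \<noteq> {}" using ne finite_subset by (auto simp: E_def)
  define a where "a = Min E"
  have agree: "u x = v x" if "x < a" for x
    using fE that Min_le[of E x] by (auto simp: a_def E_def)
  have aE: "a \<in> E" using fE by (simp add: a_def)
  \<comment> \<open>\<open>E\<close> is closed under the mirror, so its minimum \<open>a\<close> is
    negative.\<close>
  then have "- 1 - a \<in> E" by (simp add: E_def mu mv)
  then have "a \<le> - 1 - a" using fE by (simp add: a_def)
  then have a0: "a < - 1 - a" by presburger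
  have aI: "a \<in> {- int k..<int k}" using aE EI by blast
  have "rk u a (u a) = rk v a (u a)"
  proof -
    have "{x. x < a \<and> u a \<le> u x} = {x. x < a \<and> u a \<le> v x}" using agree by auto
    then show ?thesis by (simp add: rk_def)
  qed
  moreover have "rk u (a + 1) (u a) \<le> rk v (a + 1) (u a)" using le by (simp add: rk_le_def)
  ultimately have "u a \<le> v a"
    using rk_Suc_pos[OF u, of a "u a"] rk_Suc_pos[OF v, of a "u a"]
    by (cases "u a \<le> v a") auto
  then have uva: "u a < v a" using aE by (simp add: E_def)
  \<comment> \<open>The position where \<open>u\<close> takes the value \<open>v a\<close> witnesses
    that \<open>B\<close> below is nonempty.\<close>
  define q where "q = inv u (v a)"
  have q: "u q = v a" using centredD(4)[OF u] by (simp add: q_def bij_def surj_f_inv_f)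
  have "q \<noteq> a" using q uva by auto
  have "a < q"
  proof (rule ccontr)
    assume "\<not> a < q"
    then have "q < a" using \<open>q \<noteq> a\<close> by simp
    then have "v q = v a" using agree q by simp
    then show False using centredD(6)[OF v] \<open>q \<noteq> a\<close> by simp
  qed
  have "q \<le> - 1 - a"
  proof (rule ccontr)
    assume "\<not> q \<le> - 1 - a"
    then have "u (- 1 - q) = v (- 1 - q)" using agree by simp
    then have "v q = v a" using q mu mv by simp
    then show False using centredD(6)[OF v] \<open>q \<noteq> a\<close> by simp
  qed
  define B where "B = {x \<in> {a<..- 1 - a}. u a < u x \<and> u x \<le> v a}"
  have "q \<in> B" using \<open>a < q\<close> \<open>q \<le> - 1 - a\<close> q uva by (simp add: B_def)
  have fB: "finite B" by (rule finite_subset[of _ "{a<..- 1 - a}"]) (auto simp: B_def)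
  define b where "b = Min B"
  have "b \<in> B" unfolding b_def using fB \<open>q \<in> B\<close> by (intro Min_in) auto
  then have ab: "a < b" "u a < u b" "u b \<le> v a" "b \<le> - 1 - a" by (auto simp: B_def)
  have bI: "b \<in> {- int k..<int k}" using ab aI by auto
  have empty: "\<not> (u a < u x \<and> u x \<le> v a)" if "a < x" "x < b" for x
  proof
    assume "u a < u x \<and> u x \<le> v a"
    then have "x \<in> B" using that ab by (simp add: B_def)
    then show False using Min_le[OF fB, of x] that by (simp add: b_def)
  qed
  have empty': "\<not> (u a < u x \<and> u x < u b)" if "a < x" "x < b" for x
    using empty[OF that] ab(3) by auto
  have less: "rk u c y < rk v c y" if "a < c" "c \<le> b" "u a < y" "y \<le> v a" for c y
    using rk_less_on_rectangle[OF u v le agree _ that(1,3,4)] empty that(2) by force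
  have less': "rk u c y < rk v c y" if "a < - c" "- c \<le> b" "u a < - y" "- y \<le> v a" for c y
    using less[OF that] rk_mirror[OF u] rk_mirror[OF v] by simp
  have leD: "rk u c y \<le> rk v c y" for c y using le by (simp add: rk_le_def)
  show thesis
  proof (cases "b = - 1 - a")
    case True
    then have ua: "u a < - 1 - u a" using ab mu by simp
    have "rk_le (u \<circ> mrefl a (- 1 - a)) v"
      unfolding rk_le_def rk_mrefl_self[OF u a0 ua]
    proof (intro allI)
      fix c y
      show "rk u c y + of_bool (a < c \<and> c \<le> - 1 - a \<and> u a < y \<and> y \<le> - 1 - u a) \<le> rk v c y"
        using less[of c y] leD[of c y] True ab mu[of a] by auto
    qed
    then show ?thesis using that[of a b] aI bI ab empty' True by simp
  next
    case False
    then have b1: "b < - 1 - a" using ab by simp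
    show ?thesis
    proof (cases "0 \<le> b \<and> u a < 0 \<and> 0 \<le> u b")
      case False
      have "rk_le (u \<circ> mrefl a b) v"
        unfolding rk_le_def rk_mrefl[OF u ab(1,2) \<open>b \<noteq> - 1 - a\<close>]
      proof (intro allI)
        fix c y
        show "rk u c y + of_bool (a < c \<and> c \<le> b \<and> u a < y \<and> y \<le> u b) +
          of_bool (a < - c \<and> - c \<le> b \<and> u a < - y \<and> - y \<le> u b) \<le> rk v c y"
          using less[of c y] less'[of c y] leD[of c y] ab(3) False by auto
      qed
      then show ?thesis using that[of a b] aI bI ab empty' b1 False by simp
    next
      case True
      \<comment> \<open>The mirror position \<open>- 1 - b\<close> lies strictly between
        \<open>a\<close> and \<open>b\<close>, so its value avoids the range from \<open>u a\<close>
        to \<open>v a\<close>. This forces \<open>- 1 - u a \<le> u b\<close>, and then the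
        rectangle from \<open>a\<close> to \<open>- 1 - a\<close> is covered by the cuts treated in
        \<open>less\<close> and \<open>less'\<close>.\<close>
      have "\<not> (u a < u (- 1 - b) \<and> u (- 1 - b) \<le> v a)" using empty[of "- 1 - b"] True b1 by simp
      then have ub: "- 1 - u a \<le> u b" using mu[of b] True ab by auto
      have ua: "u a < - 1 - u a" using True by presburger
      have le1: "rk u c y + 1 \<le> rk v c y" if "a < c" "c \<le> - 1 - a" "u a < y" "y \<le> - 1 - u a" for c y
      proof (cases "c \<le> b")
        case True
        then show ?thesis using less[of c y] that ub ab by auto
      next
        case False
        then show ?thesis using less'[of c y] that ub ab True by auto
      qed
      have "rk_le (u \<circ> mrefl a (- 1 - a)) v"
        unfolding rk_le_def rk_mrefl_self[OF u a0 ua]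
      proof (intro allI)
        fix c y
        show "rk u c y + of_bool (a < c \<and> c \<le> - 1 - a \<and> u a < y \<and> y \<le> - 1 - u a) \<le> rk v c y"
          using le1[of c y] leD[of c y] by auto
      qed
      \<comment> \<open>Left of \<open>b\<close> this is the choice of \<open>b\<close>; right of
        \<open>b\<close> it is the same statement for the mirror position.\<close>
      moreover have "\<not> (u a < u x \<and> u x < u (- 1 - a))" if x: "a < x" "x < - 1 - a" for x
      proof
        assume *: "u a < u x \<and> u x < u (- 1 - a)"
        have "x \<noteq> b" using * ub mu[of a] by auto
        then consider "x < b" | "b < x" by linarith
        then show False
        proof cases
          case 1
          then show ?thesis using empty'[of x] * x ub mu[of a] by auto
        next
          case 2
          then show ?thesis using empty'[of "- 1 - x"] * x ub mu[of a] mu[of x] True by auto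
        qed
      qed
      ultimately show ?thesis using that[of a "- 1 - a"] aI a0 ua mu[of a] by auto
    qed
  qed
qed

section \<open>Centred coordinates of signed permutations\<close>

definition drop0 :: "int \<Rightarrow> int" where
  "drop0 x = (if x < 0 then x else x - 1)"

definition add0 :: "int \<Rightarrow> int" where
  "add0 y = (if y < 0 then y else y + 1)"

definition centre :: "(int \<Rightarrow> int) \<Rightarrow> int \<Rightarrow> int" where
  "centre w y = drop0 (w (add0 y))"

definition uncentre :: "(int \<Rightarrow> int) \<Rightarrow> int \<Rightarrow> int" where
  "uncentre w x = (if x = 0 then 0 else add0 (w (drop0 x)))"

lemma add0_simps [simp]:
  "add0 y \<noteq> 0" "0 \<noteq> add0 y" "drop0 (add0 y) = y" "add0 (- 1 - y) = - add0 y"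
  "add0 x < add0 y \<longleftrightarrow> x < y" "add0 x = add0 y \<longleftrightarrow> x = y"
  "add0 y \<in> signed_range k \<longleftrightarrow> - int k \<le> y \<and> y < int k"
  by (auto simp: add0_def drop0_def signed_range_def)

lemma drop0_simps:
  "x \<noteq> 0 \<Longrightarrow> add0 (drop0 x) = x" "x \<noteq> 0 \<Longrightarrow> drop0 (- x) = - 1 - drop0 x"
  "x \<noteq> 0 \<Longrightarrow> y \<noteq> 0 \<Longrightarrow> drop0 x < drop0 y \<longleftrightarrow> x < y"
  "x \<noteq> 0 \<Longrightarrow> - int k \<le> drop0 x \<and> drop0 x < int k \<longleftrightarrow> x \<in> signed_range k"
  by (auto simp: add0_def drop0_def signed_range_def)

lemma signed_permsD:
  assumes "w \<in> signed_perms k"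
  shows "w permutes signed_range k" "w 0 = 0" "w (- x) = - w x" "w x = 0 \<longleftrightarrow> x = 0"
    "bij w" "inj w" "x \<notin> signed_range k \<Longrightarrow> w x = x"
proof -
  show p: "w permutes signed_range k" using assms by (simp add: signed_perms_def)
  show out: "w x = x" if "x \<notin> signed_range k" for x using p that by (simp add: permutes_def)
  show z: "w 0 = 0" using out[of 0] by (simp add: signed_range_def)
  show "bij w" "inj w" using p permutes_bij permutes_inj by auto
  then show "w x = 0 \<longleftrightarrow> x = 0" using z by (metis injD)
  show "w (- x) = - w x"
  proof (cases "x \<in> signed_range k")
    case True
    then show ?thesis using assms by (simp add: signed_perms_def)
  next
    case False
    then have "- x \<notin> signed_range k" by (auto simp: signed_range_def)
    then show ?thesis using out False by simp
  qed
qed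

lemma centre_centred:
  assumes "w \<in> signed_perms k"
  shows "centre w \<in> centred k"
proof -
  note w = signed_permsD[OF assms]
  have "\<exists>!x. centre w x = y" for y
  proof
    have "w (inv w (add0 y)) = add0 y" using w(5) by (simp add: bij_def surj_f_inv_f)
    then have *: "w (inv w (add0 y)) = add0 y" "inv w (add0 y) \<noteq> 0" using w(2) by auto
    then show "centre w (drop0 (inv w (add0 y))) = y" by (simp add: centre_def drop0_simps)
    fix x assume "centre w x = y"
    then have "w (add0 x) = add0 y" using w(4)[of "add0 x"] by (auto simp: centre_def drop0_simps)
    then have "add0 x = inv w (add0 y)" using * w(6) by (metis injD)
    then show "x = drop0 (inv w (add0 y))" by (metis add0_simps(3))
  qed
  moreover have "centre w x = x" if "x \<notin> {- int k..<int k}" for x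
    using that w(7)[of "add0 x"] by (auto simp: centre_def)
  moreover have "centre w (- 1 - x) = - 1 - centre w x" for x
    using w(3)[of "add0 x"] w(4)[of "add0 x"] by (simp add: centre_def drop0_simps)
  ultimately show ?thesis by (simp add: centred_def permutes_def)
qed

lemma uncentre_signed:
  assumes "w \<in> centred k"
  shows "uncentre w \<in> signed_perms k"
proof -
  note w = centredD[OF assms]
  have "\<exists>!x. uncentre w x = y" for y
  proof (cases "y = 0")
    case True
    then show ?thesis by (auto simp: uncentre_def)
  next
    case False
    show ?thesis
    proof
      have *: "w (inv w (drop0 y)) = drop0 y" using w(4) by (simp add: bij_def surj_f_inv_f)
      then show "uncentre w (add0 (inv w (drop0 y))) = y" using False by (simp add: uncentre_def drop0_simps)
      fix x assume x: "uncentre w x = y"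
      then have "x \<noteq> 0" using False by (auto simp: uncentre_def)
      then have "w (drop0 x) = drop0 y" using x by (auto simp: uncentre_def)
      then have "drop0 x = inv w (drop0 y)" using * w(3) by (metis injD)
      then show "x = add0 (inv w (drop0 y))" using \<open>x \<noteq> 0\<close> by (metis drop0_simps(1))
    qed
  qed
  moreover have "uncentre w x = x" if "x \<notin> signed_range k" for x
  proof (cases "x = 0")
    case False
    then have "drop0 x < - int k \<or> int k \<le> drop0 x" using drop0_simps(4)[of x k] that by auto
    then show ?thesis using w(5)[of "drop0 x"] False by (simp add: uncentre_def drop0_simps)
  qed (simp add: uncentre_def)
  moreover have "uncentre w (- x) = - uncentre w x" for x
    using w(2)[of "drop0 x"] by (simp add: uncentre_def drop0_simps)
  ultimately show ?thesis by (simp add: signed_perms_def permutes_def)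
qed

lemma centre_uncentre [simp]: "centre (uncentre w) = w"
  by (rule ext) (simp add: centre_def uncentre_def)

lemma uncentre_centre: "w \<in> signed_perms k \<Longrightarrow> uncentre (centre w) = w"
  by (rule ext) (auto simp: centre_def uncentre_def drop0_simps signed_permsD(2,4))

lemma centre_inj: "u \<in> signed_perms k \<Longrightarrow> v \<in> signed_perms k \<Longrightarrow> centre u = centre v \<longleftrightarrow> u = v"
  by (metis uncentre_centre)

lemma centre_comp: "t \<in> signed_perms k \<Longrightarrow> centre (u \<circ> t) = centre u \<circ> centre t"
  by (rule ext) (simp add: centre_def drop0_simps signed_permsD(4))

lemma signed_perms_comp:
  assumes "u \<in> signed_perms k" "v \<in> signed_perms k"
  shows "u \<circ> v \<in> signed_perms k"
proof -
  have "(u \<circ> v) permutes signed_range k"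
    using signed_permsD(1)[OF assms(1)] signed_permsD(1)[OF assms(2)] permutes_compose by blast
  moreover have "(u \<circ> v) (- x) = - (u \<circ> v) x" for x
    using signed_permsD(3)[OF assms(1)] signed_permsD(3)[OF assms(2)] by simp
  ultimately show ?thesis by (simp add: signed_perms_def)
qed

lemma signed_perms_inv:
  assumes "w \<in> signed_perms k"
  shows "inv w \<in> signed_perms k" "centre (inv w) = inv (centre w)"
proof -
  note w = signed_permsD[OF assms]
  have "inv w permutes signed_range k" using w(1) permutes_inv by blast
  moreover have "inv w (- x) = - inv w x" for x
  proof -
    have "w (- inv w x) = - x" using w(3,5) by (simp add: bij_def surj_f_inv_f)
    then show ?thesis using w(6) inv_f_eq by metis
  qed
  ultimately show i: "inv w \<in> signed_perms k" by (simp add: signed_perms_def)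
  have "centre w (centre (inv w) x) = x" for x
  proof -
    have "centre (w \<circ> inv w) = centre w \<circ> centre (inv w)" by (rule centre_comp[OF i])
    moreover have "w \<circ> inv w = id" using w(5) by (simp add: bij_def surj_iff)
    ultimately show ?thesis by (metis add0_simps(3) comp_apply centre_def id_apply)
  qed
  then show "centre (inv w) = inv (centre w)"
    using centredD(3)[OF centre_centred[OF assms]] by (metis ext inv_f_f)
qed

section \<open>The length in centred coordinates\<close>

lemma sum_mirror:
  fixes F :: "int \<Rightarrow> int"
  shows "(\<Sum>x\<in>{- int k..<int k}. F x) = (\<Sum>x\<in>{0..<int k}. F x + F (- 1 - x))"
proof -
  have "{- int k..<int k} = {0..<int k} \<union> {- int k..<0}" by auto
  then have "(\<Sum>x\<in>{- int k..<int k}. F x) = (\<Sum>x\<in>{0..<int k}. F x) + (\<Sum>x\<in>{- int k..<0}. F x)"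
    by (simp add: sum.union_disjoint ivl_disj_int)
  also have "(\<Sum>x\<in>{- int k..<0}. F x) = (\<Sum>x\<in>{0..<int k}. F (- 1 - x))"
    by (rule sum.reindex_bij_witness[of _ "\<lambda>x. - 1 - x" "\<lambda>x. - 1 - x"]) auto
  finally show ?thesis by (simp add: sum.distrib)
qed

lemma sum_symmetric:
  fixes h :: "int \<Rightarrow> int \<Rightarrow> bool"
  assumes "finite A" "\<And>x y. h x y = h y x"
  shows "(\<Sum>x\<in>A. \<Sum>y\<in>A. of_bool (h x y)) =
    (\<Sum>x\<in>A. of_bool (h x x)) + 2 * (\<Sum>x\<in>A. \<Sum>y\<in>A. of_bool (x < y \<and> h x y) :: int)"
proof -
  have "(\<Sum>x\<in>A. \<Sum>y\<in>A. of_bool (h x y) :: int) =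
      (\<Sum>x\<in>A. \<Sum>y\<in>A. of_bool (x < y \<and> h x y) + of_bool (y < x \<and> h y x) + (if x = y then of_bool (h x x) else 0))"
    using assms(2) by (intro sum.cong refl) (auto simp: of_bool_def)
  also have "\<dots> = (\<Sum>x\<in>A. \<Sum>y\<in>A. of_bool (x < y \<and> h x y)) + (\<Sum>x\<in>A. \<Sum>y\<in>A. of_bool (y < x \<and> h y x))
      + (\<Sum>x\<in>A. of_bool (h x x))"
    using assms(1) by (simp add: sum.distrib)
  also have "(\<Sum>x\<in>A. \<Sum>y\<in>A. of_bool (y < x \<and> h y x) :: int) = (\<Sum>x\<in>A. \<Sum>y\<in>A. of_bool (x < y \<and> h x y))"
    by (rule sum.swap)
  finally show ?thesis by simp
qed

lemma card_pairs:
  "int (card {(a, b). 1 \<le> a \<and> a < b \<and> b \<le> int k \<and> Q a b}) =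
    (\<Sum>x\<in>{0..<int k}. \<Sum>y\<in>{0..<int k}. of_bool (x < y \<and> Q (x + 1) (y + 1)))"
proof -
  let ?P = "{0..<int k}"
  have "card {(a, b). 1 \<le> a \<and> a < b \<and> b \<le> int k \<and> Q a b} =
      card {z \<in> ?P \<times> ?P. fst z < snd z \<and> Q (fst z + 1) (snd z + 1)}"
    by (rule bij_betw_same_card[of "\<lambda>(a, b). (a - 1, b - 1)"],
        rule bij_betw_byWitness[where f' = "\<lambda>(a, b). (a + 1, b + 1)"]) auto
  also have "int \<dots> = (\<Sum>z\<in>?P \<times> ?P. of_bool (fst z < snd z \<and> Q (fst z + 1) (snd z + 1)))"
    by (simp add: Int_def)
  also have "\<dots> = (\<Sum>x\<in>?P. \<Sum>y\<in>?P. of_bool (x < y \<and> Q (x + 1) (y + 1)))"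
    unfolding sum.cartesian_product case_prod_unfold ..
  finally show ?thesis .
qed

text \<open>Fold the double sum at 0. Pairs on one side give each inversion of the window twice. A
  pair across the gap is inverted iff \<open>f x + f y < - 1\<close>; this gives each pair of
  \<open>nsp_count\<close> twice and, on the diagonal, \<open>neg_count\<close> once. The rank at
  the origin is a second \<open>neg_count\<close>.\<close>

lemma length_B_centre:
  assumes "w \<in> signed_perms k"
  shows "2 * int (length_B k w) = invs k (centre w) + rk (centre w) 0 0"
proof -
  note w = signed_permsD[OF assms]
  let ?P = "{0..<int k}"
  define f where "f = centre w"
  have f: "f \<in> centred k" unfolding f_def by (rule centre_centred[OF assms])
  have fm: "f (- 1 - x) = - 1 - f x" for x by (rule centredD(2)[OF f])
  have fw: "f x = drop0 (w (x + 1))" if "0 \<le> x" for x using that by (simp add: f_def centre_def add0_def)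
  have cmp: "f y < f x \<longleftrightarrow> w (y + 1) < w (x + 1)" "f x + f y < - 1 \<longleftrightarrow> w (x + 1) + w (y + 1) < 0"
    if "0 \<le> x" "0 \<le> y" for x y
  proof -
    have nz: "w (x + 1) \<noteq> 0" "w (y + 1) \<noteq> 0" using that w(4) by auto
    show "f y < f x \<longleftrightarrow> w (y + 1) < w (x + 1)" using nz that by (simp add: fw drop0_simps)
    show "f x + f y < - 1 \<longleftrightarrow> w (x + 1) + w (y + 1) < 0" using nz that by (auto simp: fw drop0_def)
  qed
  have "invs k f = (\<Sum>x\<in>?P. \<Sum>y\<in>?P. of_bool (x < y \<and> f y < f x) + of_bool (y < x \<and> f x < f y) + of_bool (f x + f y < - 1))"
    unfolding invs_def sum_mirror sum.distrib[symmetric]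
    by (intro sum.cong refl) (auto simp: fm)
  also have "\<dots> = (\<Sum>x\<in>?P. \<Sum>y\<in>?P. of_bool (x < y \<and> f y < f x)) + (\<Sum>x\<in>?P. \<Sum>y\<in>?P. of_bool (y < x \<and> f x < f y))
      + (\<Sum>x\<in>?P. \<Sum>y\<in>?P. of_bool (f x + f y < - 1))"
    by (simp add: sum.distrib)
  also have "(\<Sum>x\<in>?P. \<Sum>y\<in>?P. of_bool (y < x \<and> f x < f y) :: int) = (\<Sum>x\<in>?P. \<Sum>y\<in>?P. of_bool (x < y \<and> f y < f x))"
    by (rule sum.swap)
  also have "(\<Sum>x\<in>?P. \<Sum>y\<in>?P. of_bool (f x + f y < - 1) :: int) =
      (\<Sum>x\<in>?P. of_bool (f x + f x < - 1)) + 2 * (\<Sum>x\<in>?P. \<Sum>y\<in>?P. of_bool (x < y \<and> f x + f y < - 1))"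
    by (rule sum_symmetric) (auto simp: add.commute)
  also have "(\<Sum>x\<in>?P. \<Sum>y\<in>?P. of_bool (x < y \<and> f y < f x) :: int) = int (inv_count k w)"
    unfolding inv_count_def card_pairs by (intro sum.cong refl) (simp add: cmp)
  also have "(\<Sum>x\<in>?P. \<Sum>y\<in>?P. of_bool (x < y \<and> f x + f y < - 1) :: int) = int (nsp_count k w)"
    unfolding nsp_count_def card_pairs by (intro sum.cong refl) (simp add: cmp)
  also have "(\<Sum>x\<in>?P. of_bool (f x + f x < - 1) :: int) = int (neg_count k w)"
  proof -
    have "f x + f x < - 1 \<longleftrightarrow> w (x + 1) < 0" if "x \<in> ?P" for x using cmp(2)[of x x] that by auto
    then have "{x \<in> ?P. f x + f x < - 1} = {x \<in> ?P. w (x + 1) < 0}" by blast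
    moreover have "card {a \<in> {1..int k}. w a < 0} = card {x \<in> ?P. w (x + 1) < 0}"
      by (rule bij_betw_same_card[of "\<lambda>x. x - 1"], rule bij_betw_byWitness[where f' = "\<lambda>x. x + 1"])
        auto
    ultimately have "card {a \<in> {1..int k}. w a < 0} = card {x \<in> ?P. f x + f x < - 1}" by simp
    then show ?thesis by (simp add: neg_count_def Int_def)
  qed
  finally have 1: "invs k f = 2 * int (inv_count k w) + int (neg_count k w) + 2 * int (nsp_count k w)"
    by simp
  have "{x. x < 0 \<and> 0 \<le> f x} = uminus ` {a \<in> {1..int k}. w a < 0}"
  proof (intro subset_antisym subsetI)
    fix x assume x: "x \<in> {x. x < 0 \<and> 0 \<le> f x}"
    then have "- int k \<le> x" using centredD(5)[OF f, of x] by (cases "x < - int k") auto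
    moreover have "w (- x) < 0" using x w(3)[of x] w(4)[of x] by (auto simp: f_def centre_def add0_def drop0_def split: if_splits)
    ultimately show "x \<in> uminus ` {a \<in> {1..int k}. w a < 0}"
      using x by (intro image_eqI[of _ _ "- x"]) auto
  next
    fix x assume "x \<in> uminus ` {a \<in> {1..int k}. w a < 0}"
    then show "x \<in> {x. x < 0 \<and> 0 \<le> f x}"
      using w(3) by (auto simp: f_def centre_def add0_def drop0_def)
  qed
  then have "rk f 0 0 = int (neg_count k w)"
    by (simp add: rk_def neg_count_def card_image)
  with 1 show ?thesis by (simp add: length_B_def f_def)
qed

section \<open>Generators and reflections in centred coordinates\<close>

lemma centre_generators:
  "centre (transpose 1 (- 1)) = mrefl (- 1) 0"
  "1 \<le> a \<Longrightarrow> centre (transpose a (a + 1) \<circ> transpose (- a) (- a - 1)) = mrefl (a - 1) a"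
  by (rule ext; auto simp: centre_def mrefl_apply add0_def drop0_def transpose_def)+

lemma generators_signed:
  assumes "s \<in> generators_B k"
  shows "s \<in> signed_perms k"
proof -
  consider "k \<ge> 1" "s = transpose 1 (- 1)"
    | a where "1 \<le> a" "a \<le> int k - 1" "s = transpose a (a + 1) \<circ> transpose (- a) (- a - 1)"
    using assms by (auto simp: generators_B_def)
  then show ?thesis
  proof cases
    case 1
    have "s = uncentre (mrefl (- 1) 0)"
      unfolding 1 by (rule ext) (auto simp: uncentre_def mrefl_apply add0_def drop0_def transpose_def)
    then show ?thesis using 1 by (auto intro!: uncentre_signed mrefl_centred)
  next
    case 2
    have "s = uncentre (mrefl (a - 1) a)"
      unfolding 2(3) using 2(1) by (intro ext) (auto simp: uncentre_def mrefl_apply add0_def drop0_def transpose_def)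
    then show ?thesis using 2 by (auto intro!: uncentre_signed mrefl_centred)
  qed
qed

lemma mrefl_conj:
  assumes "w \<in> centred k"
  shows "w \<circ> mrefl a b \<circ> inv w = mrefl (w a) (w b)"
proof
  fix x
  obtain z where x: "x = w z" using centredD(4)[OF assms] by (metis bij_pointE)
  have "inv w x = z" unfolding x using centredD(3)[OF assms] by (simp add: inv_f_f)
  then show "(w \<circ> mrefl a b \<circ> inv w) x = mrefl (w a) (w b) x"
    unfolding x using centredD(6)[OF assms] centredD(2)[OF assms, symmetric]
    by (simp add: mrefl_apply)
qed

lemma reflections_signed:
  assumes "t \<in> reflections_B k"
  shows "t \<in> signed_perms k"
    "\<exists>a b. a \<in> {- int k..<int k} \<and> b \<in> {- int k..<int k} \<and> a < b \<and> centre t = mrefl a b"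
proof -
  obtain w s where t: "t = w \<circ> s \<circ> inv w" and w: "w \<in> signed_perms k" and s: "s \<in> generators_B k"
    using assms by (auto simp: reflections_B_def)
  note s' = generators_signed[OF s] and i = signed_perms_inv[OF w] and c = centre_centred[OF w]
  show "t \<in> signed_perms k" unfolding t using w s' i(1) by (intro signed_perms_comp)
  have ct: "centre t = centre w \<circ> centre s \<circ> inv (centre w)"
    unfolding t centre_comp[OF i(1)] centre_comp[OF s'] i(2) ..
  consider "k \<ge> 1" "s = transpose 1 (- 1)"
    | a where "1 \<le> a" "a \<le> int k - 1" "s = transpose a (a + 1) \<circ> transpose (- a) (- a - 1)"
    using s by (auto simp: generators_B_def)
  then have "\<exists>a b. a \<in> {- int k..<int k} \<and> b \<in> {- int k..<int k} \<and> a \<noteq> b \<and> centre s = mrefl a b"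
  proof cases
    case 1
    have "centre s = mrefl (- 1) 0" unfolding 1(2) by (rule centre_generators)
    then show ?thesis using 1(1) by (intro exI[of _ "- 1"] exI[of _ 0]) simp
  next
    case 2
    have "centre s = mrefl (a - 1) a" unfolding 2(3) by (rule centre_generators(2)[OF 2(1)])
    then show ?thesis using 2(1,2) by (intro exI[of _ "a - 1"] exI[of _ a]) simp
  qed
  then obtain a b where ab: "a \<in> {- int k..<int k}" "b \<in> {- int k..<int k}" "a \<noteq> b" "centre s = mrefl a b"
    by blast
  have "centre t = mrefl (centre w a) (centre w b)" unfolding ct ab(4) by (rule mrefl_conj[OF c])
  moreover have "centre w a \<in> {- int k..<int k}" "centre w b \<in> {- int k..<int k}" "centre w a \<noteq> centre w b"
    using ab centredD(6,7,8)[OF c] by auto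
  ultimately show "\<exists>a b. a \<in> {- int k..<int k} \<and> b \<in> {- int k..<int k} \<and> a < b \<and> centre t = mrefl a b"
    using mrefl_commute[of "centre w a" "centre w b"] neq_iff by metis
qed

text \<open>It suffices to find a centred \<open>W\<close> that carries the two positions of a
  generator to \<open>a\<close> and \<open>b\<close>; conjugation by \<open>W\<close> then turns
  that generator into \<open>mrefl a b\<close>.\<close>

lemma mrefl_reflection:
  assumes a: "a \<in> {- int k..<int k}" and b: "b \<in> {- int k..<int k}" and ab: "a \<noteq> b"
  obtains t where "t \<in> reflections_B k" "centre t = mrefl a b"
proof -
  note goal = that
  have *: thesis
    if W: "W \<in> centred k" and s: "s \<in> generators_B k" and xy: "centre s = mrefl x y" "W x = a" "W y = b"
    for W s x y
  proof -
    note W' = uncentre_signed[OF W]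
    note i = signed_perms_inv[OF W']
    let ?t = "uncentre W \<circ> s \<circ> inv (uncentre W)"
    have "?t \<in> reflections_B k" using W' s unfolding reflections_B_def by blast
    moreover have "centre ?t = W \<circ> centre s \<circ> inv W"
      by (simp add: centre_comp[OF i(1)] centre_comp[OF generators_signed[OF s]] i(2))
    then have "centre ?t = mrefl a b" using xy mrefl_conj[OF W, of x y] by simp
    ultimately show thesis by (rule goal)
  qed
  have k: "1 \<le> k" using a by auto
  show thesis
  proof (cases "b = - 1 - a")
    case True
    have "transpose 1 (- 1) \<in> generators_B k" using k by (simp add: generators_B_def)
    moreover have "mrefl 0 b \<in> centred k" using b k by (intro mrefl_centred) auto
    ultimately show ?thesis using *[of "mrefl 0 b" _ "- 1" 0] True centre_generators(1)
      by (simp add: mrefl_apply)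
  next
    case False
    \<comment> \<open>\<open>W1\<close> sends 0 to \<open>a\<close>. The second factor of
      \<open>W\<close> corrects the image of 1 to \<open>b\<close> without disturbing
      \<open>a\<close>, because \<open>b\<close> and \<open>c\<close> both differ from
      \<open>a\<close> and from \<open>- 1 - a\<close>.\<close>
    define W1 where "W1 = mrefl 0 a"
    have W1: "W1 \<in> centred k" using a k unfolding W1_def by (intro mrefl_centred) auto
    have "2 \<le> k" using a b ab False by auto
    define c where "c = W1 1"
    have cI: "c \<in> {- int k..<int k}" using \<open>2 \<le> k\<close> centredD(7,8)[OF W1, of 1] by (simp add: c_def)
    have W10: "W1 0 = a" by (simp add: W1_def mrefl_apply)
    have "c \<noteq> a" using centredD(6)[OF W1, of 1 0] W10 by (simp add: c_def)
    have "c \<noteq> - 1 - a" using centredD(6)[OF W1, of 1 "- 1"] centredD(2)[OF W1, of 0] W10 by (simp add: c_def)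
    define W where "W = mrefl c b \<circ> W1"
    have "W \<in> centred k" unfolding W_def using cI b W1 by (intro comp_centred mrefl_centred)
    moreover have "W 0 = a" "W 1 = b"
      using \<open>c \<noteq> a\<close> \<open>c \<noteq> - 1 - a\<close> ab False W10 by (auto simp: W_def c_def[symmetric] mrefl_apply)
    moreover have "transpose 1 (1 + 1) \<circ> transpose (- 1) (- 1 - 1) \<in> generators_B k"
      using \<open>2 \<le> k\<close> unfolding generators_B_def by force
    ultimately show ?thesis using *[of W _ 0 1] centre_generators(2)[of 1] by simp
  qed
qed

section \<open>The rank criterion for Bruhat order\<close>

lemma invs_le: "invs k w \<le> (2 * int k)\<^sup>2"
proof -
  have "invs k w \<le> (\<Sum>x\<in>{- int k..<int k}. \<Sum>y\<in>{- int k..<int k}. 1)"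
    unfolding invs_def by (intro sum_mono) auto
  then show ?thesis by (simp add: power2_eq_square)
qed

lemma bruhat_imp_rk_le:
  assumes "(u, v) \<in> (bruhat_step k)\<^sup>*" "u \<in> signed_perms k"
  shows "v \<in> signed_perms k \<and> rk_le (centre u) (centre v)"
  using assms
proof (induction rule: rtrancl_induct)
  case base
  then show ?case by (simp add: rk_le_def)
next
  case (step y z)
  then have y: "y \<in> signed_perms k" "rk_le (centre u) (centre y)" by auto
  from step obtain t where z: "z = y \<circ> t" and t: "t \<in> reflections_B k" and l: "length_B k y < length_B k z"
    by (auto simp: bruhat_step_def)
  note t' = reflections_signed[OF t]
  obtain a b where ab: "a \<in> {- int k..<int k}" "b \<in> {- int k..<int k}" "a < b" "centre t = mrefl a b"
    using t'(2) by blast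
  have zs: "z \<in> signed_perms k" unfolding z using y t' by (intro signed_perms_comp) auto
  define Y where "Y = centre y"
  have Y: "Y \<in> centred k" unfolding Y_def using y by (simp add: centre_centred)
  have cz: "centre z = Y \<circ> mrefl a b" unfolding z Y_def centre_comp[OF t'(1)] ab(4) ..
  then have Z: "Y \<circ> mrefl a b \<in> centred k" using centre_centred[OF zs] by simp
  \<comment> \<open>Otherwise the reflection would lower \<open>invs\<close> without raising the
    rank at the origin, so the length would drop.\<close>
  have "Y a < Y b"
  proof (rule ccontr)
    assume "\<not> Y a < Y b"
    then have lt: "Y b < Y a" using centredD(6)[OF Y, of a b] ab(3) by linarith
    then have lt': "(Y \<circ> mrefl a b) a < (Y \<circ> mrefl a b) b" using ab(3) by (simp add: mrefl_apply)
    have "rk (Y \<circ> mrefl a b) 0 0 \<le> rk Y 0 0"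
      using rk_mrefl_ge[OF Z ab(3) lt'] unfolding rk_le_def mrefl_comp_mrefl by blast
    moreover have "invs k (Y \<circ> mrefl a b) < invs k Y"
      using invs_mrefl_gt[OF Z ab(3) lt' ab(1,2)] unfolding mrefl_comp_mrefl .
    ultimately show False
      using l length_B_centre[OF y(1)] length_B_centre[OF zs] unfolding cz Y_def[symmetric] by linarith
  qed
  then have "rk_le Y (centre z)" unfolding cz by (rule rk_mrefl_ge[OF Y ab(3)])
  then show ?case using zs y(2) unfolding Y_def rk_le_def by (meson order_trans)
qed

lemma rk_le_imp_bruhat:
  assumes "u \<in> signed_perms k" "v \<in> signed_perms k" "rk_le (centre u) (centre v)"
  shows "(u, v) \<in> (bruhat_step k)\<^sup>*"
  using assms
\<comment> \<open>\<open>invs\<close> grows with each reflection and is bounded by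
  \<open>invs_le\<close>, so the climb towards \<open>v\<close> terminates.\<close>
proof (induction "nat ((2 * int k)\<^sup>2 - invs k (centre u))" arbitrary: u rule: less_induct)
  case less
  note u = less.prems(1) and v = less.prems(2)
  note U = centre_centred[OF u]
  show ?case
  proof (cases "u = v")
    case False
    then have "centre u \<noteq> centre v" using centre_inj[OF u v] by simp
    from cover_below[OF U centre_centred[OF v] less.prems(3) this]
    obtain a b where ab: "a \<in> {- int k..<int k}" "b \<in> {- int k..<int k}" "a < b" "centre u a < centre u b"
      "rk_le (centre u \<circ> mrefl a b) (centre v)" by metis
    obtain t where t: "t \<in> reflections_B k" "centre t = mrefl a b"
      using mrefl_reflection[OF ab(1,2)] ab(3) by auto
    note t' = reflections_signed(1)[OF t(1)]
    have ut: "u \<circ> t \<in> signed_perms k" "centre (u \<circ> t) = centre u \<circ> mrefl a b"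
      using u t' t(2) by (auto simp: signed_perms_comp centre_comp)
    have inc: "invs k (centre u) < invs k (centre (u \<circ> t))"
      unfolding ut(2) by (rule invs_mrefl_gt[OF U ab(3,4,1,2)])
    have "rk (centre u) 0 0 \<le> rk (centre (u \<circ> t)) 0 0"
      using rk_mrefl_ge[OF U ab(3,4)] unfolding ut(2) by (simp add: rk_le_def)
    with inc have "length_B k u < length_B k (u \<circ> t)"
      using length_B_centre[OF u] length_B_centre[OF ut(1)] by linarith
    then have "(u, u \<circ> t) \<in> bruhat_step k" using u t(1) by (auto simp: bruhat_step_def)
    moreover have "(u \<circ> t, v) \<in> (bruhat_step k)\<^sup>*"
      using less.hyps[OF _ ut(1) v] inc invs_le[of k "centre (u \<circ> t)"] ab(5) ut(2) by auto
    ultimately show ?thesis by (rule converse_rtrancl_into_rtrancl)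
  qed simp
qed

text \<open>This is the known fact that Bruhat order of type B is inherited from the symmetric group
  on \<open>{- int k..<int k}\<close>, whose Bruhat order has the same description by ranks.\<close>

theorem bruhat_iff_rk_le:
  "(u, v) \<in> bruhat k \<longleftrightarrow> u \<in> signed_perms k \<and> v \<in> signed_perms k \<and> rk_le (centre u) (centre v)"
proof
  assume "(u, v) \<in> bruhat k"
  then have "(u, v) \<in> (bruhat_step k)\<^sup>*" "u \<in> signed_perms k" by (simp_all add: bruhat_def)
  then show "u \<in> signed_perms k \<and> v \<in> signed_perms k \<and> rk_le (centre u) (centre v)"
    using bruhat_imp_rk_le by simp
next
  assume "u \<in> signed_perms k \<and> v \<in> signed_perms k \<and> rk_le (centre u) (centre v)"
  then show "(u, v) \<in> bruhat k" using rk_le_imp_bruhat by (simp add: bruhat_def)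
qed

section \<open>Doubled permutations\<close>

definition dbl :: "(int \<Rightarrow> int) \<Rightarrow> int set \<Rightarrow> int \<Rightarrow> int" where
  "dbl s S x = 2 * s (x div 2) + (if x div 2 \<in> S then 1 - x mod 2 else x mod 2)"

definition dbl_data :: "nat \<Rightarrow> (int \<Rightarrow> int) \<Rightarrow> int set \<Rightarrow> bool" where
  "dbl_data m s S \<longleftrightarrow> s \<in> centred m \<and> S \<subseteq> {- int m..<int m} \<and> (\<forall>x. - 1 - x \<in> S \<longleftrightarrow> x \<in> S)"

text \<open>Twice the length \<open>\<ell>\<^sub>\<W>\<close> of \<open>dbl s S\<close>; the set \<open>S\<close> is closed under \<open>x \<mapsto> - 1 - x\<close>, so it has
  twice the size of the set \<open>T\<close> of the pair \<open>(\<sigma>, T)\<close>.\<close>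

definition wlen :: "nat \<Rightarrow> (int \<Rightarrow> int) \<Rightarrow> int set \<Rightarrow> int" where
  "wlen m s S = 3 * invs m s + rk s 0 0 + int (card S)"

lemma dbl_div_mod:
  "dbl s S x div 2 = s (x div 2)"
  "dbl s S x mod 2 = (if x div 2 \<in> S then 1 - x mod 2 else x mod 2)"
proof -
  have "x mod 2 = 0 \<or> x mod 2 = 1" by presburger
  then show "dbl s S x div 2 = s (x div 2)"
    "dbl s S x mod 2 = (if x div 2 \<in> S then 1 - x mod 2 else x mod 2)"
    by (auto simp: dbl_def)
qed

lemma dbl_even_odd:
  "dbl s S (2 * k) = 2 * s k + of_bool (k \<in> S)"
  "dbl s S (2 * k + 1) = 2 * s k + of_bool (k \<notin> S)"
  by (auto simp: dbl_def)

lemma mirror_div_mod: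
  "(- 1 - x) div 2 = - 1 - x div 2" "(- 1 - x) mod 2 = 1 - x mod 2" for x :: int
  by presburger+

lemma div_mod_eqI: "x div 2 = y div 2 \<Longrightarrow> x mod 2 = y mod 2 \<Longrightarrow> x = y" for x y :: int
  by (metis mult_div_mod_eq)

lemma dbl_centred:
  assumes "dbl_data m s S"
  shows "dbl s S \<in> centred (2 * m)"
proof -
  have s: "s \<in> centred m" and S: "S \<subseteq> {- int m..<int m}" "\<And>x. - 1 - x \<in> S \<longleftrightarrow> x \<in> S"
    using assms by (auto simp: dbl_data_def)
  have "\<exists>!x. dbl s S x = y" for y
  proof
    define k where "k = inv s (y div 2)"
    have k: "s k = y div 2" unfolding k_def using centredD(4)[OF s] by (simp add: bij_def surj_f_inv_f)
    define x where "x = 2 * k + (if k \<in> S then 1 - y mod 2 else y mod 2)"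
    have "y mod 2 = 0 \<or> y mod 2 = 1" by presburger
    then have x: "x div 2 = k" "x mod 2 = (if k \<in> S then 1 - y mod 2 else y mod 2)"
      by (auto simp: x_def)
    show "dbl s S x = y"
      by (rule div_mod_eqI) (auto simp: dbl_div_mod x k)
    fix z assume z: "dbl s S z = y"
    then have "s (z div 2) = s k" using dbl_div_mod(1)[of s S z] k by simp
    then have "z div 2 = k" using centredD(6)[OF s] by simp
    then have zk: "z div 2 = x div 2" by (simp add: x(1))
    have "y mod 2 = (if k \<in> S then 1 - z mod 2 else z mod 2)"
      using dbl_div_mod(2)[of s S z] unfolding z zk x(1) .
    then have "z mod 2 = x mod 2" unfolding x(2) by simp
    then show "z = x" by (rule div_mod_eqI[OF zk])
  qed
  moreover have "dbl s S x = x" if "x \<notin> {- int (2 * m)..<int (2 * m)}" for x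
  proof -
    have "x div 2 < - int m \<or> int m \<le> x div 2" using that by auto
    then show ?thesis using centredD(5)[OF s, of "x div 2"] S(1) by (auto simp: dbl_def)
  qed
  moreover have "dbl s S (- 1 - x) = - 1 - dbl s S x" for x
    by (simp add: dbl_def mirror_div_mod S(2) centredD(2)[OF s])
  ultimately show ?thesis by (simp add: centred_def permutes_def)
qed

text \<open>Even cuts never divide a block, and a single odd cut gives the mean of the two
  neighbouring even ranks, so \<open>S\<close> is invisible there. Two odd cuts meet inside one cell
  of blocks; if \<open>s c = b\<close>, the block in this cell contributes exactly when its larger
  value comes first.\<close>

lemma rk_dbl:
  assumes "dbl_data m s S"
  shows "rk (dbl s S) (2 * c) (2 * b) = 2 * rk s c b"
    "rk (dbl s S) (2 * c + 1) (2 * b) = rk s c b + rk s (c + 1) b"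
    "rk (dbl s S) (2 * c) (2 * b + 1) = rk s c b + rk s c (b + 1)"
    "rk (dbl s S) (2 * c + 1) (2 * b + 1) = rk s (c + 1) (b + 1) + rk s c b + of_bool (s c = b \<and> c \<in> S)"
proof -
  have s: "s \<in> centred m" using assms by (auto simp: dbl_data_def)
  note v = dbl_centred[OF assms]
  let ?A = "{k. k < c \<and> b \<le> s k}"
  have "{x. x < 2 * c \<and> 2 * b \<le> dbl s S x} = (\<lambda>k. 2 * k) ` ?A \<union> (\<lambda>k. 2 * k + 1) ` ?A" (is "?L = ?R")
  proof (intro subset_antisym subsetI)
    fix x assume "x \<in> ?L"
    then have "x div 2 < c" "b \<le> dbl s S x div 2" by auto
    then have "x div 2 \<in> ?A" by (simp add: dbl_div_mod)
    moreover have "x = 2 * (x div 2) \<or> x = 2 * (x div 2) + 1" by presburger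
    ultimately show "x \<in> ?R" by blast
  next
    fix x assume "x \<in> ?R"
    then show "x \<in> ?L" by (auto simp: dbl_even_odd)
  qed
  moreover have "(\<lambda>k. 2 * k) ` ?A \<inter> (\<lambda>k. 2 * k + 1) ` ?A = {}" by (auto, presburger)
  moreover have "card ((\<lambda>k. 2 * k) ` ?A) = card ?A" "card ((\<lambda>k. 2 * k + 1) ` ?A) = card ?A"
    by (auto intro!: card_image inj_onI)
  ultimately show 1: "rk (dbl s S) (2 * c) (2 * b) = 2 * rk s c b"
    unfolding rk_def using finite_rk[OF s, of c b] by (simp add: card_Un_disjoint)
  have p: "rk s (c + 1) y = rk s c y + of_bool (y \<le> s c)" for y by (rule rk_Suc_pos[OF s])
  show 2: "rk (dbl s S) (2 * c + 1) (2 * b) = rk s c b + rk s (c + 1) b"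
    unfolding rk_Suc_pos[OF v] 1 p by (auto simp: dbl_even_odd)
  \<comment> \<open>The value \<open>2 * b\<close> sits at \<open>2 * k\<close> or
    \<open>2 * k + 1\<close>, and the even cut \<open>2 * c\<close> does not distinguish the
    two.\<close>
  define k where "k = inv s b"
  have k: "s k = b" unfolding k_def using centredD(4)[OF s] by (simp add: bij_def surj_f_inv_f)
  have "dbl s S (2 * k + of_bool (k \<in> S)) = 2 * b" using k by (auto simp: dbl_even_odd)
  from rk_val_neq[OF v this, of "2 * c"] rk_val_neq[OF s k, of c] 1
  show 3: "rk (dbl s S) (2 * c) (2 * b + 1) = rk s c b + rk s c (b + 1)"
    by (auto split: if_splits simp: of_bool_def)
  show "rk (dbl s S) (2 * c + 1) (2 * b + 1) = rk s (c + 1) (b + 1) + rk s c b + of_bool (s c = b \<and> c \<in> S)"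
    unfolding rk_Suc_pos[OF v] 3 p by (auto simp: dbl_even_odd)
qed

lemma rk_le_dbl_iff:
  assumes "dbl_data m s S" "dbl_data m t T"
  shows "rk_le (dbl s S) (dbl t T) \<longleftrightarrow> rk_le s t \<and>
    (\<forall>c b. rk s (c + 1) (b + 1) + rk s c b + of_bool (s c = b \<and> c \<in> S)
         \<le> rk t (c + 1) (b + 1) + rk t c b + of_bool (t c = b \<and> c \<in> T))" (is "?L \<longleftrightarrow> ?R")
proof
  assume L: ?L
  have "2 * rk s c b \<le> 2 * rk t c b" for c b
    using L rk_dbl(1)[OF assms(1), of c b] rk_dbl(1)[OF assms(2), of c b] unfolding rk_le_def by metis
  moreover have "rk s (c + 1) (b + 1) + rk s c b + of_bool (s c = b \<and> c \<in> S)
         \<le> rk t (c + 1) (b + 1) + rk t c b + of_bool (t c = b \<and> c \<in> T)" for c b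
    using L rk_dbl(4)[OF assms(1), of c b] rk_dbl(4)[OF assms(2), of c b] unfolding rk_le_def by metis
  ultimately show ?R by (simp add: rk_le_def)
next
  assume R: ?R
  then have le: "rk s c b \<le> rk t c b" for c b by (simp add: rk_le_def)
  show ?L unfolding rk_le_def
  proof (intro allI)
    fix c b :: int
    have "c = 2 * (c div 2) \<or> c = 2 * (c div 2) + 1" "b = 2 * (b div 2) \<or> b = 2 * (b div 2) + 1"
      by presburger+
    then obtain c' b' where "c = 2 * c' \<or> c = 2 * c' + 1" "b = 2 * b' \<or> b = 2 * b' + 1" by blast
    then show "rk (dbl s S) c b \<le> rk (dbl t T) c b"
      using R le[of c' b'] le[of "c' + 1" b'] le[of c' "b' + 1"]
      by (auto simp: rk_dbl[OF assms(1)] rk_dbl[OF assms(2)])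
  qed
qed

lemma sum_double:
  fixes F :: "int \<Rightarrow> int"
  shows "(\<Sum>x\<in>{- int (2 * m)..<int (2 * m)}. F x) = (\<Sum>k\<in>{- int m..<int m}. F (2 * k) + F (2 * k + 1))"
proof -
  let ?A = "{- int m..<int m}"
  have "{- int (2 * m)..<int (2 * m)} = (\<lambda>k. 2 * k) ` ?A \<union> (\<lambda>k. 2 * k + 1) ` ?A" (is "?L = ?R")
  proof (intro subset_antisym subsetI)
    fix x assume "x \<in> ?L"
    then have "x div 2 \<in> ?A" by auto
    moreover have "x = 2 * (x div 2) \<or> x = 2 * (x div 2) + 1" by presburger
    ultimately show "x \<in> ?R" by blast
  qed auto
  moreover have "(\<lambda>k. 2 * k) ` ?A \<inter> (\<lambda>k. 2 * k + 1) ` ?A = {}" by (auto, presburger)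
  ultimately have "(\<Sum>x\<in>?L. F x) = (\<Sum>x\<in>(\<lambda>k. 2 * k) ` ?A. F x) + (\<Sum>x\<in>(\<lambda>k. 2 * k + 1) ` ?A. F x)"
    by (simp add: sum.union_disjoint)
  also have "\<dots> = (\<Sum>k\<in>?A. F (2 * k)) + (\<Sum>k\<in>?A. F (2 * k + 1))"
    by (subst (1 2) sum.reindex) (auto intro: inj_onI)
  finally show ?thesis by (simp add: sum.distrib)
qed

text \<open>Different blocks compare as a whole, so an inversion of \<open>s\<close> yields four;
  inside a block there is one exactly if it is reversed.\<close>

lemma invs_dbl:
  assumes "dbl_data m s S"
  shows "invs (2 * m) (dbl s S) = 4 * invs m s + int (card S)"
proof -
  let ?A = "{- int m..<int m}"
  have s: "s \<in> centred m" and S: "S \<subseteq> ?A" using assms by (auto simp: dbl_data_def)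
  have "invs (2 * m) (dbl s S) =
     (\<Sum>k\<in>?A. \<Sum>l\<in>?A. 4 * of_bool (k < l \<and> s l < s k) + (if k = l then of_bool (k \<in> S) else 0))"
    unfolding invs_def sum_double sum.distrib[symmetric]
  proof (intro sum.cong refl)
    fix k l
    show "of_bool (2 * k < 2 * l \<and> dbl s S (2 * l) < dbl s S (2 * k)) +
       of_bool (2 * k < 2 * l + 1 \<and> dbl s S (2 * l + 1) < dbl s S (2 * k)) +
       (of_bool (2 * k + 1 < 2 * l \<and> dbl s S (2 * l) < dbl s S (2 * k + 1)) +
        of_bool (2 * k + 1 < 2 * l + 1 \<and> dbl s S (2 * l + 1) < dbl s S (2 * k + 1))) =
       4 * of_bool (k < l \<and> s l < s k) + (if k = l then of_bool (k \<in> S) else (0 :: int))"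
    proof (cases "k = l")
      case False
      then have "s k \<noteq> s l" using centredD(6)[OF s] by simp
      then have "dbl s S (2 * l + i) < dbl s S (2 * k + j) \<longleftrightarrow> s l < s k" if "i \<in> {0, 1}" "j \<in> {0, 1}" for i j
        using that by (auto simp: dbl_even_odd of_bool_def split: if_splits)
      from this[of 0 0] this[of 0 1] this[of 1 0] this[of 1 1] show ?thesis using False by auto
    qed (auto simp: dbl_even_odd)
  qed
  also have "\<dots> = 4 * invs m s + (\<Sum>k\<in>?A. of_bool (k \<in> S))"
    by (simp add: sum.distrib invs_def sum_distrib_left mult.commute)
  also have "(\<Sum>k\<in>?A. of_bool (k \<in> S)) = int (card S)"
    using S by (simp add: Int_absorb1 Int_def[symmetric])
  finally show ?thesis .
qed

text \<open>Only the ranks at odd cuts see \<open>S\<close>. If no block can be reversed below \<open>(t, T)\<close>, then all blocks that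
  a cover of \<open>s\<close> below \<open>t\<close> moves are already reversed; moving them and putting them back in
  increasing order raises the length by one.\<close>

lemma even_step:
  assumes d: "dbl_data m s S" "dbl_data m t T"
    and le: "rk_le (dbl s S) (dbl t T)" and ne: "\<not> (s = t \<and> S = T)"
  shows "\<exists>s' S'. dbl_data m s' S' \<and> rk_le (dbl s S) (dbl s' S') \<and> rk_le (dbl s' S') (dbl t T)
    \<and> wlen m s' S' = wlen m s S + 2"
proof -
  \<comment> \<open>\<open>f\<close> is the rank at the two odd cuts through the cell
    \<open>(c, b)\<close>, and \<open>h\<close> its part that ignores the reversed blocks.\<close>
  define h where "h r c b = rk r (c + 1) (b + 1) + rk r c b" for r c b
  define f where "f r R c b = h r c b + of_bool (r c = b \<and> c \<in> R)" for r c b and R :: "int set"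
  have s: "s \<in> centred m" and S: "S \<subseteq> {- int m..<int m}" "\<And>x. - 1 - x \<in> S \<longleftrightarrow> x \<in> S"
    and t: "t \<in> centred m" and T: "T \<subseteq> {- int m..<int m}" "\<And>x. - 1 - x \<in> T \<longleftrightarrow> x \<in> T"
    using d by (auto simp: dbl_data_def)
  have fS: "finite S" using S(1) by (rule finite_subset) simp
  note ms = centredD(2)[OF s] and mt = centredD(2)[OF t]
  have crit: "rk_le (dbl r R) (dbl r' R') \<longleftrightarrow> rk_le r r' \<and> (\<forall>c b. f r R c b \<le> f r' R' c b)"
    if "dbl_data m r R" "dbl_data m r' R'" for r R r' R'
    using rk_le_dbl_iff[OF that] by (simp add: f_def h_def)
  have st: "rk_le s t" and fle: "\<And>c b. f s S c b \<le> f t T c b" using le crit[OF d] by auto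
  have hle: "h r c b \<le> h r' c b" if "rk_le r r'" for r r' c b
    using that by (auto simp: h_def rk_le_def intro: add_mono)
  \<comment> \<open>The correction term of \<open>rk_mirror\<close> is the same for all permutations
    and cancels in differences.\<close>
  have hmir: "h r (- 1 - c) (- 1 - b) - h r' (- 1 - c) (- 1 - b) = h r c b - h r' c b"
    if "r \<in> centred m" "r' \<in> centred m" for r r' c b
    using rk_mirror[OF that(1), of c b] rk_mirror[OF that(1), of "c + 1" "b + 1"]
      rk_mirror[OF that(2), of c b] rk_mirror[OF that(2), of "c + 1" "b + 1"]
    by (simp add: h_def minus_diff_commute[of c 1] minus_diff_commute[of b 1])
  show ?thesis
  \<comment> \<open>Reversing block \<open>k\<close> and its mirror raises the corner rank at these
    two blocks by one and no other rank, so a strict inequality there is all that is needed.\<close>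
  proof (cases "\<exists>k. k \<in> {- int m..<int m} \<and> k \<notin> S \<and> f s S k (s k) < f t T k (s k)")
    case True
    then obtain k where k: "k \<in> {- int m..<int m}" "k \<notin> S" "f s S k (s k) < f t T k (s k)" by blast
    define S' where "S' = insert k (insert (- 1 - k) S)"
    have d': "dbl_data m s S'" using s S k by (auto simp: dbl_data_def S'_def)
    have "- 1 - k \<notin> S" using k(2) S(2) by simp
    then have card: "card S' = card S + 2" using k(2) fS by (simp add: S'_def)
    have mir: "f s S (- 1 - k) (- 1 - s k) < f t T (- 1 - k) (- 1 - s k)"
      using k(3) hmir[OF s t, of k "s k"] S(2)[of k] T(2)[of k] by (simp add: f_def ms mt)
    have "rk_le (dbl s S) (dbl s S')"
      unfolding crit[OF d(1) d'] by (auto simp: rk_le_def f_def S'_def)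
    moreover have "rk_le (dbl s S') (dbl t T)"
      unfolding crit[OF d' d(2)]
    proof (intro conjI allI st)
      fix c b
      show "f s S' c b \<le> f t T c b"
      proof (cases "s c = b \<and> (c = k \<or> c = - 1 - k)")
        case True
        then have "f s S' c b \<le> f s S c b + 1" by (auto simp: f_def)
        also have "\<dots> \<le> f t T c b" using True k(3) mir ms by auto
        finally show ?thesis .
      next
        case False
        then have "f s S' c b = f s S c b" by (auto simp: f_def S'_def)
        then show ?thesis using fle by simp
      qed
    qed
    ultimately show ?thesis using d' card by (intro exI[of _ s] exI[of _ S']) (simp add: wlen_def)
  next
    case False
    then have full: "k \<in> S" if "f s S k (s k) < f t T k (s k)" "k \<in> {- int m..<int m}" for k
      using that by blast
    \<comment> \<open>For \<open>s = t\<close>, comparing \<open>f\<close> at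
      \<open>(k, s k)\<close> gives \<open>S \<subseteq> T\<close>, and \<open>full\<close> gives
      the converse.\<close>
    have "s \<noteq> t"
    proof
      assume eq: "s = t"
      have "k \<in> T" if "k \<in> S" for k using fle[of k "s k"] that by (cases "k \<in> T") (auto simp: eq f_def)
      moreover have "k \<in> S" if "k \<in> T" for k using full[of k] that T(1) by (cases "k \<in> S") (auto simp: eq f_def)
      ultimately show False using eq ne by blast
    qed
    from cover_below[OF s t st this] obtain a b where
      I: "a \<in> {- int m..<int m}" "b \<in> {- int m..<int m}" and ab: "a < b" "s a < s b"
      and empty: "\<And>x. a < x \<Longrightarrow> x < b \<Longrightarrow> \<not> (s a < s x \<and> s x < s b)"
      and s't: "rk_le (s \<circ> mrefl a b) t"
      and kind: "b = - 1 - a \<or> b < - 1 - a \<and> \<not> (0 \<le> b \<and> s a < 0 \<and> 0 \<le> s b)"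
      by blast
    define s' where "s' = s \<circ> mrefl a b"
    define R where "R = {a, b, - 1 - a, - 1 - b}"
    define S' where "S' = S - R"
    have s': "s' \<in> centred m" unfolding s'_def using s I by (intro comp_centred mrefl_centred)
    have ss': "rk_le s s'" unfolding s'_def by (rule rk_mrefl_ge[OF s ab])
    have rk': "rk s' c y = rk s c y + of_bool (a < c \<and> c \<le> b \<and> s a < y \<and> y \<le> s b)
       + of_bool (b \<noteq> - 1 - a \<and> a < - c \<and> - c \<le> b \<and> s a < - y \<and> - y \<le> s b)" for c y
    proof (cases "b = - 1 - a")
      case True
      then show ?thesis using rk_mrefl_self[OF s, of a c y] ab ms[of a] by (simp add: s'_def)
    next
      case False
      then show ?thesis using rk_mrefl[OF s ab False, of c y] by (simp add: s'_def)
    qed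
    \<comment> \<open>One of the two ranks in the corner of each moved block is taken at a cut
      inside the rectangle of the cover. If such a block were not reversed, the target would have
      room for reversing it, against \<open>full\<close>.\<close>
    have ha: "h s a (s a) < h s' a (s a)" and hb: "h s b (s b) < h s' b (s b)"
      unfolding h_def rk' using ab by auto
    have hR: "h s c (s c) < h s' c (s c)" if "c \<in> R" for c
      using that ha hb hmir[OF s s', of a "s a"] hmir[OF s s', of b "s b"] by (auto simp: R_def ms)
    have RS: "R \<subseteq> S"
    proof -
      have "k \<in> S" if "k \<in> {a, b}" for k
      proof (rule ccontr)
        assume "k \<notin> S"
        then have "f s S k (s k) = h s k (s k)" by (simp add: f_def)
        also have "\<dots> < h s' k (s k)" using hR that by (auto simp: R_def)
        also have "\<dots> \<le> h t k (s k)" using hle s't by (simp add: s'_def)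
        also have "\<dots> \<le> f t T k (s k)" by (simp add: f_def)
        finally show False using full[of k] \<open>k \<notin> S\<close> that I by auto
      qed
      then show ?thesis using S(2) by (auto simp: R_def)
    qed
    have d': "dbl_data m s' S'" using s' S by (auto simp: dbl_data_def S'_def R_def)
    have s'c: "s' c = s c" if "c \<notin> R" for c using that by (simp add: s'_def R_def mrefl_apply)
    \<comment> \<open>A block that stays lies outside the rectangle and its mirror image by the
      cover property, so neither of the two ranks in its corner changes.\<close>
    have hsame: "h s' c (s c) = h s c (s c)" if "c \<notin> R" for c
    proof -
      have ne: "s c \<noteq> s a" "s c \<noteq> s b" "s (- 1 - c) \<noteq> s a" "s (- 1 - c) \<noteq> s b" "c \<noteq> a" "c \<noteq> b" "- 1 - c \<noteq> a" "- 1 - c \<noteq> b"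
        using that centredD(6)[OF s] by (auto simp: R_def)
      have "\<not> (a < c \<and> c \<le> b \<and> s a < s c \<and> s c \<le> s b)"
        "\<not> (a < c + 1 \<and> c + 1 \<le> b \<and> s a < s c + 1 \<and> s c + 1 \<le> s b)"
        using empty[of c] ne(1,2,5,6) by linarith+
      moreover have "\<not> (a < - c \<and> - c \<le> b \<and> s a < - s c \<and> - s c \<le> s b)"
        "\<not> (a < - (c + 1) \<and> - (c + 1) \<le> b \<and> s a < - (s c + 1) \<and> - (s c + 1) \<le> s b)"
        using empty[of "- 1 - c"] ne(3,4,7,8) unfolding ms[of c] by linarith+
      ultimately show ?thesis unfolding h_def rk' by (simp only: simp_thms of_bool_eq add_0_right)
    qed
    have 1: "rk_le (dbl s S) (dbl s' S')"
      unfolding crit[OF d(1) d']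
    proof (intro conjI allI ss')
      fix c y
      \<comment> \<open>A block that is put back in order loses its summand for \<open>S\<close>,
        but \<open>hR\<close> gains at least as much.\<close>
      show "f s S c y \<le> f s' S' c y"
        using hle[OF ss', of c y] hR[of c] s'c[of c] by (cases "c \<in> R") (auto simp: f_def S'_def)
    qed
    have 2: "rk_le (dbl s' S') (dbl t T)"
      unfolding crit[OF d' d(2)]
    proof (intro conjI allI)
      show "rk_le s' t" using s't by (simp add: s'_def)
      fix c y
      show "f s' S' c y \<le> f t T c y"
      proof (cases "s' c = y \<and> c \<in> S'")
        case True
        then have "c \<notin> R" "c \<in> S" by (auto simp: S'_def)
        then have "f s' S' c y = f s S c y" using True s'c[of c] hsame[of c] by (auto simp: f_def)
        then show ?thesis using fle by simp
      next
        case False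
        then have "f s' S' c y = h s' c y" unfolding f_def by auto
        then have "f s' S' c y \<le> h t c y" using hle[OF s't[folded s'_def]] by simp
        then show ?thesis by (simp add: f_def add_increasing2)
      qed
    qed
    have cS: "int (card S') = int (card S) - int (card R)"
      unfolding S'_def using RS fS by (simp add: card_Diff_subset finite_subset card_mono of_nat_diff)
    \<comment> \<open>The reflection in \<open>a\<close> and \<open>- 1 - a\<close> contributes 3 *
      1 + 1 - 2, any other one 3 * 2 + 0 - 4; both equal 2.\<close>
    have "wlen m s' S' = wlen m s S + 2"
    proof (cases "b = - 1 - a")
      case True
      then have a0: "s a < - 1 - s a" "a < - 1 - a" using ab ms by auto
      then have "rk s' 0 0 = rk s 0 0 + 1" using rk'[of 0 0] True ms[of a] by auto
      moreover have "invs m s' = invs m s + 1"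
        unfolding s'_def True using invs_mrefl_self_cover[OF s a0(2,1) I(1)] empty True ms[of a] by simp
      moreover have "R = {a, - 1 - a}" by (auto simp: R_def True)
      then have "card R = 2" by simp
      ultimately show ?thesis using cS by (simp add: wlen_def)
    next
      case False
      then have k: "b < - 1 - a" "\<not> (0 \<le> b \<and> s a < 0 \<and> 0 \<le> s b)" using kind by auto
      then have "rk s' 0 0 = rk s 0 0" using rk'[of 0 0] by auto
      moreover have "invs m s' = invs m s + 2"
        unfolding s'_def by (rule invs_mrefl_cover[OF s ab k(1) I empty k(2)])
      moreover have "card R = 4" using ab False by (simp add: R_def)
      ultimately show ?thesis using cS by (simp add: wlen_def)
    qed
    then show ?thesis using d' 1 2 by blast
  qed
qed

section \<open>Wachs permutations of even size\<close>

definition partner :: "int \<Rightarrow> int" where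
  "partner z = (if even z then z + 1 else z - 1)"

text \<open>The guard leaves out \<open>2 * int m\<close> and \<open>- 1 - 2 * int m\<close>, the
  entries without a partner when the size is odd.\<close>

definition paired :: "nat \<Rightarrow> (int \<Rightarrow> int) \<Rightarrow> bool" where
  "paired m w \<longleftrightarrow> (\<forall>x. - 2 * int m \<le> w x \<and> w x < 2 * int m \<longrightarrow>
     w (x - 1) = partner (w x) \<or> w (x + 1) = partner (w x))"

lemma partner_simps:
  "partner (partner z) = z" "partner (- 1 - z) = - 1 - partner z" "partner z div 2 = z div 2"
  "y div 2 = z div 2 \<longleftrightarrow> y = z \<or> y = partner z"
  "partner (2 * y) = 2 * y + 1" "partner (2 * y + 1) = 2 * y" "partner y = partner z \<longleftrightarrow> y = z"
proof -
  have inv: "partner (partner z) = z" for z by (simp add: partner_def)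
  then show "partner y = partner z \<longleftrightarrow> y = z" by metis
  show "partner (partner z) = z" "partner (- 1 - z) = - 1 - partner z" "partner z div 2 = z div 2"
    by (cases "even z"; auto simp: partner_def elim!: evenE oddE)+
  show "y div 2 = z div 2 \<longleftrightarrow> y = z \<or> y = partner z"
    by (cases "even y"; cases "even z"; auto simp: partner_def elim!: evenE oddE)
  show "partner (2 * y) = 2 * y + 1" "partner (2 * y + 1) = 2 * y" by (simp_all add: partner_def)
qed

lemma paired_of_wachs:
  assumes v: "v \<in> wachs n"
  shows "paired (n div 2) (centre v)"
proof -
  define m where "m = n div 2"
  have s: "v \<in> signed_perms n" using v by (simp add: wachs_def)
  note sv = signed_permsD[OF s]
  define w where "w = centre v"
  have w: "w \<in> centred n" unfolding w_def by (rule centre_centred[OF s])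
  have pos: "w (x - 1) = partner (w x) \<or> w (x + 1) = partner (w x)" if x: "0 \<le> w x" "w x < 2 * int m" for x
  proof -
    define z where "z = w x div 2"
    have z: "0 \<le> z" "z < int m" using x by (auto simp: z_def)
    have "2 * int m \<le> int n" by (simp add: m_def)
    define p where "p = inv v (2 * z + 1)"
    define q where "q = inv v (2 * z + 2)"
    have vp: "v p = 2 * z + 1" "v q = 2 * z + 2"
      using sv(5) by (auto simp: p_def q_def bij_def surj_f_inv_f)
    have "2 * z + 1 \<in> {1..int n - 1}" using z \<open>2 * int m \<le> int n\<close> by auto
    then have "\<bar>inv v (2 * z + 1) - inv v (star n (2 * z + 1))\<bar> \<le> 1" using v unfolding wachs_def by blast
    moreover have "star n (2 * z + 1) = 2 * z + 2" using z \<open>2 * int m \<le> int n\<close> by (simp add: star_def)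
    ultimately have pq: "\<bar>p - q\<bar> \<le> 1" by (simp add: p_def q_def)
    have nz: "p \<noteq> 0" "q \<noteq> 0" "p \<noteq> q" using vp sv(2) z by auto
    have w1: "w (drop0 p) = 2 * z" "w (drop0 q) = 2 * z + 1"
      using vp nz z by (auto simp: w_def centre_def drop0_simps(1)) (auto simp: drop0_def)
    \<comment> \<open>\<open>p\<close> and \<open>q\<close> are nonzero and differ by one, so they
      lie on the same side of the gap at 0 and stay adjacent when it is closed.\<close>
    have adj: "drop0 q = drop0 p + 1 \<or> drop0 q = drop0 p - 1" using pq nz by (auto simp: drop0_def)
    have "w x = 2 * z \<or> w x = 2 * z + 1" unfolding z_def by presburger
    then have "x = drop0 p \<or> x = drop0 q" using w1 centredD(6)[OF w] by metis
    then show ?thesis using adj w1 by (auto simp: partner_simps)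
  qed
  show ?thesis unfolding paired_def m_def[symmetric] w_def[symmetric]
  proof (intro allI impI)
    fix x assume x: "- 2 * int m \<le> w x \<and> w x < 2 * int m"
    show "w (x - 1) = partner (w x) \<or> w (x + 1) = partner (w x)"
    proof (cases "0 \<le> w x")
      case False
      then have "w (- 1 - x - 1) = partner (w (- 1 - x)) \<or> w (- 1 - x + 1) = partner (w (- 1 - x))"
        using pos[of "- 1 - x"] x centredD(2)[OF w, of x] by auto
      moreover have "w (- 1 - x - 1) = - 1 - w (x + 1)" "w (- 1 - x + 1) = - 1 - w (x - 1)"
        using centredD(2)[OF w, of "x + 1"] centredD(2)[OF w, of "x - 1"] by simp_all
      ultimately show ?thesis unfolding centredD(2)[OF w, of x] partner_simps by auto
    qed (use pos[of x] x in auto)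
  qed
qed

lemma wachs_of_paired:
  assumes s: "v \<in> signed_perms n" and p: "paired (n div 2) (centre v)"
  shows "v \<in> wachs n"
proof -
  note sv = signed_permsD[OF s]
  define w where "w = centre v"
  have w: "w \<in> centred n" unfolding w_def by (rule centre_centred[OF s])
  have "\<bar>inv v a - inv v (star n a)\<bar> \<le> 1" if a: "a \<in> {1..int n - 1}" for a
  proof -
    define P where "P = inv w (a - 1)"
    have P: "w P = a - 1" using centredD(4)[OF w] by (simp add: P_def bij_def surj_f_inv_f)
    have "a - 1 < 2 * int (n div 2)" using a by auto
    then have "w (P - 1) = partner (w P) \<or> w (P + 1) = partner (w P)"
      using p[unfolded paired_def, folded w_def, rule_format, of P] P a by auto
    then obtain Q where Q: "Q = P - 1 \<or> Q = P + 1" "w Q = partner (a - 1)" using P by auto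
    have star: "star n a = partner (a - 1) + 1" using a by (auto simp: star_def partner_def)
    have "0 \<le> partner (a - 1)" using a by (auto simp: partner_def)
    have i: "inv v (w x + 1) = add0 x" if "0 \<le> w x" for x
    proof -
      have "v (add0 x) = w x + 1" using that sv(4)[of "add0 x"]
        by (auto simp: w_def centre_def drop0_def split: if_splits)
      then show ?thesis using sv(6) inv_f_eq by metis
    qed
    have "inv v a = add0 P" using i[of P] P a by simp
    moreover have "inv v (star n a) = add0 Q" using i[of Q] Q(2) \<open>0 \<le> partner (a - 1)\<close> star by simp
    \<comment> \<open>The positions \<open>- 1\<close> and 0 are the only adjacent ones that the gap
      separates. They carry values of opposite sign, whereas \<open>P\<close> and \<open>Q\<close>
      both carry nonnegative ones.\<close>
    moreover have "\<not> (P = - 1 \<and> Q = 0)" "\<not> (P = 0 \<and> Q = - 1)"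
      using centredD(2)[OF w, of 0] P Q(2) a \<open>0 \<le> partner (a - 1)\<close> by auto
    ultimately show ?thesis using Q(1) by (auto simp: add0_def)
  qed
  then show ?thesis using s by (simp add: wachs_def)
qed

text \<open>Go from left to right: the entry at \<open>2 * k - 1\<close> already has its partner at
  \<open>2 * k - 2\<close>, so the partner of the entry at \<open>2 * k\<close> can only follow it.
  The start is the fixed point \<open>- 2 * int m - 1\<close>, whose value is too small to be the
  partner of the first entry.\<close>

lemma paired_even_block:
  assumes w: "w \<in> centred (2 * m)" and p: "paired m w"
  shows "w (2 * k + 1) = partner (w (2 * k))"
proof (cases "- int m \<le> k")
  case True
  then show ?thesis
  proof (induction k rule: int_ge_induct)
    case base
    show ?case
    proof (cases "m = 0")
      case False
      then have "w (2 * (- int m) - 1) = 2 * (- int m) - 1" "- int (2 * m) \<le> w (2 * (- int m))"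
        "w (2 * (- int m)) < int (2 * m)"
        using centredD(5)[OF w, of "2 * (- int m) - 1"] centredD(7,8)[OF w, of "2 * (- int m)"] by auto
      moreover from this have "w (2 * (- int m) - 1) = partner (w (2 * (- int m))) \<or> ?thesis"
        using p unfolding paired_def by auto
      ultimately show ?thesis by (auto simp: partner_def split: if_splits)
    qed (use centredD(5)[OF w, of 0] centredD(5)[OF w, of 1] in \<open>simp add: partner_def\<close>)
  next
    case (step k)
    show ?case
    proof (cases "k + 1 < int m")
      case True
      have "w (2 * (k + 1) - 1) \<noteq> partner (w (2 * (k + 1)))"
      proof
        assume "w (2 * (k + 1) - 1) = partner (w (2 * (k + 1)))"
        then have "w (2 * k) = w (2 * (k + 1))" using step.IH by (simp add: partner_simps algebra_simps)
        then show False using centredD(6)[OF w, of "2 * k" "2 * (k + 1)"] by simp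
      qed
      moreover have "- 2 * int m \<le> w (2 * (k + 1)) \<and> w (2 * (k + 1)) < 2 * int m"
        using centredD(7,8)[OF w, of "2 * (k + 1)"] True step.hyps by auto
      ultimately show ?thesis using p[unfolded paired_def, rule_format, of "2 * (k + 1)"] by blast
    next
      case False
      then show ?thesis
        using centredD(5)[OF w, of "2 * (k + 1)"] centredD(5)[OF w, of "2 * (k + 1) + 1"]
        by (auto simp: partner_def)
    qed
  qed
next
  case False
  then show ?thesis
    using centredD(5)[OF w, of "2 * k"] centredD(5)[OF w, of "2 * k + 1"] by (auto simp: partner_def)
qed

lemma dbl_of_paired:
  assumes w: "w \<in> centred (2 * m)" and p: "paired m w"
  obtains s S where "dbl_data m s S" "w = dbl s S"
proof -
  note blk = paired_even_block[OF w p]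
  define s where "s k = w (2 * k) div 2" for k
  define S where "S = {k. odd (w (2 * k))}"
  have mir: "w (2 * (- 1 - k)) = - 1 - w (2 * k + 1)" for k
    using centredD(2)[OF w, of "2 * k + 1"] by (simp add: algebra_simps)
  have out: "w (2 * k) = 2 * k" if "k < - int m \<or> int m \<le> k" for k
    using centredD(5)[OF w, of "2 * k"] that by auto
  have "\<exists>!k. s k = y" for y
  proof
    define x where "x = inv w (2 * y)"
    have x: "w x = 2 * y" using centredD(4)[OF w] by (simp add: x_def bij_def surj_f_inv_f)
    have "x = 2 * (x div 2) \<or> x = 2 * (x div 2) + 1" by presburger
    then show "s (x div 2) = y"
    proof
      assume "x = 2 * (x div 2)"
      then show ?thesis using x by (simp add: s_def)
    next
      assume "x = 2 * (x div 2) + 1"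
      then have "partner (w (2 * (x div 2))) = 2 * y" using blk[of "x div 2"] x by simp
      then have "partner (w (2 * (x div 2))) div 2 = y" by simp
      then show ?thesis by (simp only: s_def partner_simps)
    qed
    fix k assume "s k = y"
    then have "w (2 * k) div 2 = w x div 2" by (simp add: s_def x)
    then have "w (2 * k) = w x \<or> partner (w (2 * k)) = w x"
      using partner_simps(4)[of "w (2 * k)" "w x"] by (auto simp: partner_simps)
    then have "2 * k = x \<or> 2 * k + 1 = x" using centredD(6)[OF w] blk[of k] by metis
    then show "k = x div 2" by auto
  qed
  moreover have "s k = k" if "k \<notin> {- int m..<int m}" for k using out[of k] that by (auto simp: s_def)
  moreover have "s (- 1 - k) = - 1 - s k" for k
    unfolding s_def mir blk mirror_div_mod partner_simps ..
  ultimately have "s \<in> centred m" by (simp add: centred_def permutes_def)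
  moreover have "S \<subseteq> {- int m..<int m}"
  proof
    fix k assume "k \<in> S"
    then show "k \<in> {- int m..<int m}" using out[of k] by (cases "k < - int m \<or> int m \<le> k") (auto simp: S_def)
  qed
  moreover have "- 1 - k \<in> S \<longleftrightarrow> k \<in> S" for k
  proof -
    have "odd (w (2 * (- 1 - k))) \<longleftrightarrow> odd (w (2 * k))" unfolding mir blk by (simp add: partner_def)
    then show ?thesis by (simp only: S_def mem_Collect_eq)
  qed
  ultimately have "dbl_data m s S" by (simp add: dbl_data_def)
  moreover have "w = dbl s S"
  proof
    fix x :: int
    have "2 * (y div 2) + of_bool (odd y) = y" "2 * (y div 2) + of_bool (\<not> odd y) = partner y" for y :: int
      by (auto simp: partner_def) presburger
    then have *: "w (2 * k) = dbl s S (2 * k)" "w (2 * k + 1) = dbl s S (2 * k + 1)" for k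
      unfolding blk dbl_even_odd s_def S_def mem_Collect_eq by simp_all
    have "x = 2 * (x div 2) \<or> x = 2 * (x div 2) + 1" by presburger
    then show "w x = dbl s S x"
    proof
      assume "x = 2 * (x div 2)"
      then show ?thesis using *(1)[of "x div 2"] by simp
    next
      assume "x = 2 * (x div 2) + 1"
      then show ?thesis using *(2)[of "x div 2"] by simp
    qed
  qed
  ultimately show thesis by (rule that)
qed

lemma paired_dbl: "paired m (dbl s S)"
  unfolding paired_def
proof (intro allI impI)
  fix x :: int
  have *: "dbl s S (2 * k + 1) = partner (dbl s S (2 * k))" for k by (auto simp: dbl_even_odd partner_def)
  have "x = 2 * (x div 2) \<or> x = 2 * (x div 2) + 1" by presburger
  then show "dbl s S (x - 1) = partner (dbl s S x) \<or> dbl s S (x + 1) = partner (dbl s S x)"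
    using *[of "x div 2"] partner_simps(1) by (metis add_diff_cancel_right')
qed

lemma dbl_inj:
  assumes "dbl s S = dbl t T"
  shows "s = t" "S = T"
proof -
  show st: "s = t"
  proof
    fix k
    show "s k = t k" using dbl_div_mod(1)[of s S "2 * k"] dbl_div_mod(1)[of t T "2 * k"] assms by simp
  qed
  have "k \<in> S \<longleftrightarrow> k \<in> T" for k
    using fun_cong[OF assms, of "2 * k"] unfolding st dbl_even_odd by (cases "k \<in> S"; cases "k \<in> T") auto
  then show "S = T" by blast
qed

section \<open>Comparison with \<open>wachs_even\<close> and \<open>even_component\<close>\<close>

definition block_set :: "int set \<Rightarrow> int set" where
  "block_set T = {k. \<bar>add0 k\<bar> \<in> T}"

lemma block_set_data:
  assumes "s \<in> signed_perms m" "T \<subseteq> {1..int m}"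
  shows "dbl_data m (centre s) (block_set T)"
  unfolding dbl_data_def
proof (intro conjI subsetI allI)
  show "centre s \<in> centred m" by (rule centre_centred[OF assms(1)])
  show "k \<in> {- int m..<int m}" if "k \<in> block_set T" for k
  proof -
    have "\<bar>add0 k\<bar> \<in> {1..int m}" using that assms(2) by (auto simp: block_set_def)
    then show ?thesis by (auto simp: add0_def split: if_splits)
  qed
  show "- 1 - k \<in> block_set T \<longleftrightarrow> k \<in> block_set T" for k
    by (simp add: block_set_def)
qed

lemma wachs_even_odd: "wachs_even m s T (- x) = - wachs_even m s T x"
  by (simp add: wachs_even_def of_window_def Let_def)

text \<open>The \<open>of_bool\<close> terms in \<open>wachs_even\<close> compensate for the missing
  0; in centred coordinates both signs obey one formula. Both sides are odd functions, so positive
  arguments suffice.\<close>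

lemma wachs_even_eq:
  assumes s: "s \<in> signed_perms m" and T: "T \<subseteq> {1..int m}"
  shows "wachs_even m s T = uncentre (dbl (centre s) (block_set T))"
proof -
  let ?v = "uncentre (dbl (centre s) (block_set T))"
  have v: "?v \<in> signed_perms (2 * m)" by (intro uncentre_signed dbl_centred block_set_data assms)
  have pos: "wachs_even m s T x = ?v x" if "0 < x" for x
  proof (cases "x \<le> int (2 * m)")
    case True
    define i where "i = (x + 1) div 2"
    have i: "i = (x - 1) div 2 + 1" "0 < i" using that by (auto simp: i_def)
    have nz: "s i \<noteq> 0" using signed_permsD(4)[OF s] i by auto
    have k: "(x - 1) div 2 = i - 1" using i by simp
    have add: "add0 (i - 1) = i" using i(2) by (simp add: add0_def)
    have B: "i - 1 \<in> block_set T \<longleftrightarrow> i \<in> T" using i(2) by (simp add: block_set_def add)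
    have V: "?v x = add0 (2 * drop0 (s i) + (if i \<in> T then 1 - (x - 1) mod 2 else (x - 1) mod 2))"
      using that unfolding uncentre_def dbl_def centre_def by (simp add: drop0_def[of x] k B add)
    have W: "wachs_even m s T x = (if i \<notin> T then
       (if odd x then 2 * s i - of_bool (s i > 0) else 2 * s i + of_bool (s i < 0))
     else
       (if odd x then 2 * s i + of_bool (s i < 0) else 2 * s i - of_bool (s i > 0)))"
      using that True unfolding wachs_even_def of_window_def i_def Let_def by simp
    have "(x - 1) mod 2 = (if odd x then 0 else 1)" by presburger
    then show ?thesis unfolding V W using nz by (auto simp: drop0_def add0_def)
  next
    case False
    then have "x \<notin> signed_range (2 * m)" by (simp add: signed_range_def)
    then have "?v x = x" using signed_permsD(7)[OF v] by simp
    then show ?thesis using False that by (simp add: wachs_even_def of_window_def)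
  qed
  show ?thesis
  proof
    fix x :: int
    consider "0 < x" | "x = 0" | "x < 0" by linarith
    then show "wachs_even m s T x = ?v x"
    proof cases
      case 2
      then show ?thesis by (simp add: wachs_even_def of_window_def uncentre_def)
    next
      case 3
      then show ?thesis using pos[of "- x"] wachs_even_odd[of m s T x] signed_permsD(3)[OF v, of x] by simp
    qed (rule pos)
  qed
qed

text \<open>This evaluates the \<open>THE\<close>: the nonnegative half of \<open>S\<close>, shifted
  by one, provides \<open>T\<close>, and \<open>dbl_inj\<close> gives uniqueness.\<close>

lemma even_component_eq:
  assumes d: "dbl_data m s S"
  shows "even_component m (uncentre (dbl s S)) = uncentre s"
  unfolding even_component_def
proof (rule the_equality)
  define T where "T = {i \<in> {1..int m}. i - 1 \<in> S}"
  have s: "s \<in> centred m" and S: "S \<subseteq> {- int m..<int m}" "\<And>x. - 1 - x \<in> S \<longleftrightarrow> x \<in> S"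
    using d by (auto simp: dbl_data_def)
  have "block_set T = S"
  proof (intro subset_antisym subsetI)
    fix k assume "k \<in> block_set T"
    then show "k \<in> S" using S(2)[of k]
      by (auto simp: block_set_def T_def add0_def minus_diff_commute[of k 1] split: if_splits)
  next
    fix k assume "k \<in> S"
    then show "k \<in> block_set T" using S(1) S(2)[of k]
      by (auto simp: block_set_def T_def add0_def minus_diff_commute[of k 1])
  qed
  moreover have T: "T \<subseteq> {1..int m}" by (auto simp: T_def)
  ultimately have "uncentre (dbl s S) = wachs_even m (uncentre s) T"
    using wachs_even_eq[OF uncentre_signed[OF s] T] by simp
  then show "uncentre s \<in> signed_perms m \<and> (\<exists>T\<subseteq>{1..int m}. uncentre (dbl s S) = wachs_even m (uncentre s) T)"
    using uncentre_signed[OF s] T by blast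
next
  fix r assume "r \<in> signed_perms m \<and> (\<exists>T\<subseteq>{1..int m}. uncentre (dbl s S) = wachs_even m r T)"
  then obtain T where r: "r \<in> signed_perms m" "T \<subseteq> {1..int m}" "uncentre (dbl s S) = wachs_even m r T" by blast
  then have "dbl s S = dbl (centre r) (block_set T)"
    using wachs_even_eq[OF r(1,2)] by (metis centre_uncentre)
  then have "s = centre r" by (rule dbl_inj)
  then show "r = uncentre s" using uncentre_centre[OF r(1)] by simp
qed

text \<open>Twice the length of the doubled permutation is
  \<open>4 * invs + card S + 2 * rk\<close>; subtracting \<open>invs + rk\<close> for
  \<open>s\<close> leaves the coefficients 3 and 1 of \<open>wlen\<close>.\<close>

lemma length_dbl:
  assumes d: "dbl_data m s S"
  shows "2 * (int (length_B (2 * m) (uncentre (dbl s S))) - int (length_B m (uncentre s))) = wlen m s S"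
proof -
  have s: "s \<in> centred m" using d by (simp add: dbl_data_def)
  show ?thesis
    using length_B_centre[OF uncentre_signed[OF s]] length_B_centre[OF uncentre_signed[OF dbl_centred[OF d]]]
      invs_dbl[OF d] rk_dbl(1)[OF d, of 0 0]
    by (simp add: wlen_def)
qed

section \<open>Inserting the largest entry\<close>

text \<open>The largest value sits at \<open>P\<close> and the smallest at \<open>- 1 - P\<close>; \<open>height P\<close> is the nonnegative one of
  these two positions.\<close>

definition height :: "int \<Rightarrow> int" where
  "height P = (if 0 \<le> P then P else - 1 - P)"

definition skip :: "int \<Rightarrow> int \<Rightarrow> int" where
  "skip h x = (if x < - h then x - 1 else if x < h then x else x + 1)"

definition unskip :: "int \<Rightarrow> int \<Rightarrow> int" where
  "unskip h x = (if x < - 1 - h then x + 1 else if h < x then x - 1 else x)"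

text \<open>Cuts lie between positions and need a map of their own: for \<open>0 \<le> h\<close>,
  \<open>skip h x < c\<close> holds exactly if \<open>x < unskip_cut h c\<close>.\<close>

definition unskip_cut :: "int \<Rightarrow> int \<Rightarrow> int" where
  "unskip_cut h c = (if c \<le> - 1 - h then c + 1 else if c \<le> h then c else c - 1)"

definition ins :: "nat \<Rightarrow> int \<Rightarrow> (int \<Rightarrow> int) \<Rightarrow> int \<Rightarrow> int" where
  "ins m P z x = (if x = P then 2 * int m else if x = - 1 - P then - 1 - 2 * int m
     else if - 1 - 2 * int m \<le> x \<and> x \<le> 2 * int m then z (unskip (height P) x) else x)"

text \<open>In terms of the index \<open>i\<close> of the triple \<open>(i, \<sigma>, S)\<close>,
  \<open>height P = 2 * (|i| - 1)\<close>, and \<open>P < 0\<close> means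
  \<open>i < 0\<close>.\<close>

definition slot :: "nat \<Rightarrow> int \<Rightarrow> bool" where
  "slot m P \<longleftrightarrow> - 1 - 2 * int m \<le> P \<and> P \<le> 2 * int m \<and> (if 0 \<le> P then even P else odd P)"

lemma height_nonneg: "0 \<le> height P" by (simp add: height_def)

lemma slot_height: "slot m P \<longleftrightarrow> even (height P) \<and> height P \<le> 2 * int m"
  by (auto simp: slot_def height_def)

lemma eq_height_iff: "x = P \<or> x = - 1 - P \<longleftrightarrow> x = height P \<or> x = - 1 - height P"
  by (auto simp: height_def)

lemma unskip_skip: "0 \<le> h \<Longrightarrow> unskip h (skip h x) = x"
  by (auto simp: unskip_def skip_def)

lemma skip_unskip: "0 \<le> h \<Longrightarrow> x \<noteq> h \<Longrightarrow> x \<noteq> - 1 - h \<Longrightarrow> skip h (unskip h x) = x"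
  by (auto simp: unskip_def skip_def)

lemma skip_neq: "0 \<le> h \<Longrightarrow> skip h x \<noteq> h" "0 \<le> h \<Longrightarrow> skip h x \<noteq> - 1 - h"
  by (auto simp: skip_def)

lemma skip_less: "skip h x < skip h y \<longleftrightarrow> x < y"
  by (auto simp: skip_def)

lemma skip_mirror: "0 \<le> h \<Longrightarrow> skip h (- 1 - x) = - 1 - skip h x"
  by (auto simp: skip_def)

lemma unskip_mirror: "0 \<le> h \<Longrightarrow> unskip h (- 1 - x) = - 1 - unskip h x"
  by (auto simp: unskip_def)

lemma skip_range:
  "0 \<le> h \<Longrightarrow> h \<le> 2 * int m \<Longrightarrow> - 2 * int m \<le> x \<and> x < 2 * int m \<Longrightarrow>
    - 1 - 2 * int m \<le> skip h x \<and> skip h x \<le> 2 * int m"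
  by (auto simp: skip_def)

lemma unskip_range:
  "0 \<le> h \<Longrightarrow> h \<le> 2 * int m \<Longrightarrow> - 1 - 2 * int m \<le> x \<and> x \<le> 2 * int m \<Longrightarrow> x \<noteq> h \<Longrightarrow> x \<noteq> - 1 - h \<Longrightarrow>
    - 2 * int m \<le> unskip h x \<and> unskip h x < 2 * int m"
  by (auto simp: unskip_def)

lemma ins_max [simp]: "ins m P z P = 2 * int m" "ins m P z (- 1 - P) = - 1 - 2 * int m"
  by (auto simp: ins_def)

lemma ins_skip:
  assumes "height P \<le> 2 * int m" "- 2 * int m \<le> y \<and> y < 2 * int m"
  shows "ins m P z (skip (height P) y) = z y"
  using skip_neq[OF height_nonneg[of P], of y] eq_height_iff[of "skip (height P) y" P] unskip_skip[OF height_nonneg[of P], of y]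
    skip_range[OF height_nonneg assms]
  by (auto simp: ins_def)

lemma ins_centred:
  assumes z: "z \<in> centred (2 * m)" and P: "height P \<le> 2 * int m"
  shows "ins m P z \<in> centred (2 * m + 1)"
proof -
  let ?h = "height P" and ?w = "ins m P z"
  have PI: "- 1 - 2 * int m \<le> P" "P \<le> 2 * int m" using P by (auto simp: height_def split: if_splits)
  have mir: "?w (- 1 - x) = - 1 - ?w x" for x
    using unskip_mirror[OF height_nonneg, of P x] centredD(2)[OF z] PI by (auto simp: ins_def)
  have out: "?w x = x" if "x \<notin> {- int (2 * m + 1)..<int (2 * m + 1)}" for x
    using that PI by (auto simp: ins_def)
  have mid: "?w x = z (unskip ?h x)" "- 2 * int m \<le> unskip ?h x \<and> unskip ?h x < 2 * int m" "skip ?h (unskip ?h x) = x"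
    if "- 1 - 2 * int m \<le> x \<and> x \<le> 2 * int m" "x \<noteq> P" "x \<noteq> - 1 - P" for x
  proof -
    have "x \<noteq> ?h" "x \<noteq> - 1 - ?h" using that eq_height_iff[of x P] by auto
    then show "- 2 * int m \<le> unskip ?h x \<and> unskip ?h x < 2 * int m" "skip ?h (unskip ?h x) = x"
      using unskip_range[OF height_nonneg P that(1)] skip_unskip[OF height_nonneg] by auto
    show "?w x = z (unskip ?h x)" using that by (simp add: ins_def)
  qed
  have zr: "- 2 * int m \<le> z y \<and> z y < 2 * int m" if "- 2 * int m \<le> y \<and> y < 2 * int m" for y
    using that centredD(7,8)[OF z, of y] by auto
  have inr: "- 1 - 2 * int m \<le> ?w x \<and> ?w x \<le> 2 * int m" if "- 1 - 2 * int m \<le> x \<and> x \<le> 2 * int m" for x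
    using mid(1)[OF that] zr[OF mid(2)[OF that]] by (cases "x = P \<or> x = - 1 - P") auto
  have inj: "inj_on ?w {- int (2 * m + 1)..<int (2 * m + 1)}"
  proof (rule inj_onI)
    fix x y assume xy: "x \<in> {- int (2 * m + 1)..<int (2 * m + 1)}" "y \<in> {- int (2 * m + 1)..<int (2 * m + 1)}"
      "?w x = ?w y"
    then have x: "- 1 - 2 * int m \<le> x \<and> x \<le> 2 * int m" and y: "- 1 - 2 * int m \<le> y \<and> y \<le> 2 * int m" by auto
    consider "x = P \<or> x = - 1 - P" | "y = P \<or> y = - 1 - P"
      | "x \<noteq> P" "x \<noteq> - 1 - P" "y \<noteq> P" "y \<noteq> - 1 - P" by blast
    then show "x = y"
    proof cases
      case 1
      then show ?thesis using xy(3) mid(1)[OF y] zr[OF mid(2)[OF y]] by (cases "y = P \<or> y = - 1 - P") auto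
    next
      case 2
      then show ?thesis using xy(3) mid(1)[OF x] zr[OF mid(2)[OF x]] by (cases "x = P \<or> x = - 1 - P") auto
    next
      case 3
      then have "unskip ?h x = unskip ?h y" using xy(3) mid(1)[OF x] mid(1)[OF y] centredD(6)[OF z] by simp
      then show ?thesis using mid(3)[OF x] mid(3)[OF y] 3 by metis
    qed
  qed
  have "?w ` {- int (2 * m + 1)..<int (2 * m + 1)} \<subseteq> {- int (2 * m + 1)..<int (2 * m + 1)}"
    using inr by force
  then have "bij_betw ?w {- int (2 * m + 1)..<int (2 * m + 1)} {- int (2 * m + 1)..<int (2 * m + 1)}"
    using inj endo_inj_surj[OF _ _ inj] by (simp add: bij_betw_def)
  then have "?w permutes {- int (2 * m + 1)..<int (2 * m + 1)}"
    using out bij_imp_permutes by blast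
  then show ?thesis using mir by (simp add: centred_def)
qed

text \<open>At these heights the largest entry counts as soon as it is left of the cut, the smallest
  never does, and the remaining positions are renumbered. By \<open>rk_leI\<close>, no other heights
  have to be compared in size \<open>2 * m + 1\<close>.\<close>

lemma rk_ins:
  assumes z: "z \<in> centred (2 * m)" and P: "height P \<le> 2 * int m" and b: "- 2 * int m \<le> b" "b \<le> 2 * int m"
  shows "rk (ins m P z) c b = of_bool (P < c) + rk z (unskip_cut (height P) c) b"
proof (cases "- 1 - 2 * int m \<le> c")
  case True
  let ?h = "height P" and ?w = "ins m P z"
  note w = ins_centred[OF z P]
  have PI: "- 1 - 2 * int m \<le> P" "P \<le> 2 * int m" using P by (auto simp: height_def split: if_splits)
  have h0: "0 \<le> ?h" by (rule height_nonneg)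
  show ?thesis using True
  proof (induction c rule: int_ge_induct)
    case base
    have "{x. x < - 1 - 2 * int m \<and> b \<le> ?w x} = {}"
      using centredD(5)[OF w] b by (auto simp: not_le)
    then have "rk ?w (- 1 - 2 * int m) b = 0" by (simp only: rk_def card.empty of_nat_0)
    moreover have g: "unskip_cut ?h (- 1 - 2 * int m) = - 2 * int m" using P h0 by (auto simp: unskip_cut_def)
    have "{x. x < - 2 * int m \<and> b \<le> z x} = {}"
      using centredD(5)[OF z] b by (auto simp: not_le)
    then have "rk z (- 2 * int m) b = 0" by (simp only: rk_def card.empty of_nat_0)
    ultimately show ?case using PI unfolding g by simp
  next
    case (step c)
    have IH: "rk ?w c b = of_bool (P < c) + rk z (unskip_cut ?h c) b" by (rule step.IH)
    have s: "rk ?w (c + 1) b = rk ?w c b + of_bool (b \<le> ?w c)" by (rule rk_Suc_pos[OF w])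
    consider "c = P" | "c = - 1 - P" | "c \<noteq> P" "c \<noteq> - 1 - P" by blast
    then show ?case
    proof cases
      case 1
      have "unskip_cut ?h (c + 1) = unskip_cut ?h c" using 1 by (auto simp: unskip_cut_def height_def)
      then show ?thesis using 1 s IH b by simp
    next
      case 2
      have "unskip_cut ?h (c + 1) = unskip_cut ?h c" using 2 by (auto simp: unskip_cut_def height_def)
      moreover have "P < c + 1 \<longleftrightarrow> P < c" using 2 by auto
      ultimately show ?thesis using s IH b 2 by simp
    next
      case 3
      then have c: "c \<noteq> ?h" "c \<noteq> - 1 - ?h" using eq_height_iff[of c P] by auto
      have g: "unskip_cut ?h (c + 1) = unskip_cut ?h c + 1" "unskip ?h c = unskip_cut ?h c"
        using c h0 by (auto simp: unskip_cut_def unskip_def)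
      have "b \<le> ?w c \<longleftrightarrow> b \<le> z (unskip_cut ?h c)"
      proof (cases "c \<le> 2 * int m")
        case True
        then show ?thesis using 3 step.hyps g by (simp add: ins_def)
      next
        case False
        then have "unskip_cut ?h c = c - 1" "z (c - 1) = c - 1" "?w c = c"
          using P h0 centredD(5)[OF z, of "c - 1"] PI by (auto simp: unskip_cut_def ins_def)
        then show ?thesis using False b by simp
      qed
      moreover have "P < c + 1 \<longleftrightarrow> P < c" using 3 by auto
      ultimately show ?thesis using s IH g rk_Suc_pos[OF z, of "unskip_cut ?h c" b] by simp
    qed
  qed
next
  case False
  note w = ins_centred[OF z P]
  have "{x. x < c \<and> b \<le> ins m P z x} = {}"
    using False centredD(5)[OF w] b by (auto simp: not_le)
  then have "rk (ins m P z) c b = 0" by (simp only: rk_def card.empty of_nat_0)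
  moreover have "unskip_cut (height P) c = c + 1" using False P by (auto simp: unskip_cut_def)
  moreover have "{x. x < c + 1 \<and> b \<le> z x} = {}"
  proof -
    have "\<not> (x < c + 1 \<and> b \<le> z x)" for x using centredD(5)[OF z, of x] False b by auto
    then show ?thesis by blast
  qed
  then have "rk z (c + 1) b = 0" by (simp only: rk_def card.empty of_nat_0)
  moreover have "\<not> P < c" using False P by (auto simp: height_def split: if_splits)
  ultimately show ?thesis by simp
qed

text \<open>The largest entry is inverted with everything to its right, the smallest with everything
  to its left. If \<open>P < 0\<close>, these two are inverted with each other, which
  \<open>invs\<close> counts once instead of twice; the rank at the origin supplies the missing 1
  and makes the formula uniform in \<open>P\<close>.\<close>

lemma invs_ins:
  assumes z: "z \<in> centred (2 * m)" and P: "height P \<le> 2 * int m"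
  shows "invs (2 * m + 1) (ins m P z) + rk (ins m P z) 0 0 =
    invs (2 * m) z + rk z 0 0 + 2 * (2 * int m - P)"
proof -
  let ?h = "height P" and ?w = "ins m P z" and ?N = "- 1 - P" and ?A = "{- int (2 * m)..<int (2 * m)}"
  let ?I = "{- int (2 * m + 1)..<int (2 * m + 1)}"
  have h0: "0 \<le> ?h" by (rule height_nonneg)
  have PI: "- 1 - 2 * int m \<le> P" "P \<le> 2 * int m" using P by (auto simp: height_def split: if_splits)
  define Z where "Z = ?I - {P, ?N}"
  have Z: "finite Z" "P \<notin> Z" "?N \<notin> Z" "P \<noteq> ?N" by (auto simp: Z_def)
  have IZ: "?I = insert P (insert ?N Z)" using PI by (auto simp: Z_def)
  define g :: "int \<Rightarrow> int \<Rightarrow> int" where "g x y = of_bool (x < y \<and> ?w y < ?w x)" for x y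
  have ZA: "Z = skip ?h ` ?A"
  proof (intro subset_antisym subsetI)
    fix x assume x: "x \<in> Z"
    then have "x \<noteq> ?h" "x \<noteq> - 1 - ?h" using eq_height_iff[of x P] by (auto simp: Z_def)
    then have "skip ?h (unskip ?h x) = x" "unskip ?h x \<in> ?A"
      using skip_unskip[OF h0] unskip_range[OF h0 P, of x] x by (auto simp: Z_def)
    then show "x \<in> skip ?h ` ?A" by (metis image_eqI)
  next
    fix x assume "x \<in> skip ?h ` ?A"
    then obtain y where y: "x = skip ?h y" "y \<in> ?A" by blast
    then show "x \<in> Z" using skip_range[OF h0 P, of y] skip_neq[OF h0, of y] eq_height_iff[of x P] by (auto simp: Z_def)
  qed
  have inj: "inj_on (skip ?h) ?A" by (metis h0 inj_on_def unskip_skip)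
  have "invs (2 * m + 1) ?w = (\<Sum>x\<in>Z. \<Sum>y\<in>Z. g x y) +
      (\<Sum>x\<in>Z. g P x + g x P + g ?N x + g x ?N) + g P ?N + g ?N P"
    unfolding invs_def IZ using Z
    by (simp add: g_def[symmetric] sum.distrib) (simp add: g_def)
  moreover have "(\<Sum>x\<in>Z. \<Sum>y\<in>Z. g x y) = invs (2 * m) z"
    unfolding invs_def ZA sum.reindex[OF inj] comp_def
    by (intro sum.cong refl) (use P in \<open>auto simp: g_def ins_skip skip_less\<close>)
  moreover have "(\<Sum>x\<in>Z. g P x + g x P + g ?N x + g x ?N) = 2 * (2 * int m - P) - 2 * of_bool (P < 0)"
  proof -
    have "(\<Sum>x\<in>Z. g P x + g x P + g ?N x + g x ?N) = (\<Sum>x\<in>Z. of_bool (P < x) + of_bool (x < ?N))"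
    proof (intro sum.cong refl)
      fix x assume "x \<in> Z"
      then obtain y where y: "x = skip ?h y" "y \<in> ?A" unfolding ZA by blast
      then have "?w x = z y" using ins_skip[OF P, of y] by auto
      moreover have "- 2 * int m \<le> z y" "z y < 2 * int m" using centredD(7,8)[OF z, of y] y by auto
      ultimately show "g P x + g x P + g ?N x + g x ?N = of_bool (P < x) + of_bool (x < ?N)"
        by (auto simp: g_def)
    qed
    also have "\<dots> = int (card {x \<in> Z. P < x}) + int (card {x \<in> Z. x < ?N})"
      using Z(1) by (simp add: sum.distrib Int_def)
    also have "{x \<in> Z. P < x} = {P + 1..2 * int m} - (if P < 0 then {?N} else {})"
      using PI by (auto simp: Z_def)
    also have "{x \<in> Z. x < ?N} = {- 1 - 2 * int m..?N - 1} - (if P < 0 then {P} else {})"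
      using PI by (auto simp: Z_def)
    finally show ?thesis using PI by (auto simp: of_nat_diff)
  qed
  moreover have "g P ?N = of_bool (P < 0)" "g ?N P = 0" by (auto simp: g_def)
  moreover have "rk ?w 0 0 = of_bool (P < 0) + rk z 0 0"
    using rk_ins[OF z P, of 0 0] h0 by (simp add: unskip_cut_def)
  ultimately show ?thesis by simp
qed

lemma paired_ins:
  assumes d: "dbl_data m s S" and P: "slot m P"
  shows "paired m (ins m P (dbl s S))"
  unfolding paired_def
proof (intro allI impI)
  let ?h = "height P" and ?z = "dbl s S" and ?w = "ins m P (dbl s S)"
  fix x assume x: "- 2 * int m \<le> ?w x \<and> ?w x < 2 * int m"
  note z = dbl_centred[OF d]
  have h: "0 \<le> ?h" "?h \<le> 2 * int m" "even ?h" using P height_nonneg by (auto simp: slot_height)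
  have w: "?w \<in> centred (2 * m + 1)" by (rule ins_centred[OF z h(2)])
  have xne: "x \<noteq> P" "x \<noteq> - 1 - P" using x by auto
  then have xh: "x \<noteq> ?h" "x \<noteq> - 1 - ?h" using eq_height_iff[of x P] by auto
  have xI: "- 1 - 2 * int m \<le> x \<and> x \<le> 2 * int m"
    using x centredD(7,8)[OF w, of x] by auto
  define y where "y = unskip ?h x"
  have y: "- 2 * int m \<le> y \<and> y < 2 * int m" "skip ?h y = x"
    using unskip_range[OF h(1,2) xI xh] skip_unskip[OF h(1) xh] by (auto simp: y_def)
  have wx: "?w x = ?z y" using ins_skip[OF h(2) y(1), of ?z] y(2) by simp
  define k where "k = y div 2"
  have k: "- int m \<le> k" "k < int m" using y(1) by (auto simp: k_def)
  \<comment> \<open>Since the height is even, neither inserted position separates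
    \<open>2 * k\<close> from \<open>2 * k + 1\<close>.\<close>
  have blk: "skip ?h (2 * k + 1) = skip ?h (2 * k) + 1" using h by (auto simp: skip_def elim!: evenE)
  have z2: "?z (2 * k + 1) = partner (?z (2 * k))" by (auto simp: dbl_even_odd partner_def)
  have w2: "?w (skip ?h (2 * k)) = ?z (2 * k)" "?w (skip ?h (2 * k) + 1) = ?z (2 * k + 1)"
    using ins_skip[OF h(2), of "2 * k" ?z] ins_skip[OF h(2), of "2 * k + 1" ?z] k blk by auto
  have "y = 2 * k \<or> y = 2 * k + 1" unfolding k_def by presburger
  then show "?w (x - 1) = partner (?w x) \<or> ?w (x + 1) = partner (?w x)"
  proof
    assume "y = 2 * k"
    then show ?thesis using w2 z2 y(2) by simp
  next
    assume "y = 2 * k + 1"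
    then have "x = skip ?h (2 * k) + 1" using y(2) blk by simp
    then show ?thesis using w2 z2 by (simp add: partner_simps)
  qed
qed

lemma ins_of_paired:
  assumes w: "w \<in> centred (2 * m + 1)" and p: "paired m w"
  obtains P s S where "slot m P" "dbl_data m s S" "w = ins m P (dbl s S)"
proof -
  define P where "P = inv w (2 * int m)"
  let ?h = "height P"
  have wP: "w P = 2 * int m" using centredD(4)[OF w] by (simp add: P_def bij_def surj_f_inv_f)
  have wN: "w (- 1 - P) = - 1 - 2 * int m" using centredD(2)[OF w, of P] wP by simp
  have PI: "- 1 - 2 * int m \<le> P" "P \<le> 2 * int m" using centredD(7,8)[OF w, of P] wP by auto
  have h: "0 \<le> ?h" "?h \<le> 2 * int m" using PI by (auto simp: height_def)
  have wr: "- 2 * int m \<le> w x \<and> w x < 2 * int m \<longleftrightarrow> - 1 - 2 * int m \<le> x \<and> x \<le> 2 * int m \<and> x \<noteq> ?h \<and> x \<noteq> - 1 - ?h" for x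
  proof -
    have "x \<noteq> P \<longleftrightarrow> w x \<noteq> 2 * int m" "x \<noteq> - 1 - P \<longleftrightarrow> w x \<noteq> - 1 - 2 * int m"
      using centredD(6)[OF w, of x] wP wN by metis+
    then show ?thesis using eq_height_iff[of x P] centredD(7,8)[OF w, of x] by auto
  qed
  define z where "z y = (if - 2 * int m \<le> y \<and> y < 2 * int m then w (skip ?h y) else y)" for y
  have zr: "- 2 * int m \<le> w (skip ?h y) \<and> w (skip ?h y) < 2 * int m" if "- 2 * int m \<le> y \<and> y < 2 * int m" for y
    using wr[of "skip ?h y"] skip_range[OF h that] skip_neq[OF h(1)] by blast
  have zc: "z \<in> centred (2 * m)"
  proof -
    let ?A = "{- int (2 * m)..<int (2 * m)}"
    have "inj_on z ?A"
    proof (rule inj_onI)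
      fix x y assume "x \<in> ?A" "y \<in> ?A" "z x = z y"
      then have "skip ?h x = skip ?h y" using centredD(6)[OF w] by (auto simp: z_def)
      then show "x = y" using unskip_skip[OF h(1)] by metis
    qed
    moreover have "z ` ?A \<subseteq> ?A" using zr by (auto simp: z_def)
    ultimately have "bij_betw z ?A ?A"
      using endo_inj_surj[of ?A z] by (simp add: bij_betw_def)
    then have "z permutes ?A" by (rule bij_imp_permutes) (auto simp: z_def)
    moreover have "z (- 1 - x) = - 1 - z x" for x
      using skip_mirror[OF h(1), of x] centredD(2)[OF w, of "skip ?h x"] by (auto simp: z_def)
    ultimately show ?thesis by (simp add: centred_def)
  qed
  \<comment> \<open>Adjacent positions that avoid both inserted ones lie on the same side of each,
    so they stay adjacent after the deletion.\<close>
  have adj: "x' = x + 1 \<or> x' = x - 1 \<Longrightarrow> unskip ?h x' = unskip ?h x + 1 \<or> unskip ?h x' = unskip ?h x - 1"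
    if "x \<noteq> ?h" "x \<noteq> - 1 - ?h" "x' \<noteq> ?h" "x' \<noteq> - 1 - ?h" for x x'
    using that h by (auto simp: unskip_def)
  have near: "\<exists>x'. (x' = x + 1 \<or> x' = x - 1) \<and> w x' = partner (w x) \<and>
      - 2 * int m \<le> w x' \<and> w x' < 2 * int m" if "- 2 * int m \<le> w x \<and> w x < 2 * int m" for x
  proof -
    have "- 2 * int m \<le> partner (w x) \<and> partner (w x) < 2 * int m"
      using that by (auto simp: partner_def elim!: evenE oddE)
    then show ?thesis using p[unfolded paired_def, rule_format, OF that] by metis
  qed
  have "paired m z"
    unfolding paired_def
  proof (intro allI impI)
    fix y assume zy: "- 2 * int m \<le> z y \<and> z y < 2 * int m"
    then have y: "- 2 * int m \<le> y \<and> y < 2 * int m" using centredD(7,8)[OF zc, of y] by auto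
    define x where "x = skip ?h y"
    have wx: "w x = z y" using y by (simp add: z_def x_def)
    obtain x' where x': "x' = x + 1 \<or> x' = x - 1" "w x' = partner (w x)" "- 2 * int m \<le> w x' \<and> w x' < 2 * int m"
      using near[of x] zy[folded wx] by blast
    have r: "- 1 - 2 * int m \<le> x' \<and> x' \<le> 2 * int m" "x' \<noteq> ?h" "x' \<noteq> - 1 - ?h" using wr[of x'] x'(3) by auto
    have "z (unskip ?h x') = w x'"
      using unskip_range[OF h r] skip_unskip[OF h(1) r(2,3)] by (simp add: z_def)
    moreover have "unskip ?h x' = y + 1 \<or> unskip ?h x' = y - 1"
      using adj[OF _ _ r(2,3), of x] x'(1) skip_neq[OF h(1), of y] unskip_skip[OF h(1), of y] by (auto simp: x_def)
    ultimately show "z (y - 1) = partner (z y) \<or> z (y + 1) = partner (z y)" using x'(2) wx by auto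
  qed
  then obtain s S where d: "dbl_data m s S" and zd: "z = dbl s S" using dbl_of_paired[OF zc] by blast
  \<comment> \<open>An odd height would split a block of \<open>z\<close>: its two partners would
    sit at \<open>?h - 1\<close> and \<open>?h + 1\<close>, which are not adjacent.\<close>
  have "even ?h"
  proof (rule ccontr)
    assume "odd ?h"
    then obtain k where k: "?h = 2 * k + 1" by (elim oddE)
    then have kr: "0 \<le> k" "k < int m" using h by auto
    have "z (2 * k + 1) = partner (z (2 * k))" unfolding zd by (auto simp: dbl_even_odd partner_def)
    moreover have "z (2 * k) = w (?h - 1)" "z (2 * k + 1) = w (?h + 1)"
      using kr k by (auto simp: z_def skip_def)
    ultimately have e: "w (?h + 1) = partner (w (?h - 1))" by simp
    have "- 2 * int m \<le> w (?h - 1) \<and> w (?h - 1) < 2 * int m" unfolding wr using kr k by auto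
    then obtain x' where x': "x' = ?h - 1 + 1 \<or> x' = ?h - 1 - 1" "w x' = partner (w (?h - 1))"
      using near by blast
    then have "x' = ?h + 1" using e centredD(6)[OF w, of x' "?h + 1"] by simp
    then show False using x'(1) by auto
  qed
  then have "slot m P" using h by (simp add: slot_height)
  moreover have "w = ins m P z"
  proof
    fix x
    show "w x = ins m P z x"
    proof (cases "- 1 - 2 * int m \<le> x \<and> x \<le> 2 * int m \<and> x \<noteq> P \<and> x \<noteq> - 1 - P")
      case True
      then have "x \<noteq> ?h" "x \<noteq> - 1 - ?h" using eq_height_iff[of x P] by auto
      then show ?thesis using True unskip_range[OF h, of x] skip_unskip[OF h(1), of x] by (simp add: ins_def z_def)
    next
      case False
      then show ?thesis using wP wN PI centredD(5)[OF w, of x] by (auto simp: ins_def)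
    qed
  qed
  ultimately show thesis using that d zd by blast
qed

lemma delete_max_ins:
  assumes z: "z \<in> centred (2 * m)" and P: "height P \<le> 2 * int m"
  shows "delete_max (2 * m + 1) (uncentre (ins m P z)) = uncentre z"
proof -
  let ?w = "ins m P z" and ?h = "height P"
  let ?v = "uncentre ?w"
  note w = ins_centred[OF z P]
  note v = uncentre_signed[OF w] and u = uncentre_signed[OF z]
  have "?v (add0 P) = int (2 * m + 1)" by (simp add: uncentre_def) (simp add: add0_def)
  then have "inv ?v (int (2 * m + 1)) = add0 P" using signed_permsD(6)[OF v] by (metis inv_f_eq)
  \<comment> \<open>Whatever its sign, the entry of largest absolute value occupies window position
    \<open>?h + 1\<close>.\<close>
  moreover have "\<bar>add0 P\<bar> = ?h + 1" by (auto simp: add0_def height_def)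
  ultimately have D: "delete_max (2 * m + 1) ?v = of_window (2 * m) (\<lambda>x. if x < ?h + 1 then ?v x else ?v (x + 1))"
    unfolding delete_max_def Let_def by simp
  let ?d = "delete_max (2 * m + 1) ?v"
  have pos: "?d x = uncentre z x" if "0 < x" for x
  proof (cases "x \<le> int (2 * m)")
    case True
    have "?d x = (if x < ?h + 1 then ?v x else ?v (x + 1))" unfolding D of_window_def using True that by simp
    also have "\<dots> = add0 (?w (skip ?h (x - 1)))"
      using that height_nonneg[of P] by (simp add: uncentre_def drop0_def skip_def)
    also have "\<dots> = uncentre z x" using ins_skip[OF P, of "x - 1" z] that True by (simp add: uncentre_def drop0_def)
    finally show ?thesis .
  next
    case False
    then have "x \<notin> signed_range (2 * m)" by (simp add: signed_range_def)
    then have "uncentre z x = x" by (rule signed_permsD(7)[OF u])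
    then show ?thesis using False that unfolding D of_window_def by simp
  qed
  show ?thesis
  proof
    fix x :: int
    have o: "?d (- x) = - ?d x" unfolding D of_window_def by simp
    consider "0 < x" | "x = 0" | "x < 0" by linarith
    then show "?d x = uncentre z x"
    proof cases
      case 2
      then show ?thesis unfolding D of_window_def uncentre_def by simp
    next
      case 3
      then show ?thesis using pos[of "- x"] o signed_permsD(3)[OF u, of x] by simp
    qed (rule pos)
  qed
qed

section \<open>Climbing in the odd case\<close>

text \<open>On the mirrored rectangle the slack follows from \<open>less\<close> by
  \<open>rk_mirror\<close>, and \<open>disj\<close> ensures that no cut has to pay for both
  rectangles.\<close>

lemma rk_le_mreflI:
  assumes u: "u \<in> centred k" and v: "v \<in> centred k" and le: "rk_le u v"
    and ab: "a < b" "u a < u b" "b \<noteq> - 1 - a"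
    and less: "\<And>c y. a < c \<Longrightarrow> c \<le> b \<Longrightarrow> u a < y \<Longrightarrow> y \<le> u b \<Longrightarrow> rk u c y < rk v c y"
    and disj: "\<And>c. a < c \<Longrightarrow> c \<le> b \<Longrightarrow> \<not> (a < - c \<and> - c \<le> b)"
  shows "rk_le (u \<circ> mrefl a b) v"
  unfolding rk_le_def rk_mrefl[OF u ab]
proof (intro allI)
  fix c y
  have "rk u c y < rk v c y" if "a < - c" "- c \<le> b" "u a < - y" "- y \<le> u b"
    using less[OF that] rk_mirror[OF u, of c y] rk_mirror[OF v, of c y] by simp
  then show "rk u c y + of_bool (a < c \<and> c \<le> b \<and> u a < y \<and> y \<le> u b) +
      of_bool (a < - c \<and> - c \<le> b \<and> u a < - y \<and> - y \<le> u b) \<le> rk v c y"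
    using less[of c y] disj[of c] le[unfolded rk_le_def, rule_format, of c y] by auto
qed

lemma dbl_toggle:
  assumes S: "\<And>x. - 1 - x \<in> S \<longleftrightarrow> x \<in> S"
    and S': "S' = (if k \<in> S then S - {k, - 1 - k} else insert k (insert (- 1 - k) S))"
  shows "dbl s S' = dbl s S \<circ> mrefl (2 * k) (2 * k + 1)"
proof
  fix x :: int
  define j where "j = x div 2"
  have mem: "j \<in> S' \<longleftrightarrow> (if j = k \<or> j = - 1 - k then j \<notin> S else j \<in> S)"
    using S[of k] by (auto simp: S')
  have "x = 2 * j \<or> x = 2 * j + 1" unfolding j_def by presburger
  then show "dbl s S' x = (dbl s S \<circ> mrefl (2 * k) (2 * k + 1)) x"
  proof
    assume x: "x = 2 * j"
    have "mrefl (2 * k) (2 * k + 1) (2 * j) = (if j = k \<or> j = - 1 - k then 2 * j + 1 else 2 * j)"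
      unfolding mrefl_apply by (auto; presburger)
    then show ?thesis unfolding x by (auto simp: dbl_even_odd mem)
  next
    assume x: "x = 2 * j + 1"
    have "mrefl (2 * k) (2 * k + 1) (2 * j + 1) = (if j = k \<or> j = - 1 - k then 2 * j else 2 * j + 1)"
      unfolding mrefl_apply by (auto; presburger)
    then show ?thesis unfolding x by (auto simp: dbl_even_odd mem)
  qed
qed

lemma ins_nonneg:
  "0 \<le> P \<Longrightarrow> 0 \<le> x \<Longrightarrow> ins m P z x =
    (if x = P then 2 * int m else if x \<le> 2 * int m then z (if x < P then x else x - 1) else x)"
  by (auto simp: ins_def unskip_def height_def)

lemma ins_neg:
  "P < 0 \<Longrightarrow> x < 0 \<Longrightarrow> ins m P z x =
    (if x = P then 2 * int m else if - 1 - 2 * int m \<le> x then z (if x < P then x + 1 else x) else x)"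
  by (auto simp: ins_def unskip_def height_def)

text \<open>Block \<open>k\<close> is the one directly left of \<open>P\<close>. With entries x, y,
  max at \<open>P - 2\<close>, \<open>P - 1\<close>, \<open>P\<close>, the right-hand sides produce
  y, x, max and max, y, x. By mirror symmetry it suffices to compare on the side of 0 that contains
  \<open>P\<close>.\<close>

lemma ins_flip_move:
  assumes z: "z \<in> centred (2 * m)" and P: "0 < P \<and> P = 2 * k + 2 \<or> P < 0 \<and> P = 2 * k + 1"
    and k: "- int m \<le> k" "k < int m"
  shows "ins m P (z \<circ> mrefl (2 * k) (2 * k + 1)) = ins m P z \<circ> mrefl (P - 2) (P - 1)" (is "?F = ?G")
    and "ins m (P - 2) (z \<circ> mrefl (2 * k) (2 * k + 1)) = ins m P z \<circ> mrefl (P - 2) P" (is "?F' = ?G'")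
proof -
  let ?z = "z \<circ> mrefl (2 * k) (2 * k + 1)"
  have h: "height P \<le> 2 * int m" "height (P - 2) \<le> 2 * int m" using P k by (auto simp: height_def)
  have zc: "?z \<in> centred (2 * m)" using k by (intro comp_centred z mrefl_centred) auto
  have PI: "P - 2 \<in> {- int (2 * m + 1)..<int (2 * m + 1)}" "P - 1 \<in> {- int (2 * m + 1)..<int (2 * m + 1)}"
    "P \<in> {- int (2 * m + 1)..<int (2 * m + 1)}"
    using P k by auto
  have c: "?F \<in> centred (2 * m + 1)" "?G \<in> centred (2 * m + 1)" "?F' \<in> centred (2 * m + 1)" "?G' \<in> centred (2 * m + 1)"
    using PI by (intro comp_centred ins_centred zc z h mrefl_centred; simp)+
  have side: "?F x = ?G x \<and> ?F' x = ?G' x" if x: "0 \<le> x \<longleftrightarrow> 0 < P" for x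
    using P
  proof
    assume P: "0 < P \<and> P = 2 * k + 2"
    then have k0: "0 \<le> k" "0 \<le> x" using x by auto
    have e: "P - 2 = 2 * k" "P - 1 = 2 * k + 1" using P by auto
    have ne: "2 + 4 * k \<noteq> 0" using k0 by linarith
    consider "x = 2 * k" | "x = 2 * k + 1" | "x = 2 * k + 2" | "x < 2 * k" | "2 * k + 2 < x" by linarith
    then show ?thesis
      unfolding e by cases (use P k k0 in \<open>auto simp: ins_nonneg mrefl_apply ne\<close>)
  next
    assume P: "P < 0 \<and> P = 2 * k + 1"
    then have k0: "k < 0" "x < 0" using x by auto
    have e: "P - 2 = 2 * k - 1" "P - 1 = 2 * k" using P by auto
    consider "x = 2 * k - 1" | "x = 2 * k" | "x = 2 * k + 1" | "x < 2 * k - 1" | "2 * k + 1 < x" by linarith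
    then show ?thesis
      unfolding e by cases (use P k k0 in \<open>auto simp: ins_neg mrefl_apply\<close>)
  qed
  have all: "?F x = ?G x \<and> ?F' x = ?G' x" for x
  proof (cases "0 \<le> x \<longleftrightarrow> 0 < P")
    case True
    then show ?thesis by (rule side)
  next
    case False
    then have "0 \<le> - 1 - x \<longleftrightarrow> 0 < P" by auto
    from side[OF this] show ?thesis unfolding c[THEN centredD(2)] by simp
  qed
  show "?F = ?G" "?F' = ?G'" using all by blast+
qed

text \<open>\<open>2 * a \<le> 1 + 2 * b\<close> forces \<open>a \<le> b\<close>, so the 1 that the
  largest entry of the target may contribute is absorbed by parity.\<close>

lemma rk_dbl_le_of_even:
  assumes d: "dbl_data m s S" "dbl_data m t T"
    and le: "\<And>b. - int m \<le> b \<Longrightarrow> b \<le> int m \<Longrightarrow> 2 * rk s k b \<le> 1 + 2 * rk t k b"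
  shows "rk (dbl s S) (2 * k) y \<le> rk (dbl t T) (2 * k) y"
proof -
  have s: "s \<in> centred m" and t: "t \<in> centred m" using d by (auto simp: dbl_data_def)
  have st: "rk s k b \<le> rk t k b" for b
  proof (cases "- int m \<le> b \<and> b \<le> int m")
    case True
    then show ?thesis using le[of b] by linarith
  next
    case False
    then show ?thesis using rk_extreme[OF s, of b k] rk_extreme[OF t, of b k] by auto
  qed
  have "y = 2 * (y div 2) \<or> y = 2 * (y div 2) + 1" by presburger
  then show ?thesis
  proof
    assume y: "y = 2 * (y div 2)"
    show ?thesis by (subst (1 2) y) (simp only: rk_dbl(1)[OF d(1)] rk_dbl(1)[OF d(2)] mult_left_mono st)
  next
    assume y: "y = 2 * (y div 2) + 1"
    show ?thesis by (subst (1 2) y) (simp only: rk_dbl(3)[OF d(1)] rk_dbl(3)[OF d(2)] add_mono st)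
  qed
qed

text \<open>If the largest entry has to move left, the block it passes is first reversed and then swapped with
  it while being put back in increasing order. This stays below the target because the ranks of \<open>dbl\<close>
  at even cuts are even.\<close>

lemma odd_step:
  assumes d: "dbl_data m s S" "dbl_data m t T" and PQ: "slot m P" "slot m Q"
    and le: "rk_le (ins m P (dbl s S)) (ins m Q (dbl t T))" and ne: "\<not> (P = Q \<and> s = t \<and> S = T)"
  shows "\<exists>P' s' S'. slot m P' \<and> dbl_data m s' S' \<and>
    rk_le (ins m P (dbl s S)) (ins m P' (dbl s' S')) \<and> rk_le (ins m P' (dbl s' S')) (ins m Q (dbl t T)) \<and>
    wlen m s' S' - 2 * P' = wlen m s S - 2 * P + 2"
proof -
  let ?z = "dbl s S" and ?z' = "dbl t T"
  let ?u = "ins m P ?z" and ?v = "ins m Q ?z'"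
  note z = dbl_centred[OF d(1)] and z' = dbl_centred[OF d(2)]
  have hP: "height P \<le> 2 * int m" and hQ: "height Q \<le> 2 * int m" using PQ by (auto simp: slot_height)
  note u = ins_centred[OF z hP] and v = ins_centred[OF z' hQ]
  note rku = rk_ins[OF z hP] and rkv = rk_ins[OF z' hQ]
  have leD: "rk ?u c y \<le> rk ?v c y" for c y using le by (simp add: rk_le_def)
  have s: "s \<in> centred m" and S: "S \<subseteq> {- int m..<int m}" "\<And>x. - 1 - x \<in> S \<longleftrightarrow> x \<in> S"
    using d by (auto simp: dbl_data_def)
  have fS: "finite S" using S(1) by (rule finite_subset) simp
  have PI: "- 1 - 2 * int m \<le> P" "P \<le> 2 * int m" "- 1 - 2 * int m \<le> Q" "Q \<le> 2 * int m"
    using PQ by (auto simp: slot_def)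
  \<comment> \<open>At height \<open>2 * int m\<close> the rank only records whether the largest
    entry is left of the cut; the cut right after \<open>P\<close> decides.\<close>
  have "Q \<le> P"
  proof -
    have rk_max: "rk w (P + 1) (2 * int m) = of_bool (x \<le> P)" if "w \<in> centred (2 * m + 1)" "w x = 2 * int m" for w x
    proof -
      have "{y. y < P + 1 \<and> 2 * int m + 1 \<le> y} = {}" using PI by auto
      then have "rk id (P + 1) (2 * int m + 1) = 0" by (simp only: rk_def id_apply card.empty of_nat_0)
      then have "rk w (P + 1) (2 * int m + 1) = 0" using rk_extreme[OF that(1), of "2 * int m + 1"] by simp
      then show ?thesis using rk_val_neq[OF that, of "P + 1"] by simp
    qed
    show ?thesis using leD[of "P + 1" "2 * int m"] rk_max[OF u, of P] rk_max[OF v, of Q]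
      by (cases "Q \<le> P") auto
  qed
  show ?thesis
  proof (cases "P = Q")
    case True
    \<comment> \<open>Equal insertions contribute equally, and each cut of \<open>?z\<close> comes
      from a cut \<open>c'\<close> of \<open>?u\<close>, so the even case applies to the deleted
      permutations.\<close>
    have zz: "rk_le ?z ?z'"
    proof (rule rk_leI[OF z z'])
      fix c b assume b: "- int (2 * m) < b" "b < int (2 * m)"
      define c' where "c' = (if c < - height P then c - 1 else if c \<le> height P then c else c + 1)"
      have "unskip_cut (height P) c' = c" using height_nonneg[of P] by (auto simp: unskip_cut_def c'_def)
      then show "rk ?z c b \<le> rk ?z' c b"
        using leD[of c' b] rku[of b c'] rkv[of b c'] b True by simp
    qed
    have "\<not> (s = t \<and> S = T)" using ne True by simp
    from even_step[OF d zz this] obtain s' S' where st: "dbl_data m s' S'" "rk_le ?z (dbl s' S')"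
      "rk_le (dbl s' S') ?z'" "wlen m s' S' = wlen m s S + 2" by blast
    note z1 = dbl_centred[OF st(1)]
    have mono: "rk_le (ins m P x) (ins m P y)" if "rk_le x y" "x \<in> centred (2 * m)" "y \<in> centred (2 * m)" for x y
    proof (rule rk_leI[OF ins_centred[OF that(2) hP] ins_centred[OF that(3) hP]])
      fix c b assume b: "- int (2 * m + 1) < b" "b < int (2 * m + 1)"
      then show "rk (ins m P x) c b \<le> rk (ins m P y) c b"
        using rk_ins[OF that(2) hP, of b c] rk_ins[OF that(3) hP, of b c] that(1) by (simp add: rk_le_def)
    qed
    show ?thesis
      using mono[OF st(2) z z1] mono[OF st(3) z1 z'] st PQ True
      by (intro exI[of _ P] exI[of _ s'] exI[of _ S']) simp
  next
    case False
    then have QP: "Q < P" using \<open>Q \<le> P\<close> by simp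
    show ?thesis
    proof (cases "P = 0")
      case True
      have h0: "height P = 0" "height (- 1) = 0" by (auto simp: height_def True)
      \<comment> \<open>Passing from slot 0 to the next slot \<open>- 1\<close> exchanges the
        largest and the smallest entry and moves no block; only ranks at the cut 0 change.\<close>
      have w: "ins m (- 1) ?z = ?u \<circ> mrefl (- 1) (- 1 - (- 1))"
      proof
        fix x
        show "ins m (- 1) ?z x = (?u \<circ> mrefl (- 1) (- 1 - (- 1))) x"
          by (auto simp: ins_def True mrefl_apply height_def)
      qed
      have a: "?u (- 1) < - 1 - ?u (- 1)" "?u (- 1) = - 1 - 2 * int m" by (auto simp: ins_def True)
      have g: "unskip_cut (height P) 0 = 0" "unskip_cut (height Q) 0 = 0" using height_nonneg[of Q] by (auto simp: unskip_cut_def h0)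
      have K: "2 * rk s 0 b \<le> 1 + 2 * rk t 0 b" if "- int m \<le> b" "b \<le> int m" for b
        using leD[of 0 "2 * b"] rku[of "2 * b" 0] rkv[of "2 * b" 0] that g QP True
          rk_dbl(1)[OF d(1), of 0 b] rk_dbl(1)[OF d(2), of 0 b] by simp
      have less: "rk ?u 0 y < rk ?v 0 y" if "- 1 - 2 * int m < y" "y \<le> 2 * int m" for y
        using rku[of y 0] rkv[of y 0] that g QP True rk_dbl_le_of_even[OF d K, of y] by simp
      have rkw: "rk (ins m (- 1) ?z) c y = rk ?u c y + of_bool (- 1 < c \<and> c \<le> 0 \<and> - 1 - 2 * int m < y \<and> y \<le> 2 * int m)" for c y
        unfolding w using rk_mrefl_self[OF u _ a(1), of c y] a(2) by simp
      have "rk_le ?u (ins m (- 1) ?z)" unfolding rk_le_def rkw by simp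
      moreover have "rk_le (ins m (- 1) ?z) ?v"
        unfolding rk_le_def rkw
      proof (intro allI)
        fix c y
        show "rk ?u c y + of_bool (- 1 < c \<and> c \<le> 0 \<and> - 1 - 2 * int m < y \<and> y \<le> 2 * int m) \<le> rk ?v c y"
          using leD[of c y] less[of y] by (cases "c = 0") auto
      qed
      moreover have "slot m (- 1)" by (simp add: slot_def)
      ultimately show ?thesis using d(1) True by (intro exI[of _ "- 1"] exI[of _ s] exI[of _ S]) simp
    next
      case False
      define k where "k = (if 0 \<le> P then (P - 2) div 2 else (P - 1) div 2)"
      have Pk: "0 < P \<and> P = 2 * k + 2 \<or> P < 0 \<and> P = 2 * k + 1"
        using PQ(1) False by (auto simp: k_def slot_def elim!: evenE oddE split: if_splits)
      \<comment> \<open>Slots on one side of 0 have equal parity, so 0 and \<open>- 1\<close> are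
        the only adjacent slots.\<close>
      have "Q \<noteq> P - 1"
        using PQ False by (auto simp: slot_def split: if_splits)
      then have Q2: "Q \<le> P - 2" using QP by simp
      have kr: "- int m \<le> k" "k < int m" using Pk PI Q2 by auto
      have gP: "unskip_cut (height P) (P - 2) = 2 * k" "unskip_cut (height P) (P - 1) = 2 * k + 1" "unskip_cut (height P) P = 2 * k + 2"
        using Pk False by (auto simp: unskip_cut_def height_def)
      have gQ: "unskip_cut (height Q) (P - 2) \<le> 2 * k" "2 * k \<le> unskip_cut (height Q) (P - 1)" "2 * k \<le> unskip_cut (height Q) P"
      proof -
        have "2 * k \<le> Q \<Longrightarrow> 0 \<le> Q" using Pk Q2 by auto
        then show "unskip_cut (height Q) (P - 2) \<le> 2 * k" "2 * k \<le> unskip_cut (height Q) (P - 1)" "2 * k \<le> unskip_cut (height Q) P"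
          using Pk False Q2 by (auto simp: unskip_cut_def height_def)
      qed
      have skip: "skip (height P) (2 * k) = P - 2" "skip (height P) (2 * k + 1) = P - 1"
        using Pk False by (auto simp: skip_def height_def)
      \<comment> \<open>Compare at \<open>P - 2\<close>, the cut just before block \<open>k\<close>:
        there \<open>?u\<close> has not met its largest entry, and that of \<open>?v\<close> adds at
        most 1.\<close>
      have K: "2 * rk s k b \<le> 1 + 2 * rk t k b" if "- int m \<le> b" "b \<le> int m" for b
      proof -
        have "2 * rk s k b = rk ?u (P - 2) (2 * b)"
          using rku[of "2 * b" "P - 2"] that gP rk_dbl(1)[OF d(1), of k b] by simp
        also have "\<dots> \<le> rk ?v (P - 2) (2 * b)" by (rule leD)
        also have "\<dots> \<le> 1 + rk ?z' (unskip_cut (height Q) (P - 2)) (2 * b)" using rkv[of "2 * b" "P - 2"] that by simp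
        also have "\<dots> \<le> 1 + rk ?z' (2 * k) (2 * b)" using rk_mono[OF z' gQ(1)] by simp
        finally show ?thesis using rk_dbl(1)[OF d(2), of k b] by simp
      qed
      \<comment> \<open>By \<open>Q \<le> P - 2\<close> the largest entry of \<open>?v\<close> lies
        left of both cuts, which makes the inequality strict.\<close>
      have less: "rk ?z (2 * k) y < rk ?v c y" if "- 2 * int m \<le> y" "y \<le> 2 * int m" "c = P - 1 \<or> c = P" for c y
      proof -
        have "rk ?z (2 * k) y \<le> rk ?z' (2 * k) y" by (rule rk_dbl_le_of_even[OF d K])
        also have "\<dots> \<le> rk ?z' (unskip_cut (height Q) c) y" using rk_mono[OF z', of "2 * k" _ y y] gQ that(3) by auto
        also have "\<dots> < rk ?v c y" using rkv[of y c] that Q2 by auto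
        finally show ?thesis .
      qed
      have sr: "- int m \<le> s k" "s k < int m" using centredD(7,8)[OF s, of k] kr by auto
      have uv: "?u (P - 2) = ?z (2 * k)" "?u (P - 1) = ?z (2 * k + 1)"
        using ins_skip[OF hP, of "2 * k" ?z] ins_skip[OF hP, of "2 * k + 1" ?z] skip kr by auto
      define S' where "S' = (if k \<in> S then S - {k, - 1 - k} else insert k (insert (- 1 - k) S))"
      have d': "dbl_data m s S'" using s S kr by (auto simp: dbl_data_def S'_def)
      have tog: "dbl s S' = ?z \<circ> mrefl (2 * k) (2 * k + 1)" by (rule dbl_toggle[OF S(2) S'_def])
      have kne: "k \<noteq> - 1 - k" by presburger
      show ?thesis
      proof (cases "k \<in> S")
        case True
        have zk: "?z (2 * k) = 2 * s k + 1" "?z (2 * k + 1) = 2 * s k" using True by (simp_all add: dbl_even_odd)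
        have w: "ins m (P - 2) (dbl s S') = ?u \<circ> mrefl (P - 2) P"
          unfolding tog by (rule ins_flip_move(2)[OF z Pk kr])
        have up: "?u (P - 2) < ?u P" using uv(1) zk sr by simp
        have "rk_le ?u (ins m (P - 2) (dbl s S'))" unfolding w by (rule rk_mrefl_ge[OF u _ up]) simp
        moreover have "rk_le (ins m (P - 2) (dbl s S')) ?v"
          unfolding w
        proof (rule rk_le_mreflI[OF u v le _ up])
          show "P \<noteq> - 1 - (P - 2)" by presburger
          fix c assume c: "P - 2 < c" "c \<le> P"
          then have c': "c = P - 1 \<or> c = P" by auto
          show "\<not> (P - 2 < - c \<and> - c \<le> P)" using c Pk by presburger
          fix y assume y: "?u (P - 2) < y" "y \<le> ?u P"
          then have yr: "2 * s k + 1 < y" "y \<le> 2 * int m" using uv zk by auto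
          \<comment> \<open>The height \<open>y\<close> exceeds both entries of the block, so
            neither of them counts even if it is left of the cut.\<close>
          have "rk ?u c y = rk ?z (2 * k) y"
            using c' rku[of y c] yr sr gP rk_Suc_pos[OF z, of "2 * k" y] rk_Suc_pos[OF z, of "2 * k + 1" y] zk
            by (auto simp: add.commute)
          then show "rk ?u c y < rk ?v c y" using less[OF _ yr(2) c'] yr sr by simp
        qed simp
        moreover have "slot m (P - 2)" using PQ(1) Pk False kr by (auto simp: slot_def)
        \<comment> \<open>While \<open>card S\<close> drops by 2, moving from \<open>P\<close> to
          \<open>P - 2\<close> gains 4.\<close>
        moreover have "int (card S') = int (card S) - 2"
        proof -
          have "{k, - 1 - k} \<subseteq> S" using True S(2) by simp
          then have "card S' = card S - card {k, - 1 - k}" "card {k, - 1 - k} \<le> card S"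
            using True card_Diff_subset[of "{k, - 1 - k}" S] card_mono[OF fS, of "{k, - 1 - k}"]
            by (simp_all only: S'_def if_True finite.emptyI finite.insertI)
          then show ?thesis using kne by simp
        qed
        ultimately show ?thesis using d'
          by (intro exI[of _ "P - 2"] exI[of _ s] exI[of _ S']) (simp add: wlen_def)
      next
        case nin: False
        have zk: "?z (2 * k) = 2 * s k" "?z (2 * k + 1) = 2 * s k + 1" using nin by (simp_all add: dbl_even_odd)
        have w: "ins m P (dbl s S') = ?u \<circ> mrefl (P - 2) (P - 1)"
          unfolding tog by (rule ins_flip_move(1)[OF z Pk kr])
        have up: "?u (P - 2) < ?u (P - 1)" using uv zk by simp
        have "rk_le ?u (ins m P (dbl s S'))" unfolding w by (rule rk_mrefl_ge[OF u _ up]) simp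
        moreover have "rk_le (ins m P (dbl s S')) ?v"
          unfolding w
        proof (rule rk_le_mreflI[OF u v le _ up])
          show "P - 1 \<noteq> - 1 - (P - 2)" using Pk by presburger
          fix c assume c: "P - 2 < c" "c \<le> P - 1"
          then have c': "c = P - 1" by auto
          show "\<not> (P - 2 < - c \<and> - c \<le> P - 1)" using c Pk by presburger
          fix y assume y: "?u (P - 2) < y" "y \<le> ?u (P - 1)"
          \<comment> \<open>Only this height occurs, and the first entry of the block is still below
            it.\<close>
          then have yr: "y = 2 * s k + 1" using uv zk by auto
          have "rk ?u c y = rk ?z (2 * k) y"
            using c' rku[of y c] yr sr gP rk_Suc_pos[OF z, of "2 * k" y] zk by auto
          then show "rk ?u c y < rk ?v c y" using less[of y c] c' yr sr by simp
        qed simp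
        moreover have "card S' = card S + 2"
          using nin fS S(2)[of k] kne by (simp add: S'_def)
        ultimately show ?thesis using d' PQ(1)
          by (intro exI[of _ P] exI[of _ s] exI[of _ S']) (simp add: wlen_def)
      qed
    qed
  qed
qed

section \<open>Gradedness\<close>

text \<open>The step property makes \<open>\<rho>\<close> strictly monotone, hence injective on
  chains. A maximal chain contains \<open>bt\<close> and \<open>tp\<close>, and it cannot miss a
  value in between, as a step would provide an element to be added. So \<open>\<rho>\<close> maps it
  bijectively onto \<open>{0..int N}\<close>.\<close>

lemma graded_by_rank_steps:
  fixes \<rho> :: "'a \<Rightarrow> int"
  assumes fin: "finite A" and po: "partial_order_on A r"
    and step: "\<And>x y. x \<in> A \<Longrightarrow> y \<in> A \<Longrightarrow> (x, y) \<in> r \<Longrightarrow> x \<noteq> y \<Longrightarrow>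
      \<exists>z\<in>A. (x, z) \<in> r \<and> (z, y) \<in> r \<and> \<rho> z = \<rho> x + 1"
    and bot: "bt \<in> A" "\<And>x. x \<in> A \<Longrightarrow> (bt, x) \<in> r" "\<rho> bt = 0"
    and top: "tp \<in> A" "\<And>x. x \<in> A \<Longrightarrow> (x, tp) \<in> r" "\<rho> tp = int N"
  shows "graded_poset A r N \<and> rank_function A r \<rho>"
proof -
  have refl: "\<And>x. x \<in> A \<Longrightarrow> (x, x) \<in> r" and tr: "\<And>x y z. (x, y) \<in> r \<Longrightarrow> (y, z) \<in> r \<Longrightarrow> (x, z) \<in> r"
    and anti: "\<And>x y. (x, y) \<in> r \<Longrightarrow> (y, x) \<in> r \<Longrightarrow> x = y"
    using po unfolding partial_order_on_def preorder_on_def refl_on_def trans_def antisym_def by blast+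
  have mono: "\<rho> x < \<rho> y" if "x \<in> A" "y \<in> A" "(x, y) \<in> r" "x \<noteq> y" for x y
    using that
  \<comment> \<open>Passing from \<open>x\<close> to \<open>z\<close> removes at least
    \<open>x\<close> from the set of elements above.\<close>
  proof (induction "card {z \<in> A. (x, z) \<in> r}" arbitrary: x rule: less_induct)
    case less
    obtain z where z: "z \<in> A" "(x, z) \<in> r" "(z, y) \<in> r" "\<rho> z = \<rho> x + 1"
      using step[OF less.prems] by blast
    show ?case
    proof (cases "z = y")
      case False
      have "z \<noteq> x" using z(4) by auto
      then have "x \<notin> {w \<in> A. (z, w) \<in> r}" using anti z(2) by blast
      moreover have "{w \<in> A. (z, w) \<in> r} \<subseteq> {w \<in> A. (x, w) \<in> r}" using tr z(2) by blast
      ultimately have "{w \<in> A. (z, w) \<in> r} \<subset> {w \<in> A. (x, w) \<in> r}" using refl less.prems(1) by blast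
      then have "card {w \<in> A. (z, w) \<in> r} < card {w \<in> A. (x, w) \<in> r}"
        by (intro psubset_card_mono) (use fin in auto)
      then have "\<rho> z < \<rho> y" using less.hyps z less.prems(2) False by blast
      then show ?thesis using z(4) by simp
    qed (use z in simp)
  qed
  have mono': "\<rho> x \<le> \<rho> y" if "x \<in> A" "y \<in> A" "(x, y) \<in> r" for x y
    using mono[OF that] by (cases "x = y") auto
  have "finite C \<and> card C = N + 1" if C: "pred_on.maxchain A (\<lambda>x y. (x, y) \<in> r) C" for C
  proof -
    have CA: "C \<subseteq> A" and comp: "\<And>x y. x \<in> C \<Longrightarrow> y \<in> C \<Longrightarrow> (x, y) \<in> r \<or> (y, x) \<in> r"
      using C refl unfolding pred_on.maxchain_def pred_on.chain_def by blast+
    have max: "z \<in> C" if "z \<in> A" "\<And>x. x \<in> C \<Longrightarrow> (x, z) \<in> r \<or> (z, x) \<in> r" for z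
    proof (rule ccontr)
      assume "z \<notin> C"
      moreover have "pred_on.chain A (\<lambda>x y. (x, y) \<in> r) (insert z C)"
        unfolding pred_on.chain_def using that CA comp by blast
      ultimately show False using C unfolding pred_on.maxchain_def by blast
    qed
    have fC: "finite C" using CA fin finite_subset by blast
    have bC: "bt \<in> C" and tC: "tp \<in> C" using max bot top CA by blast+
    have inj: "inj_on \<rho> C"
    proof (rule inj_onI)
      fix x y assume "x \<in> C" "y \<in> C" "\<rho> x = \<rho> y"
      then show "x = y" using comp[of x y] mono[of x y] mono[of y x] CA by force
    qed
    have "\<rho> ` C = {0..int N}"
    proof (intro subset_antisym subsetI)
      fix j assume "j \<in> \<rho> ` C"
      then obtain x where "x \<in> C" "j = \<rho> x" by blast
      then show "j \<in> {0..int N}" using mono'[of bt x] mono'[of x tp] bot top CA by auto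
    next
      fix j assume j: "j \<in> {0..int N}"
      define L where "L = {x \<in> C. \<rho> x \<le> j}"
      have L: "finite L" "L \<noteq> {}" using fC bC bot j by (auto simp: L_def)
      define i where "i = Max (\<rho> ` L)"
      have "i \<in> \<rho> ` L" unfolding i_def using L by (intro Max_in) auto
      then obtain x where x: "x \<in> L" "\<rho> x = i" by blast
      have imax: "\<rho> y \<le> i" if "y \<in> L" for y unfolding i_def using L that by simp
      show "j \<in> \<rho> ` C"
      proof (cases "i = j")
        case True
        then show ?thesis using x by (auto simp: L_def)
      next
        case False
        then have ij: "i < j" using x by (auto simp: L_def)
        define U where "U = {y \<in> C. j < \<rho> y}"
        show ?thesis
        proof (cases "U = {}")
          case True
          then have "tp \<in> L" using tC top by (force simp: U_def L_def)
          then show ?thesis using imax[of tp] ij top j by auto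
        next
          case False
          have fU: "finite U" using fC by (simp add: U_def)
          define l where "l = Min (\<rho> ` U)"
          have "l \<in> \<rho> ` U" unfolding l_def using fU False by (intro Min_in) auto
          then obtain y where y: "y \<in> U" "\<rho> y = l" by blast
          have lmin: "l \<le> \<rho> w" if "w \<in> U" for w unfolding l_def using fU that by simp
          have xy: "x \<in> C" "y \<in> C" "\<rho> x < \<rho> y" using x y ij by (auto simp: L_def U_def)
          then have "(x, y) \<in> r" using comp[of x y] mono'[of y x] CA by auto
          \<comment> \<open>\<open>x\<close> and \<open>y\<close> are the neighbours in the chain
            around the missing value \<open>j\<close>. Every chain element is below \<open>x\<close>
            or above \<open>y\<close>, so \<open>z\<close> is comparable to all of them and lies in
            \<open>C\<close>; its rank \<open>\<rho> x + 1\<close> then contradicts the choice of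
            \<open>x\<close>.\<close>
          then obtain z where z: "z \<in> A" "(x, z) \<in> r" "(z, y) \<in> r" "\<rho> z = \<rho> x + 1"
            using step[of x y] xy CA by auto
          have "z \<in> C"
          proof (rule max[OF z(1)])
            fix w assume w: "w \<in> C"
            show "(w, z) \<in> r \<or> (z, w) \<in> r"
            proof (cases "\<rho> w \<le> j")
              case True
              then have "\<rho> w \<le> \<rho> x" using imax[of w] w x by (simp add: L_def)
              then have "(w, x) \<in> r" using comp[of w x] mono[of x w] w xy CA by force
              then show ?thesis using tr z(2) by blast
            next
              case False
              then have "\<rho> y \<le> \<rho> w" using lmin[of w] w y by (simp add: U_def)
              then have "(y, w) \<in> r" using comp[of w y] mono[of w y] w xy CA by force
              then show ?thesis using tr z(3) by blast
            qed
          qed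
          then have "z \<in> L" using z(4) x ij by (simp add: L_def)
          then show ?thesis using imax[of z] z(4) x by simp
        qed
      qed
    qed
    then have "card C = N + 1" using card_image[OF inj] by simp
    then show ?thesis using fC by simp
  qed
  then have "graded_poset A r N" using po by (simp add: graded_poset_def)
  moreover have "rank_function A r \<rho>"
    unfolding rank_function_def
  proof (intro conjI allI impI)
    fix x assume "minimal_in A r x"
    then have "x = bt" using bot by (auto simp: minimal_in_def)
    then show "\<rho> x = 0" using bot by simp
  next
    fix x y assume c: "covered_by A r x y"
    then obtain z where "z \<in> A" "(x, z) \<in> r" "(z, y) \<in> r" "\<rho> z = \<rho> x + 1"
      using step[of x y] by (auto simp: covered_by_def)
    then show "\<rho> y = \<rho> x + 1" using c by (auto simp: covered_by_def)
  qed
  ultimately show ?thesis by blast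
qed

section \<open>Identity and longest element as bottom and top\<close>

definition longest :: "nat \<Rightarrow> int \<Rightarrow> int" where
  "longest k x = (if - int k \<le> x \<and> x < int k then - 1 - x else x)"

lemma longest_centred: "longest k \<in> centred k"
proof -
  have "bij_betw (longest k) {- int k..<int k} {- int k..<int k}"
    by (rule bij_betw_byWitness[where f' = "longest k"]) (auto simp: longest_def)
  then have "longest k permutes {- int k..<int k}" by (rule bij_imp_permutes) (auto simp: longest_def)
  then show ?thesis by (auto simp: centred_def longest_def)
qed

text \<open>\<open>rk id c b\<close> is the maximum of 0 and \<open>c - b\<close>, and
  \<open>rk_mirror\<close> bounds \<open>rk w c b\<close> from below by
  \<open>c - b\<close>.\<close>

lemma rk_le_id:
  assumes w: "w \<in> centred k"
  shows "rk_le id w"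
  unfolding rk_le_def
proof (intro allI)
  fix c b :: int
  have "{x. x < c \<and> b \<le> id x} = {b..<c}" by auto
  then have "rk id c b = int (nat (c - b))" by (simp only: rk_def card_atLeastLessThan_int)
  then show "rk id c b \<le> rk w c b"
    using rk_mirror[OF w, of c b] rk_nonneg[of w c b] rk_nonneg[of w "- c" "- b"] by simp
qed

lemma rk_left:
  assumes w: "w \<in> centred k" and "c \<le> - int k" "- int k \<le> b"
  shows "rk w c b = 0"
proof -
  have "\<not> (x < c \<and> b \<le> w x)" for x using centredD(5)[OF w, of x] assms by auto
  then have "{x. x < c \<and> b \<le> w x} = {}" by blast
  then show ?thesis by (simp only: rk_def card.empty of_nat_0)
qed

text \<open>A rank exceeds neither the number of available positions, \<open>c + int k\<close>, nor
  the number of available values, \<open>int k - b\<close>, and the longest element attains the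
  smaller of the two. Cuts outside the range are trivial on the left and follow by the mirror on the
  right.\<close>

lemma rk_le_longest:
  assumes w: "w \<in> centred k"
  shows "rk_le w (longest k)"
proof (rule rk_leI[OF w longest_centred])
  fix c b assume b: "- int k < b" "b < int k"
  consider "c \<le> - int k" | "int k \<le> c" | "- int k < c" "c < int k" by linarith
  then show "rk w c b \<le> rk (longest k) c b"
  proof cases
    case 1
    then show ?thesis using rk_left[OF w, of c b] rk_nonneg b by simp
  next
    case 2
    then show ?thesis
      using rk_left[OF w, of "- c" "- b"] rk_left[OF longest_centred, of "- c" k "- b"] b
        rk_mirror[OF w, of c b] rk_mirror[OF longest_centred, of k c b] by simp
  next
    case 3
    have "{x. x < c \<and> b \<le> longest k x} = {- int k..<min c (- b)}"
      using 3 b by (auto simp: longest_def)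
    then have longest: "rk (longest k) c b = min (c + int k) (int k - b)"
      using 3 b by (auto simp: rk_def min_def)
    have "{x. x < c \<and> b \<le> w x} \<subseteq> {- int k..<c}"
    proof
      fix x assume "x \<in> {x. x < c \<and> b \<le> w x}"
      then show "x \<in> {- int k..<c}" using centredD(7)[OF w, of x] b by auto
    qed
    then have "card {x. x < c \<and> b \<le> w x} \<le> card {- int k..<c}" by (intro card_mono) auto
    then have 1: "rk w c b \<le> c + int k" using 3 by (simp add: rk_def)
    have "w ` {x. x < c \<and> b \<le> w x} \<subseteq> {b..<int k}"
    proof
      fix y assume "y \<in> w ` {x. x < c \<and> b \<le> w x}"
      then obtain x where "y = w x" "x < c" "b \<le> w x" by blast
      then show "y \<in> {b..<int k}" using centredD(8)[OF w, of x] 3 by auto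
    qed
    then have "card (w ` {x. x < c \<and> b \<le> w x}) \<le> card {b..<int k}" by (intro card_mono) auto
    moreover have "card (w ` {x. x < c \<and> b \<le> w x}) = card {x. x < c \<and> b \<le> w x}"
      by (intro card_image inj_on_subset[OF centredD(3)[OF w]]) simp
    ultimately have "rk w c b \<le> int k - b" using b by (simp add: rk_def)
    with 1 show ?thesis using longest by simp
  qed
qed

lemma invs_longest: "invs k (longest k) = int k * (2 * int k - 1)"
proof -
  let ?I = "{- int k..<int k}"
  have "invs k (longest k) = (\<Sum>x\<in>?I. \<Sum>y\<in>?I. of_bool (x < y \<and> True))"
    unfolding invs_def by (intro sum.cong refl) (auto simp: longest_def)
  moreover have "(\<Sum>x\<in>?I. \<Sum>y\<in>?I. of_bool True) = (\<Sum>x\<in>?I. of_bool True) + 2 * (\<Sum>x\<in>?I. \<Sum>y\<in>?I. of_bool (x < y \<and> True) :: int)"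
    by (rule sum_symmetric) auto
  ultimately have "2 * int k * (2 * int k) = 2 * int k + 2 * invs k (longest k)" by simp
  then show ?thesis by (simp add: algebra_simps)
qed

lemma rk_longest: "rk (longest k) 0 0 = int k"
proof -
  have "{x. x < 0 \<and> 0 \<le> longest k x} = {- int k..<0}" by (auto simp: longest_def)
  then show ?thesis by (simp add: rk_def)
qed

lemma invs_id: "invs k id = 0"
proof -
  have "invs k id = (\<Sum>x\<in>{- int k..<int k}. \<Sum>y\<in>{- int k..<int k}. 0)"
    unfolding invs_def by (intro sum.cong refl) auto
  then show ?thesis by simp
qed

lemma rk_id: "rk id 0 0 = 0"
proof -
  have "{x :: int. x < 0 \<and> 0 \<le> id x} = {}" by auto
  then show ?thesis by (simp only: rk_def card.empty of_nat_0)
qed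

lemma wlen_id: "wlen m id {} = 0"
  by (simp add: wlen_def invs_id rk_id)

text \<open>Half of this is \<open>3 m^2\<close>, the claimed rank for \<open>n = 2 * m\<close>; for
  \<open>n = 2 * m + 1\<close>, the largest entry at \<open>P = - 1 - 2 * int m\<close> adds
  \<open>4 m + 1\<close>.\<close>

lemma wlen_longest: "wlen m (longest m) {- int m..<int m} = 6 * (int m)\<^sup>2"
  by (simp add: wlen_def invs_longest rk_longest power2_eq_square algebra_simps)

lemma data_id: "dbl_data m id {}"
  by (simp add: dbl_data_def)

lemma data_longest: "dbl_data m (longest m) {- int m..<int m}"
  by (auto simp: dbl_data_def longest_centred)

lemma dbl_id: "dbl id {} = id"
  by (rule ext) (simp add: dbl_def)

lemma dbl_longest: "dbl (longest m) {- int m..<int m} = longest (2 * m)"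
proof
  fix x :: int
  have "x div 2 \<in> {- int m..<int m} \<longleftrightarrow> - int (2 * m) \<le> x \<and> x < int (2 * m)" by auto
  then show "dbl (longest m) {- int m..<int m} x = longest (2 * m) x"
    using minus_mult_div_eq_mod[of x 2] by (auto simp: dbl_def longest_def)
qed

lemma ins_id: "ins m (2 * int m) id = id"
  by (rule ext) (auto simp: ins_def unskip_def height_def)

lemma ins_longest: "ins m (- 1 - 2 * int m) (longest (2 * m)) = longest (2 * m + 1)"
  by (rule ext) (auto simp: ins_def unskip_def height_def longest_def)

section \<open>Transfer to the poset of signed Wachs permutations\<close>

lemma wachs_even_iff:
  "v \<in> wachs (2 * m) \<longleftrightarrow> (\<exists>s S. dbl_data m s S \<and> v = uncentre (dbl s S))"
proof
  assume v: "v \<in> wachs (2 * m)"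
  then have s: "v \<in> signed_perms (2 * m)" by (simp add: wachs_def)
  have "paired m (centre v)" using paired_of_wachs[OF v] by simp
  then obtain s S where "dbl_data m s S" "centre v = dbl s S"
    using dbl_of_paired[OF centre_centred[OF s]] by blast
  then show "\<exists>s S. dbl_data m s S \<and> v = uncentre (dbl s S)" using uncentre_centre[OF s] by metis
next
  assume "\<exists>s S. dbl_data m s S \<and> v = uncentre (dbl s S)"
  then obtain s S where d: "dbl_data m s S" "v = uncentre (dbl s S)" by blast
  then show "v \<in> wachs (2 * m)"
    using wachs_of_paired[of v "2 * m"] uncentre_signed[OF dbl_centred[OF d(1)]] paired_dbl by simp
qed

lemma wachs_odd_iff:
  "v \<in> wachs (2 * m + 1) \<longleftrightarrow> (\<exists>P s S. slot m P \<and> dbl_data m s S \<and> v = uncentre (ins m P (dbl s S)))"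
proof
  assume v: "v \<in> wachs (2 * m + 1)"
  then have s: "v \<in> signed_perms (2 * m + 1)" by (simp add: wachs_def)
  have "paired m (centre v)" using paired_of_wachs[OF v] by simp
  then obtain P s S where "slot m P" "dbl_data m s S" "centre v = ins m P (dbl s S)"
    using ins_of_paired[OF centre_centred[OF s]] by blast
  then show "\<exists>P s S. slot m P \<and> dbl_data m s S \<and> v = uncentre (ins m P (dbl s S))"
    using uncentre_centre[OF s] by metis
next
  assume "\<exists>P s S. slot m P \<and> dbl_data m s S \<and> v = uncentre (ins m P (dbl s S))"
  then obtain P s S where d: "slot m P" "dbl_data m s S" "v = uncentre (ins m P (dbl s S))" by blast
  have "ins m P (dbl s S) \<in> centred (2 * m + 1)"
    using ins_centred[OF dbl_centred[OF d(2)]] d(1) by (simp add: slot_height)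
  then show "v \<in> wachs (2 * m + 1)"
    using wachs_of_paired[of v "2 * m + 1"] uncentre_signed paired_ins[OF d(2,1)] d(3) by simp
qed

lemma length_W_even:
  assumes "dbl_data m s S"
  shows "2 * length_W (2 * m) (uncentre (dbl s S)) = wlen m s S"
  using length_dbl[OF assms] even_component_eq[OF assms] by (simp add: length_W_def wachs_component_def)

lemma length_W_odd:
  assumes d: "dbl_data m s S" and P: "slot m P"
  shows "2 * length_W (2 * m + 1) (uncentre (ins m P (dbl s S))) = wlen m s S + 2 * (2 * int m - P)"
proof -
  note z = dbl_centred[OF d]
  have h: "height P \<le> 2 * int m" using P by (simp add: slot_height)
  have "wachs_component (2 * m + 1) (uncentre (ins m P (dbl s S))) = uncentre s"
    unfolding wachs_component_def delete_max_ins[OF z h] using even_component_eq[OF d] by simp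
  then show ?thesis
    using length_dbl[OF d] length_B_centre[OF uncentre_signed[OF z]]
      length_B_centre[OF uncentre_signed[OF ins_centred[OF z h]]] invs_ins[OF z h]
    by (simp add: length_W_def)
qed

lemma wachs_order_iff:
  "(u, v) \<in> wachs_order n \<longleftrightarrow> u \<in> wachs n \<and> v \<in> wachs n \<and> rk_le (centre u) (centre v)"
  by (auto simp: wachs_order_def bruhat_iff_rk_le wachs_def)

lemma partial_order_wachs: "partial_order_on (wachs n) (wachs_order n)"
proof -
  have "antisym (wachs_order n)"
  proof (rule antisymI)
    fix u v assume "(u, v) \<in> wachs_order n" "(v, u) \<in> wachs_order n"
    then have *: "u \<in> signed_perms n" "v \<in> signed_perms n" "rk_le (centre u) (centre v)" "rk_le (centre v) (centre u)"
      by (auto simp: wachs_order_iff wachs_def)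
    then show "u = v" using rk_le_antisym[OF centre_centred centre_centred] centre_inj by blast
  qed
  moreover have "refl_on (wachs n) (wachs_order n)"
    by (auto simp: refl_on_def wachs_order_iff rk_le_def)
  moreover have "trans (wachs_order n)"
    unfolding trans_def wachs_order_iff rk_le_def by (meson order_trans)
  moreover have "wachs_order n \<subseteq> wachs n \<times> wachs n" by (auto simp: wachs_order_iff)
  ultimately show ?thesis by (simp add: partial_order_on_def preorder_on_def)
qed

lemma wachs_step:
  assumes "u \<in> wachs n" "v \<in> wachs n" "(u, v) \<in> wachs_order n" "u \<noteq> v"
  shows "\<exists>w\<in>wachs n. (u, w) \<in> wachs_order n \<and> (w, v) \<in> wachs_order n \<and> length_W n w = length_W n u + 1"
proof (cases "even n")
  case True
  then obtain m where n: "n = 2 * m" by (elim evenE)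
  obtain s S where u: "dbl_data m s S" "u = uncentre (dbl s S)" using assms(1) by (auto simp: n wachs_even_iff)
  obtain t T where v: "dbl_data m t T" "v = uncentre (dbl t T)" using assms(2) by (auto simp: n wachs_even_iff)
  have "rk_le (dbl s S) (dbl t T)" using assms(3) u v by (simp add: wachs_order_iff)
  moreover have "\<not> (s = t \<and> S = T)" using assms(4) u v by auto
  ultimately obtain s' S' where w: "dbl_data m s' S'" "rk_le (dbl s S) (dbl s' S')"
    "rk_le (dbl s' S') (dbl t T)" "wlen m s' S' = wlen m s S + 2"
    using even_step[OF u(1) v(1)] by blast
  let ?w = "uncentre (dbl s' S')"
  have "?w \<in> wachs n" using w(1) by (auto simp: n wachs_even_iff)
  moreover have "length_W n ?w = length_W n u + 1"
    using length_W_even[OF w(1)] length_W_even[OF u(1)] w(4) unfolding n u(2) by simp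
  ultimately show ?thesis using w assms u v by (intro bexI[of _ ?w]) (simp_all add: wachs_order_iff)
next
  case False
  then obtain m where n: "n = 2 * m + 1" by (elim oddE)
  obtain P s S where u: "slot m P" "dbl_data m s S" "u = uncentre (ins m P (dbl s S))"
    using assms(1) unfolding n wachs_odd_iff by blast
  obtain Q t T where v: "slot m Q" "dbl_data m t T" "v = uncentre (ins m Q (dbl t T))"
    using assms(2) unfolding n wachs_odd_iff by blast
  have "rk_le (ins m P (dbl s S)) (ins m Q (dbl t T))" using assms(3) u v by (simp add: wachs_order_iff)
  moreover have "\<not> (P = Q \<and> s = t \<and> S = T)" using assms(4) u v by auto
  ultimately obtain P' s' S' where w: "slot m P'" "dbl_data m s' S'"
    "rk_le (ins m P (dbl s S)) (ins m P' (dbl s' S'))" "rk_le (ins m P' (dbl s' S')) (ins m Q (dbl t T))"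
    "wlen m s' S' - 2 * P' = wlen m s S - 2 * P + 2"
    using odd_step[OF u(2) v(2) u(1) v(1)] by blast
  let ?w = "uncentre (ins m P' (dbl s' S'))"
  have "?w \<in> wachs n" using w(1,2) unfolding n wachs_odd_iff by blast
  moreover have "length_W n ?w = length_W n u + 1"
    using length_W_odd[OF w(2,1)] length_W_odd[OF u(2,1)] w(5) unfolding n u(3) by simp
  ultimately show ?thesis using w assms u v by (intro bexI[of _ ?w]) (simp_all add: wachs_order_iff)
qed

lemma wachs_id:
  "uncentre id \<in> wachs n" "length_W n (uncentre id) = 0"
proof -
  have "uncentre id \<in> wachs n \<and> length_W n (uncentre id) = 0"
  proof (cases "even n")
    case True
    then obtain m where n: "n = 2 * m" by (elim evenE)
    have "uncentre id \<in> wachs n" unfolding n wachs_even_iff using data_id[of m] dbl_id by metis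
    then show ?thesis using length_W_even[OF data_id[of m]] by (simp add: n dbl_id wlen_id)
  next
    case False
    then obtain m where n: "n = 2 * m + 1" by (elim oddE)
    have P: "slot m (2 * int m)" by (simp add: slot_def)
    have "uncentre id \<in> wachs n"
      unfolding n wachs_odd_iff using P data_id[of m] dbl_id ins_id by metis
    then show ?thesis using length_W_odd[OF data_id[of m] P] by (simp add: n dbl_id ins_id wlen_id)
  qed
  then show "uncentre id \<in> wachs n" "length_W n (uncentre id) = 0" by auto
qed

lemma wachs_longest:
  "uncentre (longest n) \<in> wachs n" "length_W n (uncentre (longest n)) = int (n\<^sup>2 - (n div 2)\<^sup>2)"
proof -
  have "uncentre (longest n) \<in> wachs n \<and> length_W n (uncentre (longest n)) = int (n\<^sup>2 - (n div 2)\<^sup>2)"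
  proof (cases "even n")
    case True
    then obtain m where n: "n = 2 * m" by (elim evenE)
    have "uncentre (longest n) \<in> wachs n" unfolding n wachs_even_iff using data_longest[of m] dbl_longest by metis
    moreover have "(2 * m)\<^sup>2 - m\<^sup>2 = 3 * m\<^sup>2" by (simp add: power2_eq_square)
    ultimately show ?thesis using length_W_even[OF data_longest[of m]] by (simp add: n dbl_longest wlen_longest)
  next
    case False
    then obtain m where n: "n = 2 * m + 1" by (elim oddE)
    have P: "slot m (- 1 - 2 * int m)" by (simp add: slot_def)
    have "uncentre (longest n) \<in> wachs n"
      unfolding n wachs_odd_iff using P data_longest[of m] dbl_longest[of m] ins_longest[of m] by metis
    moreover have "n div 2 = m" "(2 * m + 1)\<^sup>2 - m\<^sup>2 = 3 * m\<^sup>2 + 4 * m + 1"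
      by (simp_all add: n power2_eq_square)
    ultimately show ?thesis
      using length_W_odd[OF data_longest[of m] P] unfolding n dbl_longest ins_longest wlen_longest by simp
  qed
  then show "uncentre (longest n) \<in> wachs n" "length_W n (uncentre (longest n)) = int (n\<^sup>2 - (n div 2)\<^sup>2)" by auto
qed

lemma finite_wachs: "finite (wachs n)"
proof (rule finite_subset)
  show "wachs n \<subseteq> {w. w permutes signed_range n}" by (auto simp: wachs_def signed_perms_def)
  show "finite {w. w permutes signed_range n}" by (rule finite_permutations) (simp add: signed_range_def)
qed

theorem theorem4p10:
  fixes n :: nat
  assumes "n \<ge> 1"
  shows "graded_poset (wachs n) (wachs_order n) (n\<^sup>2 - (n div 2)\<^sup>2) \<and>
         rank_function (wachs n) (wachs_order n) (length_W n)"
proof (rule graded_by_rank_steps[OF finite_wachs partial_order_wachs wachs_step])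
  show "uncentre id \<in> wachs n" "length_W n (uncentre id) = 0" by (rule wachs_id)+
  show "uncentre (longest n) \<in> wachs n" "length_W n (uncentre (longest n)) = int (n\<^sup>2 - (n div 2)\<^sup>2)" by (rule wachs_longest)+
  fix v assume v: "v \<in> wachs n"
  then have c: "centre v \<in> centred n" by (simp add: wachs_def centre_centred)
  show "(uncentre id, v) \<in> wachs_order n"
    using v wachs_id(1) rk_le_id[OF c] by (simp add: wachs_order_iff)
  show "(v, uncentre (longest n)) \<in> wachs_order n"
    using v wachs_longest(1) rk_le_longest[OF c] by (simp add: wachs_order_iff)
qed

end
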